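(* The following decision problem is solvable in polynomial time: given a one-player game $G=(S_1,S_2,E,w)$ with $S_2=\emptyset$ (weights encoded in binary), an initial state $s_{init}$ and a threshold $t\in\mathbb{Q}$, decide whether player 1 has a winning strategy from $s_{init}$ for the objective $\mathrm{AvgEnergy}(t)$.
   Context: A game is a tuple $G=(S_1,S_2,E,w)$ where $S_1,S_2$ are disjoint finite sets of states (belonging to player 1 and player 2 respectively), $S=S_1\uplus S_2$, $E\subseteq S\times S$ is a set of edges such that every $s\in S$ has at least one $s'$ with $(s,s')\in E$, and $w\colon E\to\mathbb{Z}$ is a weight function. A play from $s_{init}$ is an infinite sequence $\pi=s_0s_1s_2\dots$ with $s_0=s_{init}$ and $(s_i,s_{i+1})\in E$ for all $i$; $\pi(n)=s_0\dots s_n$ denotes its prefix with $n$ edges. The energy level is $\mathrm{EL}(\pi(n))=\sum_{i=0}^{n-1}w(s_i,s_{i+1})$, and the average-energy of a play is $\overline{\mathrm{AE}}(\pi)=\limsup_{n\to\infty}\frac1n\sum_{i=1}^{n}\mathrm{EL}(\pi(i))$. A strategy of player $i$ maps every finite prefix whose last state is in $S_i$ to a successor of that last state. A strategy of player 1 is winning from $s_{init}$ for an objective $\mathcal{W}$ (a set of plays) if every play from $s_{init}$ consistent with it belongs to $\mathcal{W}$. The average-energy objective is $\mathrm{AvgEnergy}(t)=\{\pi\mid \overline{\mathrm{AE}}(\pi)\le t\}$. *)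

theory Defs
  imports Complex_Main "HOL-Library.Extended_Real"
begin

section \<open>Weighted games\<close>

record 'v game =
  states1 :: "'v set"
  states2 :: "'v set"
  edges :: "('v \<times> 'v) set"
  weight :: "'v \<times> 'v \<Rightarrow> int"  \<comment> \<open>only the values on \<open>edges\<close> matter\<close>

definition states :: "('v, 'm) game_scheme \<Rightarrow> 'v set" where
  "states G = states1 G \<union> states2 G"

definition is_game :: "('v, 'm) game_scheme \<Rightarrow> bool" where
  "is_game G \<longleftrightarrow>
     finite (states1 G) \<and> finite (states2 G) \<and> states1 G \<inter> states2 G = {} \<and>
     edges G \<subseteq> states G \<times> states G \<and>
     (\<forall>s \<in> states G. \<exists>s'. (s, s') \<in> edges G)"

definition is_play :: "('v, 'm) game_scheme \<Rightarrow> (nat \<Rightarrow> 'v) \<Rightarrow> bool" where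
  "is_play G \<pi> \<longleftrightarrow> (\<forall>i. (\<pi> i, \<pi> (Suc i)) \<in> edges G)"

definition is_play_from :: "('v, 'm) game_scheme \<Rightarrow> 'v \<Rightarrow> (nat \<Rightarrow> 'v) \<Rightarrow> bool" where
  "is_play_from G s \<pi> \<longleftrightarrow> is_play G \<pi> \<and> \<pi> 0 = s"

text \<open>The prefix with \<open>n\<close> edges, that is, with \<open>n + 1\<close> states.\<close>

definition play_prefix :: "(nat \<Rightarrow> 'v) \<Rightarrow> nat \<Rightarrow> 'v list" where
  "play_prefix \<pi> n = map \<pi> [0..<Suc n]"

definition is_prefix :: "('v, 'm) game_scheme \<Rightarrow> 'v list \<Rightarrow> bool" where
  "is_prefix G \<rho> \<longleftrightarrow> (\<exists>\<pi> n. is_play G \<pi> \<and> \<rho> = play_prefix \<pi> n)"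

text \<open>The second argument is the set of states of the player to whom the strategy belongs.\<close>

definition is_strategy :: "('v, 'm) game_scheme \<Rightarrow> 'v set \<Rightarrow> ('v list \<Rightarrow> 'v) \<Rightarrow> bool" where
  "is_strategy G A \<sigma> \<longleftrightarrow>
     (\<forall>\<rho>. is_prefix G \<rho> \<and> last \<rho> \<in> A \<longrightarrow> (last \<rho>, \<sigma> \<rho>) \<in> edges G)"

definition is_consistent :: "'v set \<Rightarrow> ('v list \<Rightarrow> 'v) \<Rightarrow> (nat \<Rightarrow> 'v) \<Rightarrow> bool" where
  "is_consistent A \<sigma> \<pi> \<longleftrightarrow> (\<forall>n. \<pi> n \<in> A \<longrightarrow> \<pi> (Suc n) = \<sigma> (play_prefix \<pi> n))"

definition is_winning1 ::
    "('v, 'm) game_scheme \<Rightarrow> 'v \<Rightarrow> (nat \<Rightarrow> 'v) set \<Rightarrow> ('v list \<Rightarrow> 'v) \<Rightarrow> bool" where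
  "is_winning1 G s W \<sigma> \<longleftrightarrow>
     (\<forall>\<pi>. is_play_from G s \<pi> \<and> is_consistent (states1 G) \<sigma> \<pi> \<longrightarrow> \<pi> \<in> W)"

definition player1_wins :: "('v, 'm) game_scheme \<Rightarrow> 'v \<Rightarrow> (nat \<Rightarrow> 'v) set \<Rightarrow> bool" where
  "player1_wins G s W \<longleftrightarrow> (\<exists>\<sigma>. is_strategy G (states1 G) \<sigma> \<and> is_winning1 G s W \<sigma>)"

definition energy_level :: "('v, 'm) game_scheme \<Rightarrow> (nat \<Rightarrow> 'v) \<Rightarrow> nat \<Rightarrow> int" where
  "energy_level G \<pi> n = (\<Sum>i<n. weight G (\<pi> i, \<pi> (Suc i)))"

text \<open>Average-energy may be infinite in either direction, hence the extended reals.\<close>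

definition avg_energy :: "('v, 'm) game_scheme \<Rightarrow> (nat \<Rightarrow> 'v) \<Rightarrow> ereal" where
  "avg_energy G \<pi> =
     limsup (\<lambda>n. ereal (1 / real n * (\<Sum>i = 1..n. real_of_int (energy_level G \<pi> i))))"

definition AvgEnergy :: "('v, 'm) game_scheme \<Rightarrow> rat \<Rightarrow> (nat \<Rightarrow> 'v) set" where
  "AvgEnergy G t = {\<pi>. is_play G \<pi> \<and> avg_energy G \<pi> \<le> ereal (of_rat t)}"


section \<open>Deterministic multi-tape Turing machines and polynomial time\<close>

datatype direction = Left | Stay | Right

text \<open>
  Tape symbols are natural numbers: 0 is the blank, 1 and 2 stand for the input bits 0 and 1.
  The transition function is only ever applied to a state from the finite set
  \<open>tm_states\<close> and a list of \<open>tm_tapes\<close> symbols from the finite set \<open>tm_symbols\<close>, so it is a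
  finite table. It yields the next state and, for each tape, the symbol to write and the
  head movement.
\<close>

record tm =
  tm_tapes :: nat
  tm_states :: "nat set"
  tm_symbols :: "nat set"
  tm_start :: nat
  tm_accept :: nat
  tm_reject :: nat
  tm_delta :: "nat \<Rightarrow> nat list \<Rightarrow> nat \<times> (nat \<times> direction) list"

definition is_tm :: "tm \<Rightarrow> bool" where
  "is_tm M \<longleftrightarrow>
     0 < tm_tapes M \<and>
     finite (tm_states M) \<and> finite (tm_symbols M) \<and> {0, 1, 2} \<subseteq> tm_symbols M \<and>
     {tm_start M, tm_accept M, tm_reject M} \<subseteq> tm_states M \<and>
     tm_accept M \<noteq> tm_reject M \<and>
     (\<forall>q \<in> tm_states M. \<forall>xs. length xs = tm_tapes M \<and> set xs \<subseteq> tm_symbols M \<longrightarrow>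
        (case tm_delta M q xs of (q', acts) \<Rightarrow>
           q' \<in> tm_states M \<and> length acts = tm_tapes M \<and> fst ` set acts \<subseteq> tm_symbols M))"

text \<open>A two-way infinite tape: head position and cell contents.\<close>

type_synonym tape = "int \<times> (int \<Rightarrow> nat)"
type_synonym tm_config = "nat \<times> tape list"

fun tape_read :: "tape \<Rightarrow> nat" where
  "tape_read (h, c) = c h"

fun head_offset :: "direction \<Rightarrow> int" where
  "head_offset Left = -1"
| "head_offset Stay = 0"
| "head_offset Right = 1"

fun tape_act :: "nat \<times> direction \<Rightarrow> tape \<Rightarrow> tape" where
  "tape_act (a, d) (h, c) = (h + head_offset d, c(h := a))"

fun tm_step :: "tm \<Rightarrow> tm_config \<Rightarrow> tm_config" where
  "tm_step M (q, ts) =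
     (if q = tm_accept M \<or> q = tm_reject M then (q, ts)
      else case tm_delta M q (map tape_read ts) of (q', acts) \<Rightarrow> (q', map2 tape_act acts ts))"

definition input_tape :: "bool list \<Rightarrow> tape" where
  "input_tape x =
     (0, \<lambda>i. if 0 \<le> i \<and> i < int (length x) then (if x ! nat i then 2 else 1) else 0)"

definition tm_init :: "tm \<Rightarrow> bool list \<Rightarrow> tm_config" where
  "tm_init M x = (tm_start M, input_tape x # replicate (tm_tapes M - 1) (0, \<lambda>_. 0))"

text \<open>
  The accepting and the rejecting state are halting, so being there after exactly \<open>n\<close> steps means
  having got there within \<open>n\<close> steps.
\<close>

definition decides_in_time :: "tm \<Rightarrow> bool list set \<Rightarrow> (nat \<Rightarrow> nat) \<Rightarrow> bool" where
  "decides_in_time M L T \<longleftrightarrow>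
     (\<forall>x. fst ((tm_step M ^^ T (length x)) (tm_init M x)) =
            (if x \<in> L then tm_accept M else tm_reject M))"

definition PTIME :: "bool list set set" where
  "PTIME = {L. \<exists>M c d. is_tm M \<and> decides_in_time M L (\<lambda>n. c * n ^ d + c)}"


section \<open>Binary encoding of problem instances\<close>

text \<open>Least significant bit first, without superfluous zeros; 0 is the empty word.\<close>

fun nat_bits :: "nat \<Rightarrow> bool list" where
  "nat_bits n = (if n = 0 then [] else odd n # nat_bits (n div 2))"

declare nat_bits.simps [simp del]

definition int_bits :: "int \<Rightarrow> bool list" where
  "int_bits k = (k < 0) # nat_bits (nat \<bar>k\<bar>)"

datatype token = Bit bool | Comma | Semicolon

fun token_bits :: "token \<Rightarrow> bool list" where
  "token_bits (Bit b) = [False, b]"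
| "token_bits Comma = [True, False]"
| "token_bits Semicolon = [True, True]"

definition field :: "bool list \<Rightarrow> token list" where
  "field bs = map Bit bs @ [Comma]"

text \<open>
  States are named by binary words. A game is written as the list of states of player 1, the list
  of states of player 2, and the list of edges with their weights, each in some order and
  without repetitions. The threshold is a fraction that need not be in lowest terms.
\<close>

definition instance_tokens ::
    "bool list list \<Rightarrow> bool list list \<Rightarrow> (bool list \<times> bool list) list \<Rightarrow>
     (bool list \<times> bool list \<Rightarrow> int) \<Rightarrow> bool list \<Rightarrow> int \<Rightarrow> nat \<Rightarrow> token list" where
  "instance_tokens vs1 vs2 es w s p q =
     concat (map field vs1) @ [Semicolon] @
     concat (map field vs2) @ [Semicolon] @
     concat (map (\<lambda>(u, v). field u @ field v @ field (int_bits (w (u, v)))) es) @ [Semicolon] @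
     field s @ field (int_bits p) @ field (nat_bits q)"

definition encodes :: "bool list \<Rightarrow> bool list game \<Rightarrow> bool list \<Rightarrow> rat \<Rightarrow> bool" where
  "encodes x G s t \<longleftrightarrow>
     (\<exists>vs1 vs2 es p q.
        distinct vs1 \<and> set vs1 = states1 G \<and>
        distinct vs2 \<and> set vs2 = states2 G \<and>
        distinct es \<and> set es = edges G \<and>
        0 < q \<and> t = of_int p / of_nat q \<and>
        x = concat (map token_bits (instance_tokens vs1 vs2 es (weight G) s p q)))"

end

theory Submission
  imports Defs
begin

text \<open>
  With only one player, winning means that some play from the initial state \<open>s\<close> has average-energy at
  most \<open>t = p / q\<close>. A reachable negative cycle gives average-energy \<open>-\<infinity>\<close>. Otherwise let \<open>d v\<close> be the
  weight of a shortest path from \<open>s\<close> to \<open>v\<close>. Along any play the energy level at \<open>v\<close> is \<open>d v\<close> plus a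
  nondecreasing amount; the average is finite only if this amount is eventually constant, and then the
  play eventually uses only tight edges, those with \<open>d v = d u + w (u, v)\<close>. So a winning play exists iff
  some cycle of tight edges has mean \<open>d\<close>-value at most \<open>p / q\<close>, that is, iff with \<open>k\<close> states the weights
  \<open>k * (q * d u - p) - 1\<close> on the tight edges admit a negative cycle. Both searches for negative cycles are
  runs of the Bellman-Ford algorithm.

  For the Turing machine, a language of stack programs is implemented with one tape per stack, the
  control states being the lists of commands still to be executed. Data are binary trees, written in
  prefix notation on a stack. Functions computed in polynomial time by such programs are closed under
  composition, pairing, case distinction and folding over a list, the last as long as the accumulator
  stays of polynomial size; this suffices to program the algorithm.
\<close>

text \<open>A play need not be periodic, so a lower bound on its average cannot be read off a single
  cycle. It comes from a potential instead: when the second search finds no negative cycle, its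
  table satisfies \<open>t.dist b \<le> t.dist a + w' (a, b)\<close> on tight edges. Summed along
  the tail of a play this telescopes, and since the potential takes finitely many values on the
  reached vertices, the partial sums of k * (q * EL - p) - 1 stay bounded below; the average-energy
  then exceeds p / q by at least 1 / (k * q). Conversely, a lasso around a suitable cycle has
  partial sums of q * EL - p that are bounded above, so its averages exceed p / q by an error of
  order 1 / n only. Both directions thus replace the limes superior by bounds on sums of integers.

  On the machine side the danger lies in iteration: a polynomial step repeated polynomially often
  may still produce exponentially large data. Every fold therefore needs a size bound on all its
  intermediate results; for Bellman-Ford there is one because a round lengthens the numbers by at
  most one bit.\<close>

section \<open>Stack programs and Turing machines\<close>

text \<open>\<open>Put\<close> writes on the cell under the head. It is not a stack operation and occurs only as the second half of
  \<open>Push\<close>, which takes two steps of the machine: the head moves left, then it writes.\<close>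

datatype com =
    Put nat nat
  | Push nat nat
  | Pop nat
  | Seq com com (infixr ";;" 60)
  | Ite nat nat com com
  | While nat nat com

fun top :: "nat list \<Rightarrow> nat" where
  "top [] = 0"
| "top (a # xs) = a"

text \<open>The number in \<open>exec\<close> is an upper bound on the number of machine steps.\<close>

inductive exec :: "com \<Rightarrow> (nat \<Rightarrow> nat list) \<Rightarrow> nat \<Rightarrow> (nat \<Rightarrow> nat list) \<Rightarrow> bool" where
  Push: "i < 4 \<Longrightarrow> exec (Push i a) s 2 (s(i := a # s i))"
| Pop: "i < 4 \<Longrightarrow> exec (Pop i) s 1 (s(i := tl (s i)))"
| Seq: "exec c s m s' \<Longrightarrow> exec d s' n s'' \<Longrightarrow> exec (c ;; d) s (Suc (m + n)) s''"
| IteTrue: "i < 4 \<Longrightarrow> top (s i) = a \<Longrightarrow> exec c s n s' \<Longrightarrow> exec (Ite i a c d) s (Suc n) s'"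
| IteFalse: "i < 4 \<Longrightarrow> top (s i) \<noteq> a \<Longrightarrow> exec d s n s' \<Longrightarrow> exec (Ite i a c d) s (Suc n) s'"
| WhileStop: "i < 4 \<Longrightarrow> top (s i) = a \<Longrightarrow> exec (While i a c) s 1 s"
| WhileStep: "i < 4 \<Longrightarrow> top (s i) \<noteq> a \<Longrightarrow> exec c s m s' \<Longrightarrow> exec (While i a c) s' n s'' \<Longrightarrow>
    exec (While i a c) s (Suc (m + n)) s''"
| Weaken: "exec c s m s' \<Longrightarrow> m \<le> n \<Longrightarrow> exec c s n s'"

fun idle :: "nat list \<Rightarrow> (nat \<times> direction) list" where
  "idle xs = map (\<lambda>x. (x, Stay)) xs"

fun cont_step :: "com list \<Rightarrow> nat list \<Rightarrow> com list \<times> (nat \<times> direction) list" where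
  "cont_step [] xs = ([], idle xs)"
| "cont_step (Put i a # k) xs = (k, (idle xs)[i := (a, Stay)])"
| "cont_step (Push i a # k) xs = (Put i a # k, (idle xs)[i := (xs ! i, Left)])"
| "cont_step (Pop i # k) xs = (k, (idle xs)[i := (xs ! i, Right)])"
| "cont_step ((c ;; d) # k) xs = (c # d # k, idle xs)"
| "cont_step (Ite i a c d # k) xs = ((if xs ! i = a then c else d) # k, idle xs)"
| "cont_step (While i a c # k) xs = ((if xs ! i = a then k else c # While i a c # k), idle xs)"

text \<open>The command lists that can remain while \<open>c\<close> runs in front of
  \<open>k\<close>. There are finitely many although a loop may run arbitrarily often, because its
  body runs in front of the loop itself and so leads back to the same list. The list
  \<open>k\<close>, reached when \<open>c\<close> is finished, is left out; hence the later
  \<open>insert k\<close> and \<open>insert []\<close>.\<close>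

fun conts :: "com \<Rightarrow> com list \<Rightarrow> com list set" where
  "conts (Put i a) k = {Put i a # k}"
| "conts (Push i a) k = {Push i a # k, Put i a # k}"
| "conts (Pop i) k = {Pop i # k}"
| "conts (c ;; d) k = {(c ;; d) # k} \<union> conts c (d # k) \<union> conts d k"
| "conts (Ite i a c d) k = {Ite i a c d # k} \<union> conts c k \<union> conts d k"
| "conts (While i a c) k = {While i a c # k} \<union> conts c (While i a c # k)"

fun symbols :: "com \<Rightarrow> nat set" where
  "symbols (Put i a) = {a}"
| "symbols (Push i a) = {a}"
| "symbols (Pop i) = {}"
| "symbols (c ;; d) = symbols c \<union> symbols d"
| "symbols (Ite i a c d) = symbols c \<union> symbols d"
| "symbols (While i a c) = symbols c"

lemma finite_conts: "finite (conts c k)"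
  by (induction c arbitrary: k) auto

lemma finite_symbols: "finite (symbols c)"
  by (induction c) auto

lemma Cons_in_conts: "c # k \<in> conts c k"
  by (cases c) auto

lemma cont_step_closed:
  "l \<in> conts c k \<Longrightarrow> fst (cont_step l xs) \<in> insert k (conts c k)"
proof (induction c arbitrary: k)
  case (Seq c d)
  show ?case using Seq.prems Seq.IH(1)[of "d # k"] Seq.IH(2)[of k] Cons_in_conts[of c "d # k"]
      Cons_in_conts[of d k] by auto
next
  case (Ite i a c d)
  show ?case using Ite.prems Ite.IH(1)[of k] Ite.IH(2)[of k] Cons_in_conts[of c k]
      Cons_in_conts[of d k] by auto
next
  case (While i a c)
  show ?case using While.prems While.IH[of "While i a c # k"]
      Cons_in_conts[of c "While i a c # k"] by (auto split: if_splits)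
qed auto

lemma cont_step_symbols:
  assumes "l \<in> conts c k" "set xs \<subseteq> A" "symbols c \<subseteq> A" "\<forall>d \<in> set k. symbols d \<subseteq> A"
  shows "\<forall>d \<in> set l. symbols d \<subseteq> A"
    and "\<forall>d \<in> set (fst (cont_step l xs)). symbols d \<subseteq> A"
    and "fst ` set (snd (cont_step l xs)) \<subseteq> A"
    and "length (snd (cont_step l xs)) = length xs"
proof -
  show *: "\<forall>d \<in> set l. symbols d \<subseteq> A"
    using assms
  proof (induction c arbitrary: k)
    case (Seq c d)
    have s: "symbols c \<subseteq> A" "symbols d \<subseteq> A" "\<forall>e \<in> set (d # k). symbols e \<subseteq> A"
      using Seq.prems(3,4) by auto
    consider "l = (c ;; d) # k" | "l \<in> conts c (d # k)" | "l \<in> conts d k"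
      using Seq.prems(1) by auto
    then show ?case
    proof cases
      case 1
      then show ?thesis using Seq.prems(3,4) by simp
    next
      case 2
      show ?thesis by (rule Seq.IH(1)[OF 2 Seq.prems(2) s(1,3)])
    next
      case 3
      show ?thesis by (rule Seq.IH(2)[OF 3 Seq.prems(2) s(2) Seq.prems(4)])
    qed
  next
    case (Ite i a c d)
    have s: "symbols c \<subseteq> A" "symbols d \<subseteq> A" using Ite.prems(3) by auto
    consider "l = Ite i a c d # k" | "l \<in> conts c k" | "l \<in> conts d k"
      using Ite.prems(1) by auto
    then show ?case
    proof cases
      case 1
      then show ?thesis using Ite.prems(3,4) by simp
    next
      case 2
      show ?thesis by (rule Ite.IH(1)[OF 2 Ite.prems(2) s(1) Ite.prems(4)])
    next
      case 3
      show ?thesis by (rule Ite.IH(2)[OF 3 Ite.prems(2) s(2) Ite.prems(4)])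
    qed
  next
    case (While i a c)
    have s: "symbols c \<subseteq> A" "\<forall>e \<in> set (While i a c # k). symbols e \<subseteq> A"
      using While.prems(3,4) by auto
    consider "l = While i a c # k" | "l \<in> conts c (While i a c # k)"
      using While.prems(1) by auto
    then show ?case
    proof cases
      case 1
      then show ?thesis using While.prems(3,4) by simp
    next
      case 2
      show ?thesis by (rule While.IH[OF 2 While.prems(2) s])
    qed
  qed auto
  show "\<forall>d \<in> set (fst (cont_step l xs)). symbols d \<subseteq> A"
  proof (cases l)
    case (Cons e k)
    then have "symbols e \<subseteq> A" "\<forall>d \<in> set k. symbols d \<subseteq> A" using * by simp_all
    then show ?thesis unfolding Cons by (cases e) simp_all
  qed simp
  have upd: "fst ` set ((idle xs)[i := (b, e)]) \<subseteq> insert b A" for i b e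
  proof -
    have "fst ` set ((idle xs)[i := (b, e)]) \<subseteq> fst ` insert (b, e) (set (idle xs))"
      by (rule image_mono[OF set_update_subset_insert])
    also have "\<dots> \<subseteq> insert b A" using assms(2) by auto
    finally show ?thesis .
  qed
  have nth: "fst ` set ((idle xs)[i := (xs ! i, e)]) \<subseteq> A" for i e
  proof (cases "i < length xs")
    case True
    then have "insert (xs ! i) A = A" using assms(2) nth_mem[of i xs] by blast
    then show ?thesis using upd[of i "xs ! i" e] by simp
  next
    case False
    then show ?thesis using assms(2) by (auto simp: list_update_beyond)
  qed
  have idle: "fst ` set (idle xs) \<subseteq> A" using assms(2) by auto
  show "fst ` set (snd (cont_step l xs)) \<subseteq> A"
  proof (cases l)
    case (Cons e k)
    have "insert b A = A" if "e = Put i b" for i b using * Cons that by auto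
    then show ?thesis unfolding Cons using upd nth idle
      by (cases e) (simp_all del: idle.simps, metis)
  qed (use idle in \<open>simp del: idle.simps\<close>)
  show "length (snd (cont_step l xs)) = length xs"
  proof (cases l)
    case (Cons e k)
    then show ?thesis by (cases e) simp_all
  qed simp
qed

section \<open>Translation of programs into Turing machines\<close>

definition cont_code :: "com \<Rightarrow> com list \<Rightarrow> nat" where
  "cont_code c = (SOME f. inj_on f (insert [] (conts c [])))"

definition cont_decode :: "com \<Rightarrow> nat \<Rightarrow> com list" where
  "cont_decode c = inv_into (insert [] (conts c [])) (cont_code c)"

text \<open>The numbers 0 and 1 are the halting states, so the codes of command lists are shifted by
  2. When no command is left, the verdict is read off stack 0: the symbol 1 there is the tree
  \<open>Leaf\<close>, which stands for \<open>False\<close>, and leads to the rejecting state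
  1.\<close>

definition machine_delta :: "com \<Rightarrow> nat \<Rightarrow> nat list \<Rightarrow> nat \<times> (nat \<times> direction) list" where
  "machine_delta c q xs =
    (if q < 2 then (q, idle xs)
     else let k = cont_decode c (q - 2) in
       if k = [] then (if xs ! 0 = 1 then 1 else 0, idle xs)
       else case cont_step k xs of (k', acts) \<Rightarrow> (cont_code c k' + 2, acts))"

definition machine :: "com \<Rightarrow> tm" where
  "machine c = \<lparr>tm_tapes = 4,
     tm_states = {0, 1} \<union> (\<lambda>k. cont_code c k + 2) ` insert [] (conts c []),
     tm_symbols = {0, 1, 2} \<union> symbols c,
     tm_start = cont_code c [c] + 2, tm_accept = 0, tm_reject = 1,
     tm_delta = machine_delta c\<rparr>"

lemma inj_cont_code: "inj_on (cont_code c) (insert [] (conts c []))"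
proof -
  have "\<exists>f :: com list \<Rightarrow> nat. inj_on f (insert [] (conts c []))"
    using finite_imp_inj_to_nat_seg[of "insert [] (conts c [])"] finite_conts by auto
  then show ?thesis unfolding cont_code_def by (rule someI_ex)
qed

lemma cont_decode_code: "k \<in> insert [] (conts c []) \<Longrightarrow> cont_decode c (cont_code c k) = k"
  unfolding cont_decode_def using inv_into_f_f[OF inj_cont_code] .

lemma is_tm_machine: "is_tm (machine c)"
proof -
  let ?A = "{0, 1, 2} \<union> symbols c"
  have "case machine_delta c q xs of (q', acts) \<Rightarrow>
           q' \<in> tm_states (machine c) \<and> length acts = 4 \<and> fst ` set acts \<subseteq> ?A"
    if q: "q \<in> tm_states (machine c)" and xs: "length xs = 4" "set xs \<subseteq> ?A" for q xs
  proof (cases "q < 2")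
    case True
    then show ?thesis using q xs by (auto simp: machine_delta_def)
  next
    case False
    then obtain k where k: "k \<in> insert [] (conts c [])" "q = cont_code c k + 2"
      using q by (auto simp: machine_def)
    show ?thesis
    proof (cases "k = []")
      case True
      then show ?thesis using k xs cont_decode_code[OF k(1)]
        by (auto simp: machine_delta_def machine_def)
    next
      case False
      then have k1: "k \<in> conts c []" using k by auto
      have "fst (cont_step k xs) \<in> insert [] (conts c [])" by (rule cont_step_closed[OF k1])
      moreover have "fst ` set (snd (cont_step k xs)) \<subseteq> ?A"
        by (rule cont_step_symbols(3)[OF k1 xs(2)]) auto
      moreover have "length (snd (cont_step k xs)) = 4"
        using cont_step_symbols(4)[OF k1 xs(2)] xs by auto
      ultimately show ?thesis using k False cont_decode_code[OF k(1)]
        by (auto simp: machine_delta_def machine_def image_subset_iff split: prod.splits)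
    qed
  qed
  then show ?thesis unfolding is_tm_def
    by (auto simp: machine_def finite_conts finite_symbols Cons_in_conts)
qed

text \<open>The part of the tape to the left of the head is junk left behind by earlier pops.\<close>

definition holds_stack :: "tape \<Rightarrow> nat list \<Rightarrow> bool" where
  "holds_stack t xs \<longleftrightarrow>
     (\<forall>j. snd t (fst t + int j) = (if j < length xs then xs ! j else 0))"

definition holds_stacks :: "tape list \<Rightarrow> (nat \<Rightarrow> nat list) \<Rightarrow> bool" where
  "holds_stacks ts s \<longleftrightarrow> length ts = 4 \<and> (\<forall>i < 4. holds_stack (ts ! i) (s i))"

text \<open>The machine with command lists in place of their codes. On the empty list it idles,
  whereas the machine proceeds to its verdict.\<close>

fun cont_run :: "com list \<times> tape list \<Rightarrow> com list \<times> tape list" where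
  "cont_run (k, ts) = (case cont_step k (map tape_read ts) of (k', acts) \<Rightarrow> (k', map2 tape_act acts ts))"

lemma tape_act_idle: "tape_act (tape_read t, Stay) t = t"
  by (cases t) auto

lemma map2_idle: "map2 tape_act (idle (map tape_read ts)) ts = ts"
  by (rule nth_equalityI) (auto simp: tape_act_idle)

lemma map2_idle_update:
  "i < length ts \<Longrightarrow>
   map2 tape_act ((idle (map tape_read ts))[i := p]) ts = ts[i := tape_act p (ts ! i)]"
  by (rule nth_equalityI) (auto simp: tape_act_idle nth_list_update)

lemma tape_read_top: "holds_stack t xs \<Longrightarrow> tape_read t = top xs"
  unfolding holds_stack_def by (cases t; cases xs) (auto dest: spec[of _ 0])

lemma holds_stacks_top: "holds_stacks ts s \<Longrightarrow> i < 4 \<Longrightarrow> map tape_read ts ! i = top (s i)"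
  by (simp add: holds_stacks_def tape_read_top)

lemma holds_stack_pop:
  assumes "holds_stack t xs"
  shows "holds_stack (tape_act (tape_read t, Right) t) (tl xs)"
proof (cases t)
  case (Pair h c)
  have "c (h + 1 + int j) = (if j < length (tl xs) then tl xs ! j else 0)" for j
    using assms[unfolded holds_stack_def, rule_format, of "Suc j"] Pair
    by (auto simp: nth_tl algebra_simps)
  then show ?thesis using Pair by (auto simp: holds_stack_def)
qed

lemma holds_stack_push:
  assumes "holds_stack t xs"
  shows "holds_stack (tape_act (a, Stay) (tape_act (tape_read t, Left) t)) (a # xs)"
proof (cases t)
  case (Pair h c)
  have "(c(h - 1 := a)) (h - 1 + int j) = (if j < length (a # xs) then (a # xs) ! j else 0)" for j
    using assms[unfolded holds_stack_def, rule_format, of "j - 1"] Pair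
    by (cases j) (auto simp: algebra_simps)
  then show ?thesis using Pair by (auto simp: holds_stack_def)
qed

lemma holds_stacks_update:
  "holds_stacks ts s \<Longrightarrow> i < 4 \<Longrightarrow> holds_stack t xs \<Longrightarrow> holds_stacks (ts[i := t]) (s(i := xs))"
  by (auto simp: holds_stacks_def nth_list_update)

text \<open>The claim is made for every \<open>k\<close>, so that the hypothesis for a subcommand
  can be used with the rest of a sequence or with the loop itself as continuation. The number in
  \<open>exec\<close> is only an upper bound, hence the actual step count \<open>n'\<close>.\<close>

lemma cont_run_exec:
  assumes "exec c s n s'" "holds_stacks ts s"
  shows "\<exists>n' \<le> n. \<exists>ts'. holds_stacks ts' s' \<and> (\<forall>k. (cont_run ^^ n') (c # k, ts) = (k, ts'))"
  using assms
proof (induction arbitrary: ts rule: exec.induct)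
  case (Push i a s)
  define t where "t = tape_act (tape_read (ts ! i), Left) (ts ! i)"
  have len: "i < length ts" using Push by (auto simp: holds_stacks_def)
  have run: "cont_run (Push i a # k, ts) = (Put i a # k, ts[i := t])" for k
    using len map2_idle_update[OF len] by (simp add: t_def del: idle.simps)
  have run': "cont_run (Put i a # k, ts[i := t]) = (k, ts[i := tape_act (a, Stay) t])" for k
    using len map2_idle_update[of i "ts[i := t]"] by (simp del: idle.simps tape_act.simps)
  have "holds_stacks (ts[i := tape_act (a, Stay) t]) (s(i := a # s i))"
    using Push unfolding t_def by (intro holds_stacks_update holds_stack_push) (auto simp: holds_stacks_def)
  moreover have R: "(cont_run ^^ 2) (Push i a # k, ts) = (k, ts[i := tape_act (a, Stay) t])" for k
    using run[of k] run'[of k] by (simp add: numeral_2_eq_2 del: cont_run.simps)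
  ultimately show ?case by (intro exI[of _ 2] conjI exI[of _ "ts[i := tape_act (a, Stay) t]"] allI) (simp_all del: funpow.simps cont_run.simps fun_upd_apply)
next
  case (Pop i s)
  have len: "i < length ts" using Pop by (auto simp: holds_stacks_def)
  let ?ts = "ts[i := tape_act (tape_read (ts ! i), Right) (ts ! i)]"
  have "cont_run (Pop i # k, ts) = (k, ?ts)" for k
    using len map2_idle_update[OF len] by (simp del: idle.simps)
  moreover have "holds_stacks ?ts (s(i := tl (s i)))"
    using Pop by (intro holds_stacks_update holds_stack_pop) (auto simp: holds_stacks_def)
  ultimately show ?case by (intro exI[of _ 1] conjI exI[of _ ?ts] allI) (simp_all del: cont_run.simps fun_upd_apply)
next
  case (Seq c s m s' d n s'')
  from Seq.IH(1)[OF Seq.prems] obtain m' ts1 where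
    1: "m' \<le> m" "holds_stacks ts1 s'" "\<And>k. (cont_run ^^ m') (c # k, ts) = (k, ts1)" by blast
  from Seq.IH(2)[OF 1(2)] obtain n' ts2 where
    2: "n' \<le> n" "holds_stacks ts2 s''" "\<And>k. (cont_run ^^ n') (d # k, ts1) = (k, ts2)" by blast
  have "cont_run ((c ;; d) # k, ts) = (c # d # k, ts)" for k by (simp add: map2_idle del: idle.simps)
  then have R: "(cont_run ^^ (n' + (m' + 1))) ((c ;; d) # k, ts) = (k, ts2)" for k
    unfolding funpow_add o_apply using 1(3) 2(3) by (simp del: cont_run.simps)
  show ?case using 1 2 R by (intro exI[of _ "n' + (m' + 1)"] conjI exI[of _ ts2] allI) (auto simp del: funpow.simps cont_run.simps)
next
  case (IteTrue i s a c n s' d)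
  from IteTrue.IH[OF IteTrue.prems] obtain n' ts1 where
    1: "n' \<le> n" "holds_stacks ts1 s'" "\<And>k. (cont_run ^^ n') (c # k, ts) = (k, ts1)" by blast
  have "map tape_read ts ! i = a"
    using IteTrue holds_stacks_top by simp
  then have "cont_run (Ite i a c d # k, ts) = (c # k, ts)" for k by (simp add: map2_idle del: idle.simps)
  then have R: "(cont_run ^^ (n' + 1)) (Ite i a c d # k, ts) = (k, ts1)" for k
    unfolding funpow_add o_apply using 1(3) by (simp del: cont_run.simps)
  show ?case using 1 R by (intro exI[of _ "n' + 1"] conjI exI[of _ ts1] allI) (auto simp del: funpow.simps cont_run.simps)
next
  case (IteFalse i s a d n s' c)
  from IteFalse.IH[OF IteFalse.prems] obtain n' ts1 where
    1: "n' \<le> n" "holds_stacks ts1 s'" "\<And>k. (cont_run ^^ n') (d # k, ts) = (k, ts1)" by blast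
  have "map tape_read ts ! i \<noteq> a"
    using IteFalse holds_stacks_top by simp
  then have "cont_run (Ite i a c d # k, ts) = (d # k, ts)" for k by (simp add: map2_idle del: idle.simps)
  then have R: "(cont_run ^^ (n' + 1)) (Ite i a c d # k, ts) = (k, ts1)" for k
    unfolding funpow_add o_apply using 1(3) by (simp del: cont_run.simps)
  show ?case using 1 R by (intro exI[of _ "n' + 1"] conjI exI[of _ ts1] allI) (auto simp del: funpow.simps cont_run.simps)
next
  case (WhileStop i s a c)
  have "map tape_read ts ! i = a"
    using WhileStop holds_stacks_top by simp
  then have "cont_run (While i a c # k, ts) = (k, ts)" for k by (simp add: map2_idle del: idle.simps)
  then show ?case using WhileStop by (intro exI[of _ 1] conjI exI[of _ ts] allI) (auto simp del: cont_run.simps)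
next
  case (WhileStep i s a c m s' n s'')
  from WhileStep.IH(1)[OF WhileStep.prems] obtain m' ts1 where
    1: "m' \<le> m" "holds_stacks ts1 s'" "\<And>k. (cont_run ^^ m') (c # k, ts) = (k, ts1)" by blast
  from WhileStep.IH(2)[OF 1(2)] obtain n' ts2 where
    2: "n' \<le> n" "holds_stacks ts2 s''" "\<And>k. (cont_run ^^ n') (While i a c # k, ts1) = (k, ts2)"
    by blast
  have "map tape_read ts ! i \<noteq> a"
    using WhileStep holds_stacks_top by simp
  then have "cont_run (While i a c # k, ts) = (c # While i a c # k, ts)" for k
    by (simp add: map2_idle del: idle.simps)
  then have R: "(cont_run ^^ (n' + (m' + 1))) (While i a c # k, ts) = (k, ts2)" for k
    unfolding funpow_add o_apply using 1(3) 2(3) by (simp del: cont_run.simps)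
  show ?case using 1 2 R by (intro exI[of _ "n' + (m' + 1)"] conjI exI[of _ ts2] allI) (auto simp del: funpow.simps cont_run.simps)
next
  case (Weaken c s m s' n)
  then show ?case by (meson order_trans)
qed

lemma machine_step:
  assumes "k \<in> conts c []" "cont_run (k, ts) = (k', ts')" "k \<noteq> []"
  shows "tm_step (machine c) (cont_code c k + 2, ts) = (cont_code c k' + 2, ts')"
    and "k' \<in> insert [] (conts c [])"
proof -
  show "k' \<in> insert [] (conts c [])"
    using cont_step_closed[OF assms(1), of "map tape_read ts"] assms(2) by (auto split: prod.splits)
  show "tm_step (machine c) (cont_code c k + 2, ts) = (cont_code c k' + 2, ts')"
    using assms cont_decode_code[of k c]
    by (auto simp: machine_def machine_delta_def split: prod.splits)
qed

lemma cont_run_Nil: "(cont_run ^^ n) ([], ts) = ([], ts)"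
  by (induction n) (auto simp: map2_idle simp del: idle.simps)

text \<open>The count may shrink: \<open>cont_run\<close> can spend its remaining steps idling on
  the empty list, while the machine would leave the state of that list in its next step.\<close>

lemma machine_run:
  assumes "k \<in> conts c []" "(cont_run ^^ n) (k, ts) = ([], ts')"
  shows "\<exists>n' \<le> n. (tm_step (machine c) ^^ n') (cont_code c k + 2, ts) = (cont_code c [] + 2, ts')"
  using assms
proof (induction n arbitrary: k ts)
  case 0
  then show ?case by auto
next
  case (Suc n)
  obtain k1 ts1 where step: "cont_run (k, ts) = (k1, ts1)" by fastforce
  have rest: "(cont_run ^^ n) (k1, ts1) = ([], ts')"
    using Suc.prems(2) step by (simp add: funpow_Suc_right del: funpow.simps cont_run.simps)
  show ?case
  proof (cases "k = []")
    case True
    then show ?thesis using Suc.prems cont_run_Nil[of "Suc n" ts]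
      by (intro exI[of _ 0]) (auto simp del: funpow.simps)
  next
    case False
    note ms = machine_step[OF Suc.prems(1) step False]
    show ?thesis
    proof (cases "k1 = []")
      case True
      have "ts1 = ts'" using rest True cont_run_Nil[of n ts1] by auto
      then show ?thesis using ms(1) True by (intro exI[of _ 1]) auto
    next
      case F: False
      then obtain n' where "n' \<le> n"
        "(tm_step (machine c) ^^ n') (cont_code c k1 + 2, ts1) = (cont_code c [] + 2, ts')"
        using Suc.IH[OF _ rest] ms(2) by auto
      then show ?thesis using ms(1)
        by (intro exI[of _ "Suc n'"]) (auto simp: funpow_Suc_right simp del: funpow.simps tm_step.simps)
    qed
  qed
qed

definition input_store :: "bool list \<Rightarrow> nat \<Rightarrow> nat list" where
  "input_store x = (\<lambda>_. [])(0 := map (\<lambda>b. if b then 2 else 1) x)"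

lemma holds_stacks_init: "holds_stacks (snd (tm_init (machine c) x)) (input_store x)"
proof -
  have "holds_stack (input_tape x) (map (\<lambda>b. if b then 2 else 1) x)"
    by (auto simp: holds_stack_def input_tape_def)
  moreover have "holds_stack (0, \<lambda>_. 0) []" by (auto simp: holds_stack_def)
  ultimately show ?thesis
    by (auto simp: holds_stacks_def tm_init_def machine_def input_store_def nth_Cons split: nat.splits)
qed

lemma tm_step_halted:
  "fst cf = tm_accept M \<or> fst cf = tm_reject M \<Longrightarrow> (tm_step M ^^ n) cf = cf"
  by (cases cf, induction n) auto

text \<open>The bound is strict because one more step leads from the empty command list to the
  verdict. Halting configurations are fixed points of \<open>tm_step\<close>, so the verdict is
  still there at time \<open>T'\<close>.\<close>

lemma decides_in_time_machine:
  assumes "\<And>x. exec c (input_store x) (T (length x)) (s x)"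
    and "\<And>x. top (s x 0) = 1 \<longleftrightarrow> x \<notin> L"
    and "\<And>n. T n < T' n"
  shows "decides_in_time (machine c) L T'"
  unfolding decides_in_time_def
proof
  fix x
  let ?M = "machine c"
  let ?halt = "if x \<in> L then tm_accept ?M else tm_reject ?M"
  obtain n' ts' where 1: "n' \<le> T (length x)" "holds_stacks ts' (s x)"
    "(cont_run ^^ n') ([c], snd (tm_init ?M x)) = ([], ts')"
    using cont_run_exec[OF assms(1)[of x] holds_stacks_init[of c x]] by blast
  obtain n where n: "n \<le> n'" "(tm_step ?M ^^ n) (tm_init ?M x) = (cont_code c [] + 2, ts')"
    using machine_run[OF _ 1(3)] Cons_in_conts[of c "[]"] by (auto simp: tm_init_def machine_def)
  have len: "0 < length ts'" "map tape_read ts' ! 0 = top (s x 0)"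
    using 1(2) holds_stacks_top[OF 1(2), of 0] by (auto simp: holds_stacks_def)
  have "fst (tm_step ?M (cont_code c [] + 2, ts')) = ?halt"
    using len assms(2)[of x] cont_decode_code[of "[]" c]
    by (auto simp: machine_def machine_delta_def)
  then have halt: "fst ((tm_step ?M ^^ Suc n) (tm_init ?M x)) = ?halt" using n by simp
  obtain m where "T' (length x) = m + Suc n"
    using n(1) 1(1) assms(3)[of "length x"] le_Suc_ex[of "Suc n" "T' (length x)"] by fastforce
  then have "(tm_step ?M ^^ T' (length x)) (tm_init ?M x) = (tm_step ?M ^^ Suc n) (tm_init ?M x)"
    using tm_step_halted[of "(tm_step ?M ^^ Suc n) (tm_init ?M x)" ?M m] halt
    unfolding \<open>T' (length x) = m + Suc n\<close> funpow_add o_apply by presburger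
  then show "fst ((tm_step ?M ^^ T' (length x)) (tm_init ?M x)) = ?halt" using halt by presburger
qed


section \<open>Polynomial bounds\<close>

definition poly_bounded :: "(nat \<Rightarrow> nat) \<Rightarrow> bool" where
  "poly_bounded p \<longleftrightarrow> mono p \<and> (\<exists>a d. \<forall>n. p n \<le> a * (n + 1) ^ d)"

lemma poly_bounded_const: "poly_bounded (\<lambda>_. c)"
  unfolding poly_bounded_def by (intro conjI monoI exI[of _ c] exI[of _ 0]) auto

lemma poly_bounded_id: "poly_bounded (\<lambda>n. n)"
  unfolding poly_bounded_def by (auto intro!: monoI exI[of _ 1])

lemma poly_bounded_add:
  assumes "poly_bounded p" "poly_bounded q"
  shows "poly_bounded (\<lambda>n. p n + q n)"
proof -
  obtain a d b e where p: "\<And>n. p n \<le> a * (n + 1) ^ d" and q: "\<And>n. q n \<le> b * (n + 1) ^ e"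
    using assms unfolding poly_bounded_def by blast
  have "p n + q n \<le> (a + b) * (n + 1) ^ (max d e)" for n
  proof -
    have "a * (n + 1) ^ d \<le> a * (n + 1) ^ max d e" "b * (n + 1) ^ e \<le> b * (n + 1) ^ max d e"
      by (intro mult_left_mono power_increasing; simp)+
    then show ?thesis using p[of n] q[of n] unfolding add_mult_distrib by linarith
  qed
  moreover have "mono (\<lambda>n. p n + q n)"
    using assms unfolding poly_bounded_def by (auto intro!: monoI add_mono dest: monoD)
  ultimately show ?thesis unfolding poly_bounded_def by blast
qed

lemma poly_bounded_mult:
  assumes "poly_bounded p" "poly_bounded q"
  shows "poly_bounded (\<lambda>n. p n * q n)"
proof -
  obtain a d b e where p: "\<And>n. p n \<le> a * (n + 1) ^ d" and q: "\<And>n. q n \<le> b * (n + 1) ^ e"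
    using assms unfolding poly_bounded_def by blast
  have "p n * q n \<le> (a * b) * (n + 1) ^ (d + e)" for n
    using mult_mono[OF p[of n] q[of n]] by (simp add: power_add mult_ac)
  moreover have "mono (\<lambda>n. p n * q n)"
    using assms unfolding poly_bounded_def by (auto intro!: monoI mult_mono dest: monoD)
  ultimately show ?thesis unfolding poly_bounded_def by blast
qed

lemma poly_bounded_comp:
  assumes "poly_bounded p" "poly_bounded q"
  shows "poly_bounded (\<lambda>n. p (q n))"
proof -
  obtain a d b e where p: "\<And>n. p n \<le> a * (n + 1) ^ d" and q: "\<And>n. q n \<le> b * (n + 1) ^ e"
    using assms unfolding poly_bounded_def by blast
  have "p (q n) \<le> (a * (b + 1) ^ d) * (n + 1) ^ (e * d)" for n
  proof -
    have "q n + 1 \<le> (b + 1) * (n + 1) ^ e"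
      using q[of n] by (simp add: add_mult_distrib add_mono del: add_Suc_right)
    then have "(q n + 1) ^ d \<le> ((b + 1) * (n + 1) ^ e) ^ d" by (rule power_mono) simp
    also have "\<dots> = (b + 1) ^ d * (n + 1) ^ (e * d)" by (simp only: power_mult_distrib power_mult)
    finally have "a * (q n + 1) ^ d \<le> a * ((b + 1) ^ d * (n + 1) ^ (e * d))" by (rule mult_left_mono) simp
    then show ?thesis using p[of "q n"] by (simp only: mult.assoc)
  qed
  moreover have "mono (\<lambda>n. p (q n))"
    using assms unfolding poly_bounded_def by (auto intro!: monoI dest: monoD)
  ultimately show ?thesis unfolding poly_bounded_def by blast
qed

text \<open>The reason for demanding monotonicity: a bound in the size of an intermediate result may
  be replaced by its value at a bound for that size.\<close>

lemma poly_bounded_mono: "poly_bounded p \<Longrightarrow> m \<le> n \<Longrightarrow> p m \<le> p n"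
  unfolding poly_bounded_def by (auto dest: monoD)

lemma poly_bounded_Suc: "poly_bounded p \<Longrightarrow> poly_bounded (\<lambda>n. Suc (p n))"
  using poly_bounded_add[OF _ poly_bounded_const[of 1]] by simp

lemmas poly_bounded_intros = poly_bounded_const poly_bounded_id poly_bounded_add poly_bounded_mult
  poly_bounded_Suc


section \<open>Programs on binary trees\<close>

datatype tree = Leaf | Node tree tree

text \<open>Only the symbols 1 and 2 occur, so 0 signals the bottom of a stack. Prefix notation
  delimits itself: a tree can be taken off the stack whatever lies below it.\<close>

fun ser :: "tree \<Rightarrow> nat list" where
  "ser Leaf = [1]"
| "ser (Node a b) = 2 # ser a @ ser b"

fun tsize :: "tree \<Rightarrow> nat" where
  "tsize Leaf = 1"
| "tsize (Node a b) = Suc (tsize a + tsize b)"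

lemma length_ser [simp]: "length (ser t) = tsize t"
  by (induction t) auto

lemma set_ser: "set (ser t) \<subseteq> {1, 2}"
  by (induction t) auto

lemma tsize_pos [simp]: "0 < tsize t"
  by (cases t) auto

definition stacks :: "nat list \<Rightarrow> nat list \<Rightarrow> nat list \<Rightarrow> nat list \<Rightarrow> nat \<Rightarrow> nat list" where
  "stacks v a b c = (\<lambda>_. [])(0 := v, 1 := a, 2 := b, 3 := c)"

lemma stacks_simps [simp]:
  "stacks v a b c 0 = v" "stacks v a b c (Suc 0) = a" "stacks v a b c 2 = b" "stacks v a b c 3 = c"
  "(stacks v a b c)(0 := x) = stacks x a b c" "(stacks v a b c)(Suc 0 := x) = stacks v x b c"
  "(stacks v a b c)(2 := x) = stacks v a x c" "(stacks v a b c)(3 := x) = stacks v a b x"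
  by (auto simp: stacks_def)

lemma exec_Push: "i < 4 \<Longrightarrow> s' = s(i := a # s i) \<Longrightarrow> exec (Push i a) s 2 s'"
  using exec.Push by simp

lemma exec_Pop: "i < 4 \<Longrightarrow> s' = s(i := tl (s i)) \<Longrightarrow> exec (Pop i) s 1 s'"
  using exec.Pop by simp

lemma exec_Ite:
  "i < 4 \<Longrightarrow> (top (s i) = a \<Longrightarrow> exec c s n s') \<Longrightarrow> (top (s i) \<noteq> a \<Longrightarrow> exec d s n s') \<Longrightarrow>
   exec (Ite i a c d) s (Suc n) s'"
  using exec.IteTrue exec.IteFalse by blast

section \<open>Stack routines that drop, copy and swap trees\<close>

definition discard :: "nat \<Rightarrow> com" where
  "discard i = While i 0 (Pop i)"

definition drain :: "nat \<Rightarrow> nat \<Rightarrow> com" where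
  "drain i j = While i 0 (Ite i 1 (Pop i ;; Push j 1) (Pop i ;; Push j 2))"

definition drain2 :: "nat \<Rightarrow> nat \<Rightarrow> nat \<Rightarrow> com" where
  "drain2 i j k = While i 0 (Ite i 1 (Pop i ;; Push j 1 ;; Push k 1) (Pop i ;; Push j 2 ;; Push k 2))"

text \<open>Stack 3 holds, in unary, the number of subtrees still to be read: a leaf settles one of
  them, an inner node replaces one by two. Started with the count 1, the loop therefore moves
  exactly one tree from stack 0 to stack 1, reversing it.\<close>

definition scan :: com where
  "scan = While 3 0 (Pop 3 ;; Ite 0 1 (Pop 0 ;; Push 1 1) (Pop 0 ;; Push 1 2 ;; Push 3 1 ;; Push 3 1))"

lemma exec_discard:
  assumes "set xs \<subseteq> {1, 2}" "i < 4"
  shows "exec (discard i) (s(i := xs)) (1 + 2 * length xs) (s(i := []))"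
  using assms(1)
proof (induction xs)
  case Nil
  show ?case unfolding discard_def by (rule exec.Weaken[OF exec.WhileStop]) (use assms in auto)
next
  case (Cons x xs)
  have 1: "exec (discard i) (s(i := xs)) (1 + 2 * length xs) (s(i := []))"
    by (rule Cons.IH) (use Cons.prems in simp)
  have 2: "exec (Pop i) (s(i := x # xs)) 1 (s(i := xs))"
    by (rule exec_Pop) (use assms in auto)
  have "x \<noteq> 0" using Cons by auto
  then show ?case unfolding discard_def
    by (intro exec.Weaken[OF exec.WhileStep[OF assms(2) _ 2 1[unfolded discard_def]]]) auto
qed

lemma exec_drain:
  assumes "set xs \<subseteq> {1, 2}" "i < 4" "j < 4" "i \<noteq> j"
  shows "exec (drain i j) (s(i := xs, j := ys)) (1 + 6 * length xs) (s(i := [], j := rev xs @ ys))"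
  using assms(1)
proof (induction xs arbitrary: ys)
  case Nil
  show ?case unfolding drain_def append_Nil rev.simps list.size by (rule exec.Weaken[OF exec.WhileStop]) (use assms in auto)
next
  case (Cons x xs)
  have 1: "exec (drain i j) (s(i := xs, j := x # ys)) (1 + 6 * length xs)
      (s(i := [], j := rev xs @ x # ys))"
    by (rule Cons.IH) (use Cons.prems in simp)
  have x: "x = 1 \<or> x = 2" using Cons by auto
  have "exec (Pop i ;; Push j y) (s(i := x # xs, j := ys)) (Suc (1 + 2)) (s(i := xs, j := y # ys))" for y
    by (rule exec.Seq, rule exec_Pop[OF assms(2) refl], rule exec_Push[OF assms(3)]) (use assms in auto)
  then have 2: "exec (Ite i 1 (Pop i ;; Push j 1) (Pop i ;; Push j 2)) (s(i := x # xs, j := ys))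
      (Suc (Suc (1 + 2))) (s(i := xs, j := x # ys))"
    using x assms by (intro exec_Ite) auto
  show ?case unfolding drain_def rev.simps append_assoc append.simps
    by (rule exec.Weaken[OF exec.WhileStep[OF assms(2) _ 2 1[unfolded drain_def]]]) (use x assms(4) in auto)
qed

lemma exec_drain2:
  assumes "set xs \<subseteq> {1, 2}"
  shows "exec (drain2 1 0 2) (stacks v xs b c) (1 + 9 * length xs)
    (stacks (rev xs @ v) [] (rev xs @ b) c)"
  using assms(1)
proof (induction xs arbitrary: v b)
  case Nil
  show ?case unfolding drain2_def append_Nil rev.simps list.size by (rule exec.Weaken[OF exec.WhileStop]) auto
next
  case (Cons x xs)
  then have 1: "exec (drain2 1 0 2) (stacks (x # v) xs (x # b) c) (1 + 9 * length xs)
      (stacks (rev (x # xs) @ v) [] (rev (x # xs) @ b) c)" by simp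
  have x: "x = 1 \<or> x = 2" using Cons by auto
  have "exec (Pop 1 ;; Push 0 y ;; Push 2 y) (stacks v (x # xs) b c) (Suc (1 + (Suc (2 + 2))))
      (stacks (y # v) xs (y # b) c)" for y
    by (rule exec.Seq, rule exec_Pop[OF _ refl], simp, rule exec.Seq, rule exec_Push[OF _ refl], simp,
        rule exec_Push) auto
  then have 2: "exec (Ite 1 1 (Pop 1 ;; Push 0 1 ;; Push 2 1) (Pop 1 ;; Push 0 2 ;; Push 2 2))
      (stacks v (x # xs) b c) (Suc (Suc (1 + (Suc (2 + 2))))) (stacks (x # v) xs (x # b) c)"
    using x by (intro exec_Ite) auto
  show ?case
    using exec.WhileStep[OF _ _ 2 1[unfolded drain2_def]] x by (auto simp add: drain2_def)
qed

text \<open>The loop does not stop between the two subtrees of a node. So the lemma reasons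
  backwards, from a run that starts behind the tree to one that starts in front of it, and the
  hypotheses for the two subtrees can be chained.\<close>

lemma exec_scan_tree:
  assumes "exec scan (stacks v (rev (ser t) @ a) b c) n s"
  shows "exec scan (stacks (ser t @ v) a b (1 # c)) (n + 14 * tsize t) s"
  using assms
proof (induction t arbitrary: v a c n)
  case Leaf
  have 1: "exec (Pop 3 ;; Ite 0 1 (Pop 0 ;; Push 1 1) (Pop 0 ;; Push 1 2 ;; Push 3 1 ;; Push 3 1))
      (stacks (1 # v) a b (1 # c)) (Suc (1 + Suc (Suc (1 + 2)))) (stacks v (1 # a) b c)"
    by (rule exec.Seq, rule exec_Pop[OF _ refl], simp, rule exec.IteTrue, simp, simp,
        rule exec.Seq, rule exec_Pop[OF _ refl], simp, rule exec_Push) auto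
  have 2: "exec scan (stacks (1 # v) a b (1 # c)) (Suc (Suc (1 + Suc (Suc (1 + 2))) + n)) s"
  proof -
    have "exec scan (stacks v (1 # a) b c) n s" using Leaf by simp
    from exec.WhileStep[OF _ _ 1 this[unfolded scan_def]] show ?thesis by (simp add: scan_def)
  qed
  show ?case using exec.Weaken[OF 2, of "n + 14 * tsize Leaf"] by simp
next
  case (Node t u)
  have 1: "exec (Pop 3 ;; Ite 0 1 (Pop 0 ;; Push 1 1) (Pop 0 ;; Push 1 2 ;; Push 3 1 ;; Push 3 1))
      (stacks (2 # ser t @ ser u @ v) a b (1 # c)) (Suc (1 + Suc (Suc (1 + Suc (2 + Suc (2 + 2))))))
      (stacks (ser t @ ser u @ v) (2 # a) b (1 # 1 # c))"
    by (rule exec.Seq, rule exec_Pop[OF _ refl], simp, rule exec.IteFalse, simp, simp,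
        rule exec.Seq, rule exec_Pop[OF _ refl], simp, rule exec.Seq, rule exec_Push[OF _ refl], simp,
        rule exec.Seq, rule exec_Push[OF _ refl], simp, rule exec_Push) auto
  have "exec scan (stacks (ser t @ ser u @ v) (2 # a) b (1 # 1 # c)) (n + 14 * tsize u + 14 * tsize t) s"
    by (rule Node.IH(1), rule Node.IH(2)) (use Node.prems in simp)
  from exec.WhileStep[OF _ _ 1 this[unfolded scan_def]]
  have 2: "exec scan (stacks (2 # ser t @ ser u @ v) a b (1 # c))
      (Suc (Suc (1 + Suc (Suc (1 + Suc (2 + Suc (2 + 2))))) + (n + 14 * tsize u + 14 * tsize t))) s"
    by (simp add: scan_def)
  show ?case using exec.Weaken[OF 2, of "n + 14 * tsize (Node t u)"] by simp
qed

lemma exec_scan: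
  "exec (Push 3 1 ;; scan) (stacks (ser t @ v) a b []) (4 + 14 * tsize t)
     (stacks v (rev (ser t) @ a) b [])"
proof -
  have "exec scan (stacks v (rev (ser t) @ a) b []) 1 (stacks v (rev (ser t) @ a) b [])"
    unfolding scan_def by (rule exec.WhileStop) auto
  from exec_scan_tree[OF this]
  have "exec (Push 3 1 ;; scan) (stacks (ser t @ v) a b []) (Suc (2 + (1 + 14 * tsize t)))
      (stacks v (rev (ser t) @ a) b [])"
    by (intro exec.Seq exec_Push) auto
  then show ?thesis by (rule exec.Weaken) simp
qed

abbreviation val_stack :: "nat list \<Rightarrow> nat \<Rightarrow> nat list" where
  "val_stack v \<equiv> stacks v [] [] []"

definition drop_top :: com where
  "drop_top = (Push 3 1 ;; scan) ;; discard 1"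

definition dup_top :: com where
  "dup_top = (Push 3 1 ;; scan) ;; drain2 1 0 2 ;; drain 2 1 ;; drain 1 0"

text \<open>Every move reverses a word, so a tree is readable again only after an even number of
  moves; hence the detour of the first tree over stack 3. It waits on stack 2 meanwhile, because the
  second scan uses stacks 1 and 3.\<close>

definition swap_top :: com where
  "swap_top =
    (Push 3 1 ;; scan) ;; drain 1 2 ;; (Push 3 1 ;; scan) ;; drain 2 3 ;; drain 3 0 ;; drain 1 0"

lemma exec_drop_top: "exec drop_top (val_stack (ser t @ v)) (25 * tsize t) (val_stack v)"
proof -
  have "exec (discard 1) (stacks v (rev (ser t)) [] []) (1 + 2 * tsize t) (val_stack v)"
    using exec_discard[of "rev (ser t)" 1 "stacks v [] [] []"] set_ser[of t] by simp
  from exec.Seq[OF exec_scan[of t v "[]" "[]", simplified] this]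
  have 1: "exec drop_top (val_stack (ser t @ v)) (Suc (4 + 14 * tsize t + (1 + 2 * tsize t))) (val_stack v)"
    by (simp add: drop_top_def)
  show ?thesis by (rule exec.Weaken[OF 1]) (use tsize_pos[of t] in linarith)
qed

lemma exec_dup_top:
  "exec dup_top (val_stack (ser t @ v)) (50 * tsize t) (val_stack (ser t @ ser t @ v))"
proof -
  let ?r = "rev (ser t)"
  have r: "set ?r \<subseteq> {1, 2}" "set (ser t) \<subseteq> {1, 2}" using set_ser[of t] by auto
  have 1: "exec (drain2 1 0 2) (stacks v ?r [] []) (1 + 9 * tsize t) (stacks (ser t @ v) [] (ser t) [])"
    using exec_drain2[OF r(1), of v "[]" "[]"] by simp
  have 2: "exec (drain 2 1) (stacks (ser t @ v) [] (ser t) []) (1 + 6 * tsize t)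
      (stacks (ser t @ v) ?r [] [])"
    using exec_drain[OF r(2), of 2 1 "stacks (ser t @ v) [] [] []" "[]"] by simp
  have 3: "exec (drain 1 0) (stacks (ser t @ v) ?r [] []) (1 + 6 * tsize t)
      (val_stack (ser t @ ser t @ v))"
    using exec_drain[OF r(1), of 1 0 "stacks (ser t @ v) [] [] []" "ser t @ v"] by simp
  from exec.Seq[OF exec_scan[of t v "[]" "[]", simplified] exec.Seq[OF 1 exec.Seq[OF 2 3]]]
  have 4: "exec dup_top (val_stack (ser t @ v)) (Suc (4 + 14 * tsize t + Suc (1 + 9 * tsize t +
     Suc (1 + 6 * tsize t + (1 + 6 * tsize t))))) (val_stack (ser t @ ser t @ v))"
    by (simp add: dup_top_def)
  show ?thesis by (rule exec.Weaken[OF 4]) (use tsize_pos[of t] in linarith)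
qed

lemma exec_swap_top:
  "exec swap_top (val_stack (ser t @ ser u @ v)) (50 * (tsize t + tsize u)) (val_stack (ser u @ ser t @ v))"
proof -
  let ?r = "rev (ser t)" and ?q = "rev (ser u)"
  have r: "set ?r \<subseteq> {1, 2}" "set (ser t) \<subseteq> {1, 2}" "set ?q \<subseteq> {1, 2}"
    using set_ser[of t] set_ser[of u] by auto
  have 1: "exec (drain 1 2) (stacks (ser u @ v) ?r [] []) (1 + 6 * tsize t)
      (stacks (ser u @ v) [] (ser t) [])"
    using exec_drain[OF r(1), of 1 2 "val_stack (ser u @ v)" "[]"] by simp
  have 2: "exec (drain 2 3) (stacks v ?q (ser t) []) (1 + 6 * tsize t) (stacks v ?q [] ?r)"
    using exec_drain[OF r(2), of 2 3 "stacks v ?q [] []" "[]"] by simp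
  have 3: "exec (drain 3 0) (stacks v ?q [] ?r) (1 + 6 * tsize t) (stacks (ser t @ v) ?q [] [])"
    using exec_drain[OF r(1), of 3 0 "stacks v ?q [] []" v] by simp
  have 4: "exec (drain 1 0) (stacks (ser t @ v) ?q [] []) (1 + 6 * tsize u) (val_stack (ser u @ ser t @ v))"
    using exec_drain[OF r(3), of 1 0 "stacks v [] [] []" "ser t @ v"] by simp
  from exec.Seq[OF exec_scan[of t "ser u @ v" "[]" "[]", simplified] exec.Seq[OF 1
      exec.Seq[OF exec_scan[of u v "[]" "ser t", simplified] exec.Seq[OF 2 exec.Seq[OF 3 4]]]]]
  have 5: "exec swap_top (val_stack (ser t @ ser u @ v)) (Suc (4 + 14 * tsize t + Suc (1 + 6 * tsize t +
     Suc (4 + 14 * tsize u + Suc (1 + 6 * tsize t + Suc (1 + 6 * tsize t + (1 + 6 * tsize u)))))))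
     (val_stack (ser u @ ser t @ v))"
    by (simp add: swap_top_def)
  show ?thesis
    by (rule exec.Weaken[OF 5]) (use tsize_pos[of t] tsize_pos[of u] in presburger)
qed

text \<open>The program must leave the rest \<open>v\<close> of the stack untouched, so that it can run in the presence of
  intermediate results of other programs.\<close>

definition tree_polytime :: "'i set \<Rightarrow> ('i \<Rightarrow> tree) \<Rightarrow> ('i \<Rightarrow> tree) \<Rightarrow> bool" where
  "tree_polytime D f g \<longleftrightarrow> (\<exists>c p. poly_bounded p \<and> (\<forall>x \<in> D. \<forall>v. tsize (g x) \<le> p (tsize (f x)) \<and>
     exec c (val_stack (ser (f x) @ v)) (p (tsize (f x))) (val_stack (ser (g x) @ v))))"

lemma tree_polytimeI:
  assumes "poly_bounded p" "poly_bounded q"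
    and "\<And>x v. x \<in> D \<Longrightarrow> tsize (g x) \<le> p (tsize (f x))"
    and "\<And>x v. x \<in> D \<Longrightarrow>
      exec c (val_stack (ser (f x) @ v)) (q (tsize (f x))) (val_stack (ser (g x) @ v))"
  shows "tree_polytime D f g"
  unfolding tree_polytime_def
proof (intro exI conjI ballI allI)
  show "poly_bounded (\<lambda>n. p n + q n)" using assms by (intro poly_bounded_intros)
  fix x v assume x: "x \<in> D"
  show "tsize (g x) \<le> p (tsize (f x)) + q (tsize (f x))" using assms(3)[OF x] by simp
  show "exec c (val_stack (ser (f x) @ v)) (p (tsize (f x)) + q (tsize (f x))) (val_stack (ser (g x) @ v))"
    by (rule exec.Weaken[OF assms(4)[OF x]]) simp
qed

lemma tree_polytimeE:
  assumes "tree_polytime D f g"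
  obtains c p where "poly_bounded p" "\<And>x. x \<in> D \<Longrightarrow> tsize (g x) \<le> p (tsize (f x))"
    "\<And>x v. x \<in> D \<Longrightarrow>
      exec c (val_stack (ser (f x) @ v)) (p (tsize (f x))) (val_stack (ser (g x) @ v))"
  using assms unfolding tree_polytime_def by blast

section \<open>Closure properties of polynomial-time tree functions\<close>

lemma tree_polytime_cong: "tree_polytime D f g \<Longrightarrow> (\<And>x. x \<in> D \<Longrightarrow> f x = f' x) \<Longrightarrow> (\<And>x. x \<in> D \<Longrightarrow> g x = g' x) \<Longrightarrow> tree_polytime D f' g'"
  unfolding tree_polytime_def by simp

lemma tree_polytime_reindex: "tree_polytime E f g \<Longrightarrow> h ` D \<subseteq> E \<Longrightarrow> tree_polytime D (\<lambda>x. f (h x)) (\<lambda>x. g (h x))"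
  unfolding tree_polytime_def by (meson image_subset_iff)

lemma tree_polytime_subset: "tree_polytime E f g \<Longrightarrow> D \<subseteq> E \<Longrightarrow> tree_polytime D f g"
  using tree_polytime_reindex[of E f g "\<lambda>x. x" D] by simp

lemma tree_polytime_comp:
  assumes "tree_polytime D f g" "tree_polytime D g h"
  shows "tree_polytime D f h"
proof -
  obtain c p where p: "poly_bounded p" "\<And>x. x \<in> D \<Longrightarrow> tsize (g x) \<le> p (tsize (f x))"
    "\<And>x v. x \<in> D \<Longrightarrow> exec c (val_stack (ser (f x) @ v)) (p (tsize (f x))) (val_stack (ser (g x) @ v))"
    by (rule tree_polytimeE[OF assms(1)], rule that)
  obtain d q where q: "poly_bounded q" "\<And>x. x \<in> D \<Longrightarrow> tsize (h x) \<le> q (tsize (g x))"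
    "\<And>x v. x \<in> D \<Longrightarrow> exec d (val_stack (ser (g x) @ v)) (q (tsize (g x))) (val_stack (ser (h x) @ v))"
    by (rule tree_polytimeE[OF assms(2)], rule that)
  have le: "q (tsize (g x)) \<le> q (p (tsize (f x)))" if "x \<in> D" for x
    using poly_bounded_mono[OF q(1) p(2)[OF that]] .
  show ?thesis
  proof (rule tree_polytimeI)
    show "poly_bounded (\<lambda>n. q (p n))" by (rule poly_bounded_comp[OF q(1) p(1)])
    then show "poly_bounded (\<lambda>n. Suc (p n + q (p n)))" by (intro poly_bounded_intros p(1))
    show "tsize (h x) \<le> q (p (tsize (f x)))" if "x \<in> D" for x using q(2)[OF that] le[OF that] by simp
    show "exec (c ;; d) (val_stack (ser (f x) @ v)) (Suc (p (tsize (f x)) + q (p (tsize (f x)))))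
      (val_stack (ser (h x) @ v))" if "x \<in> D" for x v
      using exec.Seq[OF p(3)[OF that] exec.Weaken[OF q(3)[OF that] le[OF that]]] .
  qed
qed

lemma tree_polytime_id: "tree_polytime D f f"
proof (rule tree_polytimeI)
  show "poly_bounded (\<lambda>n. n)" "poly_bounded (\<lambda>n. 4)" by (rule poly_bounded_intros)+
  show "exec (Push 1 1 ;; Pop 1) (val_stack (ser (f x) @ v)) 4 (val_stack (ser (f x) @ v))" for x v
    by (rule exec.Weaken, rule exec.Seq, rule exec_Push[OF _ refl], simp, rule exec_Pop) auto
qed simp

lemma tree_polytime_Leaf: "tree_polytime D f (\<lambda>_. Leaf)"
proof (rule tree_polytimeI)
  show "poly_bounded (\<lambda>n. 1)" "poly_bounded (\<lambda>n. Suc (25 * n + 2))" by (intro poly_bounded_intros)+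
  show "exec (drop_top ;; Push 0 1) (val_stack (ser (f x) @ v)) (Suc (25 * tsize (f x) + 2))
      (val_stack (ser Leaf @ v))" for x v
    by (rule exec.Seq, rule exec_drop_top, rule exec_Push) auto
qed simp

lemma tree_polytime_Node:
  assumes "tree_polytime D f g" "tree_polytime D f h"
  shows "tree_polytime D f (\<lambda>x. Node (g x) (h x))"
proof -
  obtain c p where p: "poly_bounded p" "\<And>x. x \<in> D \<Longrightarrow> tsize (g x) \<le> p (tsize (f x))"
    "\<And>x v. x \<in> D \<Longrightarrow> exec c (val_stack (ser (f x) @ v)) (p (tsize (f x))) (val_stack (ser (g x) @ v))"
    by (rule tree_polytimeE[OF assms(1)], rule that)
  obtain d q where q: "poly_bounded q" "\<And>x. x \<in> D \<Longrightarrow> tsize (h x) \<le> q (tsize (f x))"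
    "\<And>x v. x \<in> D \<Longrightarrow> exec d (val_stack (ser (f x) @ v)) (q (tsize (f x))) (val_stack (ser (h x) @ v))"
    by (rule tree_polytimeE[OF assms(2)], rule that)
  let ?time = "\<lambda>n. Suc (50 * n + Suc (p n + Suc (50 * (p n + n) + Suc (q n + Suc (50 * (q n + p n) + 2)))))"
  show ?thesis
  proof (rule tree_polytimeI)
    show "poly_bounded (\<lambda>n. Suc (p n + q n))" "poly_bounded ?time"
      by (intro poly_bounded_intros p(1) q(1))+
    fix x v assume x: "x \<in> D"
    show "tsize (Node (g x) (h x)) \<le> Suc (p (tsize (f x)) + q (tsize (f x)))"
      using p(2)[OF x] q(2)[OF x] by simp
    have 1: "exec swap_top (val_stack (ser (g x) @ ser (f x) @ v)) (50 * (p (tsize (f x)) + tsize (f x)))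
        (val_stack (ser (f x) @ ser (g x) @ v))"
      by (rule exec.Weaken[OF exec_swap_top]) (use p(2)[OF x] in simp)
    have 2: "exec swap_top (val_stack (ser (h x) @ ser (g x) @ v))
        (50 * (q (tsize (f x)) + p (tsize (f x)))) (val_stack (ser (g x) @ ser (h x) @ v))"
      by (rule exec.Weaken[OF exec_swap_top]) (use p(2)[OF x] q(2)[OF x] in simp)
    \<comment> \<open>The second result lands on top of the first, so another swap precedes the
      symbol of the node.\<close>
    show "exec (dup_top ;; c ;; swap_top ;; d ;; swap_top ;; Push 0 2) (val_stack (ser (f x) @ v))
        (?time (tsize (f x))) (val_stack (ser (Node (g x) (h x)) @ v))"
      by (rule exec.Seq[OF exec_dup_top exec.Seq[OF p(3)[OF x] exec.Seq[OF 1 exec.Seq[OF q(3)[OF x]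
            exec.Seq[OF 2 exec_Push]]]]]) auto
  qed
qed

lemma tree_polytime_left: "tree_polytime D (\<lambda>x. Node (f x) (g x)) f"
proof (rule tree_polytimeI)
  show "poly_bounded (\<lambda>n. n)" "poly_bounded (\<lambda>n. Suc (1 + Suc (50 * n + 25 * n)))"
    by (intro poly_bounded_intros)+
  fix x v
  have 1: "exec swap_top (val_stack (ser (f x) @ ser (g x) @ v)) (50 * tsize (Node (f x) (g x)))
      (val_stack (ser (g x) @ ser (f x) @ v))"
    by (rule exec.Weaken[OF exec_swap_top]) simp
  have 2: "exec drop_top (val_stack (ser (g x) @ ser (f x) @ v)) (25 * tsize (Node (f x) (g x)))
      (val_stack (ser (f x) @ v))"
    by (rule exec.Weaken[OF exec_drop_top]) simp
  show "exec (Pop 0 ;; swap_top ;; drop_top) (val_stack (ser (Node (f x) (g x)) @ v))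
     (Suc (1 + Suc (50 * tsize (Node (f x) (g x)) + 25 * tsize (Node (f x) (g x))))) (val_stack (ser (f x) @ v))"
    by (rule exec.Seq[OF exec_Pop exec.Seq[OF 1 2]]) auto
qed simp

lemma tree_polytime_right: "tree_polytime D (\<lambda>x. Node (f x) (g x)) g"
proof (rule tree_polytimeI)
  show "poly_bounded (\<lambda>n. n)" "poly_bounded (\<lambda>n. Suc (1 + 25 * n))"
    by (intro poly_bounded_intros)+
  fix x v
  have 2: "exec drop_top (val_stack (ser (f x) @ ser (g x) @ v)) (25 * tsize (Node (f x) (g x)))
      (val_stack (ser (g x) @ v))"
    by (rule exec.Weaken[OF exec_drop_top]) simp
  show "exec (Pop 0 ;; drop_top) (val_stack (ser (Node (f x) (g x)) @ v))
     (Suc (1 + 25 * tsize (Node (f x) (g x)))) (val_stack (ser (g x) @ v))"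
    by (rule exec.Seq[OF exec_Pop 2]) auto
qed simp

lemma top_ser: "top (ser t @ v) = Suc 0 \<longleftrightarrow> t = Leaf"
  by (cases t) auto

text \<open>Each branch is only required to work on the indices where it is taken. Case distinction
  on lists depends on this, since head and tail can be extracted only where the list is
  nonempty.\<close>

lemma tree_polytime_If:
  assumes "tree_polytime D f b" "tree_polytime {x \<in> D. b x = Leaf} f g" "tree_polytime {x \<in> D. b x \<noteq> Leaf} f h"
  shows "tree_polytime D f (\<lambda>x. if b x = Leaf then g x else h x)"
proof -
  obtain c p where p: "poly_bounded p" "\<And>x. x \<in> D \<Longrightarrow> tsize (b x) \<le> p (tsize (f x))"
    "\<And>x v. x \<in> D \<Longrightarrow> exec c (val_stack (ser (f x) @ v)) (p (tsize (f x))) (val_stack (ser (b x) @ v))"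
    by (rule tree_polytimeE[OF assms(1)], rule that)
  obtain d q where q: "poly_bounded q"
    "\<And>x. x \<in> {x \<in> D. b x = Leaf} \<Longrightarrow> tsize (g x) \<le> q (tsize (f x))"
    "\<And>x v. x \<in> {x \<in> D. b x = Leaf} \<Longrightarrow>
      exec d (val_stack (ser (f x) @ v)) (q (tsize (f x))) (val_stack (ser (g x) @ v))"
    by (rule tree_polytimeE[OF assms(2)], rule that)
  obtain e r where r: "poly_bounded r"
    "\<And>x. x \<in> {x \<in> D. b x \<noteq> Leaf} \<Longrightarrow> tsize (h x) \<le> r (tsize (f x))"
    "\<And>x v. x \<in> {x \<in> D. b x \<noteq> Leaf} \<Longrightarrow>
      exec e (val_stack (ser (f x) @ v)) (r (tsize (f x))) (val_stack (ser (h x) @ v))"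
    by (rule tree_polytimeE[OF assms(3)], rule that)
  let ?branch = "\<lambda>n. Suc (25 * p n + (q n + r n))"
  let ?time = "\<lambda>n. Suc (50 * n + Suc (p n + Suc (?branch n)))"
  show ?thesis
  proof (rule tree_polytimeI)
    show "poly_bounded (\<lambda>n. q n + r n)" "poly_bounded ?time"
      by (intro poly_bounded_intros p(1) q(1) r(1))+
    fix x v assume x: "x \<in> D"
    let ?o = "if b x = Leaf then g x else h x"
    show "tsize ?o \<le> q (tsize (f x)) + r (tsize (f x))"
      using q(2)[of x] r(2)[of x] x by auto
    have drop: "exec drop_top (val_stack (ser (b x) @ ser (f x) @ v)) (25 * p (tsize (f x)))
        (val_stack (ser (f x) @ v))"
      by (rule exec.Weaken[OF exec_drop_top]) (use p(2)[OF x] in simp)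
    have 1: "exec d (val_stack (ser (f x) @ v)) (q (tsize (f x)) + r (tsize (f x)))
        (val_stack (ser ?o @ v))" if "b x = Leaf"
      using exec.Weaken[OF q(3)[of x v]] that x by auto
    have 2: "exec e (val_stack (ser (f x) @ v)) (q (tsize (f x)) + r (tsize (f x)))
        (val_stack (ser ?o @ v))" if "b x \<noteq> Leaf"
      using exec.Weaken[OF r(3)[of x v]] that x by auto
    have "exec (Ite 0 1 (drop_top ;; d) (drop_top ;; e)) (val_stack (ser (b x) @ ser (f x) @ v))
        (Suc (?branch (tsize (f x)))) (val_stack (ser ?o @ v))"
    proof (rule exec_Ite)
      assume "top (val_stack (ser (b x) @ ser (f x) @ v) 0) = 1"
      then have "b x = Leaf" by (simp add: top_ser)
      then show "exec (drop_top ;; d) (val_stack (ser (b x) @ ser (f x) @ v)) (?branch (tsize (f x)))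
          (val_stack (ser ?o @ v))"
        by (intro exec.Seq[OF drop 1])
    next
      assume "top (val_stack (ser (b x) @ ser (f x) @ v) 0) \<noteq> 1"
      then have "b x \<noteq> Leaf" by (auto simp: top_ser)
      then show "exec (drop_top ;; e) (val_stack (ser (b x) @ ser (f x) @ v)) (?branch (tsize (f x)))
          (val_stack (ser ?o @ v))"
        by (intro exec.Seq[OF drop 2])
    qed simp
    from exec.Seq[OF exec_dup_top exec.Seq[OF p(3)[OF x] this]]
    show "exec (dup_top ;; c ;; Ite 0 1 (drop_top ;; d) (drop_top ;; e)) (val_stack (ser (f x) @ v))
        (?time (tsize (f x))) (val_stack (ser ?o @ v))" .
  qed
qed

fun tlength :: "tree \<Rightarrow> nat" where
  "tlength Leaf = 0"
| "tlength (Node a b) = Suc (tlength b)"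

lemma tlength_le: "tlength t \<le> tsize t"
  by (induction t) auto

text \<open>The list \<open>l x\<close> lies on top of the state \<open>y x k\<close> and counts the
  rounds, each of which removes one cell. A polynomial bound for one round says little about the
  iterates, which might double in size each time; hence the separate bound \<open>q\<close> on all
  intermediate states.\<close>

lemma tree_polytime_iter:
  assumes step: "tree_polytime {(x, k). x \<in> D \<and> k < tlength (l x)} (\<lambda>(x, k). y x k) (\<lambda>(x, k). y x (Suc k))"
    and q: "poly_bounded q"
    and size: "\<And>x k. x \<in> D \<Longrightarrow> k \<le> tlength (l x) \<Longrightarrow> tsize (y x k) \<le> q (tsize (Node (l x) (y x 0)))"
  shows "tree_polytime D (\<lambda>x. Node (l x) (y x 0)) (\<lambda>x. y x (tlength (l x)))"
proof -
  let ?E = "{(x, k). x \<in> D \<and> k < tlength (l x)}"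
  obtain c p where cp: "poly_bounded p \<and> (\<forall>z \<in> ?E. \<forall>v.
      tsize ((\<lambda>(x, k). y x (Suc k)) z) \<le> p (tsize ((\<lambda>(x, k). y x k) z)) \<and>
      exec c (val_stack (ser ((\<lambda>(x, k). y x k) z) @ v)) (p (tsize ((\<lambda>(x, k). y x k) z)))
        (val_stack (ser ((\<lambda>(x, k). y x (Suc k)) z) @ v)))"
    using step[unfolded tree_polytime_def] by (elim exE) (rule that)
  then have p: "poly_bounded p" by (rule conjunct1)
  have c: "exec c (val_stack (ser (y x k) @ v)) (p (tsize (y x k))) (val_stack (ser (y x (Suc k)) @ v))"
    if "x \<in> D" "k < tlength (l x)" for x k v
    using cp[THEN conjunct2, THEN bspec, of "(x, k)", THEN spec, of v] that by simp
  let ?body = "Pop 0 ;; drop_top ;; swap_top ;; c ;; swap_top"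
  let ?loop = "While 0 1 ?body"
  let ?R = "\<lambda>n. Suc (1 + Suc (25 * n + Suc (50 * (n + q n) + Suc (p (q n) + 50 * (q n + n)))))"
  let ?time = "\<lambda>n. Suc (1 + Suc (Suc (n * Suc (?R n)) + 1))"
  show ?thesis
  proof (rule tree_polytimeI[OF q])
    show "poly_bounded ?time"
      by (intro poly_bounded_intros p q poly_bounded_comp[OF p q])
    fix x v assume x: "x \<in> D"
    let ?n = "tsize (Node (l x) (y x 0))"
    show "tsize (y x (tlength (l x))) \<le> q ?n" using size[OF x] by simp
    have loop: "exec ?loop (val_stack (ser m @ ser (y x k) @ v)) (Suc (tlength m * Suc (?R ?n)))
        (val_stack (1 # ser (y x (tlength (l x))) @ v))"
      if "k + tlength m = tlength (l x)" "tsize m \<le> ?n" for k m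
      using that
    proof (induction m arbitrary: k)
      case Leaf
      have "exec ?loop (val_stack (1 # ser (y x (tlength (l x))) @ v)) 1
          (val_stack (1 # ser (y x (tlength (l x))) @ v))"
        by (rule exec.WhileStop) auto
      moreover have "k = tlength (l x)" using Leaf by simp
      ultimately show ?case by simp
    next
      case (Node a m)
      have k: "k < tlength (l x)" using Node.prems by simp
      have m: "tsize m \<le> ?n" "tsize a \<le> ?n" using Node.prems by auto
      have yk: "tsize (y x k) \<le> q ?n" "tsize (y x (Suc k)) \<le> q ?n" using size[OF x] k by auto
      have 1: "exec drop_top (val_stack (ser a @ ser m @ ser (y x k) @ v)) (25 * ?n)
          (val_stack (ser m @ ser (y x k) @ v))"
        by (rule exec.Weaken[OF exec_drop_top]) (use m in simp)
      have 2: "exec swap_top (val_stack (ser m @ ser (y x k) @ v)) (50 * (?n + q ?n))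
          (val_stack (ser (y x k) @ ser m @ v))"
        by (rule exec.Weaken[OF exec_swap_top]) (use m yk in simp)
      have 3: "exec c (val_stack (ser (y x k) @ ser m @ v)) (p (q ?n))
          (val_stack (ser (y x (Suc k)) @ ser m @ v))"
        by (rule exec.Weaken[OF c[OF x k] poly_bounded_mono[OF p yk(1)]])
      have 4: "exec swap_top (val_stack (ser (y x (Suc k)) @ ser m @ v)) (50 * (q ?n + ?n))
          (val_stack (ser m @ ser (y x (Suc k)) @ v))"
        by (rule exec.Weaken[OF exec_swap_top]) (use m yk in simp)
      have 5: "exec ?body (val_stack (ser (Node a m) @ ser (y x k) @ v)) (?R ?n)
          (val_stack (ser m @ ser (y x (Suc k)) @ v))"
        by (rule exec.Seq[OF exec_Pop exec.Seq[OF 1 exec.Seq[OF 2 exec.Seq[OF 3 4]]]]) auto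
      have 6: "exec ?loop (val_stack (ser m @ ser (y x (Suc k)) @ v)) (Suc (tlength m * Suc (?R ?n)))
          (val_stack (1 # ser (y x (tlength (l x))) @ v))"
        by (rule Node.IH(2)) (use Node.prems in auto)
      have 7: "exec ?loop (val_stack (ser (Node a m) @ ser (y x k) @ v))
          (Suc (?R ?n + Suc (tlength m * Suc (?R ?n)))) (val_stack (1 # ser (y x (tlength (l x))) @ v))"
        by (rule exec.WhileStep[OF _ _ 5 6]) auto
      show ?case by (rule exec.Weaken[OF 7]) simp
    qed
    have le: "tlength (l x) * Suc (?R ?n) \<le> ?n * Suc (?R ?n)"
      by (rule mult_right_mono) (use tlength_le[of "l x"] in auto)
    have 1: "exec ?loop (val_stack (ser (l x) @ ser (y x 0) @ v)) (Suc (?n * Suc (?R ?n)))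
        (val_stack (1 # ser (y x (tlength (l x))) @ v))"
      by (rule exec.Weaken[OF loop]) (use le in auto)
    \<comment> \<open>The first \<open>Pop\<close> removes the node symbol and thereby exposes the
      counter, the last one removes the \<open>Leaf\<close> that is left of it.\<close>
    show "exec (Pop 0 ;; ?loop ;; Pop 0) (val_stack (ser (Node (l x) (y x 0)) @ v)) (?time ?n)
       (val_stack (ser (y x (tlength (l x))) @ v))"
      by (rule exec.Seq[OF exec_Pop exec.Seq[OF 1 exec_Pop]]) simp_all
  qed
qed


section \<open>Polynomial-time functions\<close>

class data =
  fixes to_tree :: "'a \<Rightarrow> tree"

instantiation bool :: data
begin
definition to_tree_bool :: "bool \<Rightarrow> tree" where "to_tree_bool b = (if b then Node Leaf Leaf else Leaf)"
instance ..
end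

instantiation prod :: (data, data) data
begin
fun to_tree_prod :: "'a \<times> 'b \<Rightarrow> tree" where "to_tree_prod (a, b) = Node (to_tree a) (to_tree b)"
instance ..
end

instantiation list :: (data) data
begin
fun to_tree_list :: "'a list \<Rightarrow> tree" where
  "to_tree_list [] = Leaf"
| "to_tree_list (x # xs) = Node (to_tree x) (to_tree_list xs)"
instance ..
end

abbreviation dsize :: "'a :: data \<Rightarrow> nat" where
  "dsize x \<equiv> tsize (to_tree x)"

definition polytime :: "('a :: data \<Rightarrow> 'b :: data) \<Rightarrow> bool" where
  "polytime f \<longleftrightarrow> tree_polytime UNIV to_tree (\<lambda>x. to_tree (f x))"

lemma dsize_bool: "dsize (b :: bool) \<le> 3"
  by (simp add: to_tree_bool_def)

lemma tlength_to_tree: "tlength (to_tree xs) = length (xs :: 'a :: data list)"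
  by (induction xs) auto

lemma dsize_list: "dsize xs = Suc (\<Sum>x\<leftarrow>xs. Suc (dsize x))"
  by (induction xs) auto

lemma dsize_append: "Suc (dsize (xs @ ys)) = dsize xs + dsize ys"
  by (simp add: dsize_list)

lemma dsize_rev: "dsize (rev xs) = dsize xs"
  by (simp add: dsize_list rev_map[symmetric] sum_list_rev)

lemma length_le_dsize: "length xs \<le> dsize xs"
  by (induction xs) auto

lemma dsize_member: "x \<in> set xs \<Longrightarrow> dsize x \<le> dsize xs"
  by (induction xs) auto

lemma dsize_take: "dsize (take k xs) \<le> dsize xs"
  using dsize_append[of "take k xs" "drop k xs", unfolded append_take_drop_id]
    tsize_pos[of "to_tree (drop k xs)"] by linarith

lemma dsize_drop: "dsize (drop k xs) \<le> dsize xs"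
  using dsize_append[of "take k xs" "drop k xs", unfolded append_take_drop_id]
    tsize_pos[of "to_tree (take k xs)"] by linarith

lemma polytime_tree_polytime: "polytime f \<Longrightarrow> tree_polytime D (\<lambda>x. to_tree (h x)) (\<lambda>x. to_tree (f (h x)))"
  unfolding polytime_def by (rule tree_polytime_reindex) auto

lemma polytime_size:
  assumes "polytime f"
  obtains q where "poly_bounded q" "\<And>x. dsize (f x) \<le> q (dsize x)"
  by (rule tree_polytimeE[OF assms[unfolded polytime_def]]) (rule that; simp)

lemma polytime_comp:
  assumes "polytime g" "polytime f"
  shows "polytime (\<lambda>x. g (f x))"
  unfolding polytime_def using tree_polytime_comp[OF assms(2)[unfolded polytime_def] polytime_tree_polytime[OF assms(1)]] .

lemma polytime_cong: "polytime f \<Longrightarrow> (\<And>x. f x = g x) \<Longrightarrow> polytime g"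
  unfolding polytime_def by (rule tree_polytime_cong) auto

lemma polytime_id: "polytime (\<lambda>x. x)"
  unfolding polytime_def by (rule tree_polytime_id)

lemma tree_polytime_const: "tree_polytime D f (\<lambda>_. t)"
  by (induction t) (auto intro: tree_polytime_Leaf tree_polytime_Node)

lemma polytime_const: "polytime (\<lambda>_. c)"
  unfolding polytime_def by (rule tree_polytime_const)

lemma polytime_Pair: "polytime f \<Longrightarrow> polytime g \<Longrightarrow> polytime (\<lambda>x. (f x, g x))"
  unfolding polytime_def to_tree_prod.simps by (rule tree_polytime_Node)

lemma polytime_Cons: "polytime f \<Longrightarrow> polytime g \<Longrightarrow> polytime (\<lambda>x. f x # g x)"
  unfolding polytime_def to_tree_list.simps by (rule tree_polytime_Node)

lemma polytime_fst:
  assumes "polytime f"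
  shows "polytime (\<lambda>x. fst (f x))"
proof -
  have "to_tree (f x) = Node (to_tree (fst (f x))) (to_tree (snd (f x)))" for x
    by (cases "f x") simp
  then have "tree_polytime UNIV to_tree (\<lambda>x. Node (to_tree (fst (f x))) (to_tree (snd (f x))))"
    using assms unfolding polytime_def by simp
  then show ?thesis unfolding polytime_def by (rule tree_polytime_comp[OF _ tree_polytime_left])
qed

lemma polytime_snd:
  assumes "polytime f"
  shows "polytime (\<lambda>x. snd (f x))"
proof -
  have "to_tree (f x) = Node (to_tree (fst (f x))) (to_tree (snd (f x)))" for x
    by (cases "f x") simp
  then have "tree_polytime UNIV to_tree (\<lambda>x. Node (to_tree (fst (f x))) (to_tree (snd (f x))))"
    using assms unfolding polytime_def by simp
  then show ?thesis unfolding polytime_def by (rule tree_polytime_comp[OF _ tree_polytime_right])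
qed

lemma polytime_If:
  assumes "polytime b" "polytime f" "polytime g"
  shows "polytime (\<lambda>x. if b x then f x else g x)"
proof -
  have "tree_polytime UNIV to_tree (\<lambda>x. if to_tree (b x) = Leaf then to_tree (g x) else to_tree (f x))"
    by (rule tree_polytime_If[OF assms(1)[unfolded polytime_def] tree_polytime_subset[OF assms(3)[unfolded polytime_def] subset_UNIV]
        tree_polytime_subset[OF assms(2)[unfolded polytime_def] subset_UNIV]])
  then show ?thesis unfolding polytime_def
    by (rule tree_polytime_cong) (auto simp: to_tree_bool_def)
qed

lemma polytime_case_list:
  fixes l :: "'a :: data \<Rightarrow> 'b :: data list"
  assumes "polytime l" "polytime f" "polytime (\<lambda>y. g (fst y) (fst (snd y)) (snd (snd y)))"
  shows "polytime (\<lambda>x. case l x of [] \<Rightarrow> f x | a # as \<Rightarrow> g x a as)"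
proof -
  let ?h = "\<lambda>x. (x, hd (l x), tl (l x))"
  have "tree_polytime {x \<in> UNIV. to_tree (l x) \<noteq> Leaf} to_tree (\<lambda>x. Node (to_tree x) (to_tree (l x)))"
    by (rule tree_polytime_Node[OF tree_polytime_id tree_polytime_subset[OF assms(1)[unfolded polytime_def] subset_UNIV]])
  then have "tree_polytime {x \<in> UNIV. to_tree (l x) \<noteq> Leaf} to_tree (\<lambda>x. to_tree (?h x))"
  proof (rule tree_polytime_cong)
    fix x assume "x \<in> {x \<in> UNIV. to_tree (l x) \<noteq> Leaf}"
    then show "Node (to_tree x) (to_tree (l x)) = to_tree (?h x)" by (cases "l x") auto
  qed simp
  from tree_polytime_comp[OF this polytime_tree_polytime[OF assms(3)]]
  have "tree_polytime {x \<in> UNIV. to_tree (l x) \<noteq> Leaf} to_tree (\<lambda>x. to_tree (g x (hd (l x)) (tl (l x))))" by simp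
  then have "tree_polytime UNIV to_tree (\<lambda>x. if to_tree (l x) = Leaf then to_tree (f x) else to_tree (g x (hd (l x)) (tl (l x))))"
    using tree_polytime_If[OF assms(1)[unfolded polytime_def] tree_polytime_subset[OF assms(2)[unfolded polytime_def] subset_UNIV]] by simp
  then show ?thesis unfolding polytime_def
    by (rule tree_polytime_cong) (auto split: list.splits)
qed

lemma polytime_foldl:
  fixes l :: "'a :: data \<Rightarrow> 'b :: data list" and g :: "'a \<Rightarrow> 'c :: data"
  assumes l: "polytime l" and g: "polytime g" and f: "polytime (\<lambda>y. f (fst y) (fst (snd y)) (snd (snd y)))"
    and q: "poly_bounded q" "\<And>x k. dsize (foldl (f x) (g x) (take k (l x))) \<le> q (dsize x)"
  shows "polytime (\<lambda>x. foldl (f x) (g x) (l x))"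
proof -
  let ?acc = "\<lambda>x k. foldl (f x) (g x) (take k (l x))"
  \<comment> \<open>The counter of \<open>tree_polytime_iter\<close> is thrown away cell by cell.
    The state therefore has its own copy of the list, from which the elements are taken, and also
    carries \<open>x\<close>, on which \<open>f\<close> depends.\<close>
  let ?y = "\<lambda>x k. Node (to_tree x) (Node (to_tree (drop k (l x))) (to_tree (?acc x k)))"
  let ?E = "{(x, k). x \<in> UNIV \<and> k < tlength (to_tree (l x))}"
  have 1: "tree_polytime UNIV to_tree (\<lambda>x. Node (to_tree (l x)) (?y x 0))"
    using l g unfolding polytime_def by (intro tree_polytime_Node tree_polytime_id) auto
  have 2: "tree_polytime UNIV (\<lambda>x. Node (to_tree (l x)) (?y x 0)) (\<lambda>x. ?y x (tlength (to_tree (l x))))"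
  proof (rule tree_polytime_iter[where y = ?y])
    show "tree_polytime ?E (\<lambda>(x, k). ?y x k) (\<lambda>(x, k). ?y x (Suc k))"
    proof -
      let ?x = "\<lambda>(x, k). to_tree (x :: 'a)" and ?a = "\<lambda>(x, k). to_tree (?acc x k)"
      let ?h = "\<lambda>(x, k). to_tree (l x ! k)" and ?t = "\<lambda>(x, k). to_tree (drop (Suc k) (l x))"
      let ?yy = "\<lambda>z :: 'a \<times> nat. Node (?x z) (Node (Node (?h z) (?t z)) (?a z))"
      have x: "tree_polytime ?E ?yy ?x" by (rule tree_polytime_left)
      have r: "tree_polytime ?E ?yy (\<lambda>z. Node (Node (?h z) (?t z)) (?a z))" by (rule tree_polytime_right)
      have a: "tree_polytime ?E ?yy ?a" by (rule tree_polytime_comp[OF r tree_polytime_right])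
      have ht: "tree_polytime ?E ?yy (\<lambda>z. Node (?h z) (?t z))" by (rule tree_polytime_comp[OF r tree_polytime_left])
      have h: "tree_polytime ?E ?yy ?h" by (rule tree_polytime_comp[OF ht tree_polytime_left])
      have t: "tree_polytime ?E ?yy ?t" by (rule tree_polytime_comp[OF ht tree_polytime_right])
      have "tree_polytime ?E ?yy (\<lambda>z. Node (?x z) (Node (?a z) (?h z)))" by (intro tree_polytime_Node x a h)
      then have "tree_polytime ?E ?yy (\<lambda>z. to_tree ((\<lambda>(x, k). (x, ?acc x k, l x ! k)) z))"
        by (rule tree_polytime_cong) auto
      from tree_polytime_comp[OF this polytime_tree_polytime[OF f]]
      have "tree_polytime ?E ?yy (\<lambda>z. to_tree ((\<lambda>(x, k). f x (?acc x k) (l x ! k)) z))"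
        by (rule tree_polytime_cong) auto
      then have "tree_polytime ?E ?yy (\<lambda>z. Node (?x z) (Node (?t z) (to_tree ((\<lambda>(x, k). f x (?acc x k) (l x ! k)) z))))"
        by (intro tree_polytime_Node x t)
      then show ?thesis
        by (rule tree_polytime_cong)
          (auto simp: tlength_to_tree take_Suc_conv_app_nth Cons_nth_drop_Suc[symmetric])
    qed
    show "poly_bounded (\<lambda>n. Suc (n + Suc (n + q n)))" using q(1) by (intro poly_bounded_intros)
    show "tsize (?y x k) \<le> Suc (tsize (Node (to_tree (l x)) (?y x 0)) +
        Suc (tsize (Node (to_tree (l x)) (?y x 0)) + q (tsize (Node (to_tree (l x)) (?y x 0)))))" for x k
    proof -
      have "dsize (?acc x k) \<le> q (tsize (Node (to_tree (l x)) (?y x 0)))"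
        by (rule order_trans[OF q(2) poly_bounded_mono[OF q(1)]]) simp
      then show ?thesis using dsize_drop[of k "l x"] by simp
    qed
  qed
  have 3: "tree_polytime UNIV (\<lambda>x. ?y x (tlength (to_tree (l x)))) (\<lambda>x. to_tree (?acc x (tlength (to_tree (l x)))))"
    by (rule tree_polytime_comp[OF tree_polytime_right tree_polytime_right])
  show ?thesis unfolding polytime_def
    using tree_polytime_comp[OF 1 tree_polytime_comp[OF 2 3]] by (simp add: tlength_to_tree)
qed

lemma dsize_foldl_additive:
  assumes "\<And>acc a. a \<in> set l \<Longrightarrow> dsize (f acc a) \<le> dsize acc + c"
  shows "dsize (foldl f z l) \<le> dsize z + length l * c"
  using assms
proof (induction l arbitrary: z)
  case (Cons a l)
  have "dsize (foldl f (f z a) l) \<le> dsize (f z a) + length l * c"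
    by (rule Cons.IH) (use Cons.prems in simp)
  also have "dsize (f z a) \<le> dsize z + c" using Cons.prems by simp
  finally show ?case by simp
qed simp

text \<open>An increment bounded in terms of \<open>x\<close> alone, independently of the
  accumulator, accumulates to a polynomial over polynomially many rounds. Most folds grow in this
  way.\<close>

lemma polytime_foldl_additive:
  fixes l :: "'a :: data \<Rightarrow> 'b :: data list" and g :: "'a \<Rightarrow> 'c :: data"
  assumes l: "polytime l" and g: "polytime g" and f: "polytime (\<lambda>y. f (fst y) (fst (snd y)) (snd (snd y)))"
    and r: "poly_bounded r" "\<And>x acc a. a \<in> set (l x) \<Longrightarrow> dsize (f x acc a) \<le> dsize acc + r (dsize x)"
  shows "polytime (\<lambda>x. foldl (f x) (g x) (l x))"
proof -
  obtain p where p: "poly_bounded p" "\<And>x. dsize (l x) \<le> p (dsize x)" by (rule polytime_size[OF l], rule that)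
  obtain q where q: "poly_bounded q" "\<And>x. dsize (g x) \<le> q (dsize x)" by (rule polytime_size[OF g], rule that)
  show ?thesis
  proof (rule polytime_foldl[OF l g f])
    show "poly_bounded (\<lambda>n. q n + p n * r n)" by (intro poly_bounded_intros p(1) q(1) r(1))
    fix x k
    have "dsize (foldl (f x) (g x) (take k (l x))) \<le> dsize (g x) + length (take k (l x)) * r (dsize x)"
      by (rule dsize_foldl_additive) (use r(2) in_set_takeD in metis)
    also have "length (take k (l x)) \<le> p (dsize x)"
      using length_le_dsize[of "l x"] p(2)[of x] by simp
    finally show "dsize (foldl (f x) (g x) (take k (l x))) \<le> q (dsize x) + p (dsize x) * r (dsize x)"
      using q(2)[of x] by (simp add: add_mono order_trans)
  qed
qed

lemma polytime_Let: "polytime f \<Longrightarrow> polytime (\<lambda>y. g (fst y) (snd y)) \<Longrightarrow> polytime (\<lambda>x. let z = f x in g x z)"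
  using polytime_comp[OF _ polytime_Pair[OF polytime_id], of "\<lambda>y. g (fst y) (snd y)" f] by simp

lemma polytime_case_prod:
  assumes "polytime f" "polytime (\<lambda>y. g (fst y) (fst (snd y)) (snd (snd y)))"
  shows "polytime (\<lambda>x. case f x of (a, b) \<Rightarrow> g x a b)"
  using polytime_comp[OF assms(2) polytime_Pair[OF polytime_id assms(1)]] by (simp add: case_prod_beta)

section \<open>Booleans and lists\<close>

lemma polytime_not: "polytime b \<Longrightarrow> polytime (\<lambda>x. \<not> b x)"
  by (rule polytime_cong[OF polytime_If[OF _ polytime_const[of False] polytime_const[of True], of b]]) auto

lemma polytime_conj: "polytime b \<Longrightarrow> polytime c \<Longrightarrow> polytime (\<lambda>x. b x \<and> c x)"
  by (rule polytime_cong[OF polytime_If[OF _ _ polytime_const[of False], of b c]]) auto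

lemma polytime_disj: "polytime b \<Longrightarrow> polytime c \<Longrightarrow> polytime (\<lambda>x. b x \<or> c x)"
  by (rule polytime_cong[OF polytime_If[OF _ polytime_const[of True], of b c]]) auto

lemma polytime_eq_bool: "polytime b \<Longrightarrow> polytime c \<Longrightarrow> polytime (\<lambda>x. b x = (c x :: bool))"
  by (rule polytime_cong[OF polytime_If[OF _ _ polytime_not, of b c c]]) auto

lemma polytime_rev:
  assumes "polytime l"
  shows "polytime (\<lambda>x. rev (l x))"
proof -
  obtain p where p: "poly_bounded p" "\<And>x. dsize (l x) \<le> p (dsize x)" by (rule polytime_size[OF assms], rule that)
  have rev: "foldl (\<lambda>acc a. a # acc) ys xs = rev xs @ ys" for xs ys :: "'b list"
    by (induction xs arbitrary: ys) auto
  have "polytime (\<lambda>x. foldl (\<lambda>acc a. a # acc) [] (l x))"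
  proof (rule polytime_foldl[OF assms polytime_const _ p(1)])
    show "polytime (\<lambda>y. snd (snd y) # fst (snd y))" by (intro polytime_Cons polytime_fst polytime_snd polytime_id)
    show "dsize (foldl (\<lambda>acc a. a # acc) [] (take k (l x))) \<le> p (dsize x)" for x k
      unfolding rev using p(2)[of x] dsize_take[of k "l x"] by (simp add: dsize_rev)
  qed
  then show ?thesis unfolding rev by simp
qed

lemma polytime_append:
  assumes "polytime l" "polytime m"
  shows "polytime (\<lambda>x. l x @ m x)"
proof -
  have l: "polytime (\<lambda>x. rev (l x))" using assms(1) by (rule polytime_rev)
  obtain p where p: "poly_bounded p" "\<And>x. dsize (rev (l x)) \<le> p (dsize x)" by (rule polytime_size[OF l], rule that)
  have app: "foldl (\<lambda>acc a. a # acc) ys xs = rev xs @ ys" for xs ys :: "'b list"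
    by (induction xs arbitrary: ys) auto
  have "polytime (\<lambda>x. foldl (\<lambda>acc a. a # acc) (m x) (rev (l x)))"
  proof (rule polytime_foldl_additive[OF l assms(2)])
    show "polytime (\<lambda>y. snd (snd y) # fst (snd y))" by (intro polytime_Cons polytime_fst polytime_snd polytime_id)
    show "poly_bounded (\<lambda>n. Suc (p n))" by (intro poly_bounded_intros p(1))
    show "dsize (a # acc) \<le> dsize acc + Suc (p (dsize x))" if "a \<in> set (rev (l x))" for x acc a
      using dsize_member[OF that] p(2)[of x] by simp
  qed
  then show ?thesis unfolding app by simp
qed

lemma polytime_map:
  fixes l :: "'a :: data \<Rightarrow> 'b :: data list" and f :: "'a \<Rightarrow> 'b \<Rightarrow> 'c :: data"
  assumes l: "polytime l" and f: "polytime (\<lambda>y. f (fst y) (snd y))"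
  shows "polytime (\<lambda>x. map (f x) (l x))"
proof -
  obtain p where p: "poly_bounded p" "\<And>x. dsize (l x) \<le> p (dsize x)" by (rule polytime_size[OF l], rule that)
  obtain q where q: "poly_bounded q" "\<And>y. dsize (f (fst y) (snd y)) \<le> q (dsize y)"
    by (rule polytime_size[OF f], rule that)
  have rev: "foldl (\<lambda>acc a. g a # acc) ys xs = rev (map g xs) @ ys" for g xs and ys :: "'c list"
    by (induction xs arbitrary: ys) auto
  have "polytime (\<lambda>x. foldl (\<lambda>acc a. f x a # acc) [] (l x))"
  proof (rule polytime_foldl_additive[OF l polytime_const])
    have "polytime (\<lambda>y :: 'a \<times> 'c list \<times> 'b. (fst y, snd (snd y)))" by (intro polytime_Pair polytime_fst polytime_snd polytime_id)
    from polytime_comp[OF f this]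
    show "polytime (\<lambda>y. f (fst y) (snd (snd y)) # fst (snd y))"
      by (intro polytime_Cons polytime_fst polytime_snd polytime_id) simp
    show "poly_bounded (\<lambda>n. Suc (q (Suc (n + p n))))"
      by (intro poly_bounded_intros poly_bounded_comp[OF q(1)] p(1))
    show "dsize (f x a # acc) \<le> dsize acc + Suc (q (Suc (dsize x + p (dsize x))))" if "a \<in> set (l x)" for x acc a
    proof -
      have "dsize (f x a) \<le> q (dsize (x, a))" using q(2)[of "(x, a)"] by simp
      also have "\<dots> \<le> q (Suc (dsize x + p (dsize x)))"
        by (rule poly_bounded_mono[OF q(1)]) (use dsize_member[OF that] p(2)[of x] in simp)
      finally show ?thesis by simp
    qed
  qed
  from polytime_rev[OF this] show ?thesis unfolding rev by simp
qed

lemma polytime_concat: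
  assumes "polytime l"
  shows "polytime (\<lambda>x. concat (l x))"
proof -
  obtain p where p: "poly_bounded p" "\<And>x. dsize (l x) \<le> p (dsize x)" by (rule polytime_size[OF assms], rule that)
  have app: "foldl (@) ys xs = ys @ concat xs" for xs and ys :: "'b list"
    by (induction xs arbitrary: ys) auto
  have "polytime (\<lambda>x. foldl (@) [] (l x))"
  proof (rule polytime_foldl_additive[OF assms polytime_const _ p(1)])
    show "polytime (\<lambda>y. fst (snd y) @ snd (snd y))" by (intro polytime_append polytime_fst polytime_snd polytime_id)
    show "dsize (acc @ a) \<le> dsize acc + p (dsize x)" if "a \<in> set (l x)" for x acc a
      using dsize_member[OF that] p(2)[of x] dsize_append[of acc a] by simp
  qed
  then show ?thesis unfolding app by simp
qed

lemma polytime_list_ex: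
  assumes l: "polytime l" and f: "polytime (\<lambda>y. f (fst y) (snd y))"
  shows "polytime (\<lambda>x. list_ex (f x) (l x))"
proof -
  have ex: "foldl (\<lambda>acc a. acc \<or> g a) b xs = (b \<or> list_ex g xs)" for b g and xs :: "'b list"
    by (induction xs arbitrary: b) auto
  have "polytime (\<lambda>x. foldl (\<lambda>acc a. acc \<or> f x a) False (l x))"
  proof (rule polytime_foldl_additive[OF l polytime_const])
    have "polytime (\<lambda>y :: 'a \<times> bool \<times> 'b. (fst y, snd (snd y)))" by (intro polytime_Pair polytime_fst polytime_snd polytime_id)
    from polytime_comp[OF f this]
    show "polytime (\<lambda>y. fst (snd y) \<or> f (fst y) (snd (snd y)))"
      by (intro polytime_disj polytime_fst polytime_snd polytime_id) simp
    show "poly_bounded (\<lambda>_. 3)" by (rule poly_bounded_const)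
    show "dsize (acc \<or> f x a) \<le> dsize acc + 3" for x acc a
      using dsize_bool[of "acc \<or> f x a"] by simp
  qed
  then show ?thesis unfolding ex by simp
qed

lemma polytime_list_all:
  assumes "polytime l" "polytime (\<lambda>y. f (fst y) (snd y))"
  shows "polytime (\<lambda>x. list_all (f x) (l x))"
  by (rule polytime_cong[OF polytime_not[OF polytime_list_ex[OF assms(1) polytime_not[OF assms(2)]]]])
    (auto simp: list_ex_iff list_all_iff)

lemma polytime_tl:
  assumes "polytime l"
  shows "polytime (\<lambda>x. tl (l x))"
  unfolding tl_def by (intro polytime_case_list assms polytime_const polytime_snd polytime_id)

lemma polytime_null:
  assumes "polytime l"
  shows "polytime (\<lambda>x. l x = [])"
proof -
  have "polytime (\<lambda>x. case l x of [] \<Rightarrow> True | a # as \<Rightarrow> False)"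
    by (intro polytime_case_list assms polytime_const)
  then show ?thesis by (rule polytime_cong) (auto split: list.splits)
qed

lemma polytime_eq_list:
  fixes l m :: "'a :: data \<Rightarrow> 'b :: data list"
  assumes l: "polytime l" and m: "polytime m" and eq: "polytime (\<lambda>y :: 'b \<times> 'b. fst y = snd y)"
  shows "polytime (\<lambda>x. l x = m x)"
proof -
  \<comment> \<open>The second list is consumed along with the first. If it is too short the flag
    becomes \<open>False\<close>; if it is too long a nonempty rest remains.\<close>
  let ?f = "\<lambda>(acc :: bool \<times> 'b list) a. case snd acc of [] \<Rightarrow> (False, []) | b # bs \<Rightarrow> (fst acc \<and> a = b, bs)"
  have fold: "(let r = foldl ?f (b, ys) xs in fst r \<and> snd r = []) = (b \<and> xs = ys)" for b xs ys
  proof (induction xs arbitrary: b ys)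
    case (Cons x xs)
    show ?case using Cons.IH[of False "[]"] Cons.IH by (cases ys) (auto simp: Let_def)
  qed (auto simp: Let_def)
  have step: "polytime (\<lambda>y :: 'a \<times> (bool \<times> 'b list) \<times> 'b. ?f (fst (snd y)) (snd (snd y)))"
  proof (intro polytime_case_list polytime_snd polytime_fst polytime_id polytime_const polytime_Pair polytime_conj)
    have "polytime (\<lambda>y :: ('a \<times> (bool \<times> 'b list) \<times> 'b) \<times> 'b \<times> 'b list. (snd (snd (fst y)), fst (snd y)))"
      by (intro polytime_snd polytime_fst polytime_id polytime_Pair)
    from polytime_comp[OF eq this]
    show "polytime (\<lambda>y :: ('a \<times> (bool \<times> 'b list) \<times> 'b) \<times> 'b \<times> 'b list. snd (snd (fst y)) = fst (snd y))" by simp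
  qed
  have "polytime (\<lambda>x. foldl ?f (True, m x) (l x))"
  proof (rule polytime_foldl_additive[OF l _ step])
    show "polytime (\<lambda>x. (True, m x))" by (intro polytime_Pair polytime_const m)
    show "poly_bounded (\<lambda>_. 5)" by (rule poly_bounded_const)
    show "dsize (?f acc a) \<le> dsize acc + 5" for acc a
      using dsize_bool[of "fst acc \<and> a = b" for b] by (cases acc) (auto split: list.splits simp: to_tree_bool_def)
  qed
  then have "polytime (\<lambda>x. let r = foldl ?f (True, m x) (l x) in fst r \<and> snd r = [])"
    by (intro polytime_Let polytime_conj polytime_fst polytime_snd polytime_null polytime_id)
  then show ?thesis unfolding fold by simp
qed

lemma polytime_eq_prod:
  assumes "polytime f" "polytime g" "polytime (\<lambda>y :: 'b \<times> 'b. fst y = snd y)" "polytime (\<lambda>y :: 'c \<times> 'c. fst y = snd y)"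
  shows "polytime (\<lambda>x. f x = (g x :: 'b :: data \<times> 'c :: data))"
proof -
  have "polytime (\<lambda>x. fst (f x) = fst (g x))"
    using polytime_comp[OF assms(3) polytime_Pair[OF polytime_fst[OF assms(1)] polytime_fst[OF assms(2)]]] by simp
  moreover have "polytime (\<lambda>x. snd (f x) = snd (g x))"
    using polytime_comp[OF assms(4) polytime_Pair[OF polytime_snd[OF assms(1)] polytime_snd[OF assms(2)]]] by simp
  ultimately show ?thesis using polytime_conj by (simp add: prod_eq_iff)
qed

lemmas polytime_intros = polytime_id polytime_const polytime_Pair polytime_Cons polytime_fst polytime_snd polytime_If polytime_case_list polytime_Let polytime_case_prod
  polytime_not polytime_conj polytime_disj polytime_eq_bool polytime_rev polytime_append polytime_map polytime_concat polytime_list_ex polytime_list_all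
  polytime_tl polytime_null polytime_eq_list polytime_eq_prod

lemma polytime_mem:
  fixes f :: "'a :: data \<Rightarrow> 'b :: data"
  assumes "polytime f" "polytime l" "polytime (\<lambda>y :: 'b \<times> 'b. fst y = snd y)"
  shows "polytime (\<lambda>x. f x \<in> set (l x))"
proof -
  have "polytime (\<lambda>y :: 'a \<times> 'b. f (fst y) = snd y)"
    using polytime_comp[OF assms(3) polytime_Pair[OF polytime_comp[OF assms(1) polytime_fst[OF polytime_id]] polytime_snd[OF polytime_id]]] by simp
  then have "polytime (\<lambda>x. list_ex (\<lambda>a. f x = a) (l x))" by (intro polytime_list_ex assms(2))
  then show ?thesis by (simp add: list_ex_iff)
qed

lemma polytime_distinct:
  fixes l :: "'a :: data \<Rightarrow> 'b :: data list"
  assumes l: "polytime l" and eq: "polytime (\<lambda>y :: 'b \<times> 'b. fst y = snd y)"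
  shows "polytime (\<lambda>x. distinct (l x))"
proof -
  obtain p where p: "poly_bounded p" "\<And>x. dsize (l x) \<le> p (dsize x)" by (rule polytime_size[OF l], rule that)
  let ?f = "\<lambda>(acc :: bool \<times> 'b list) a. (fst acc \<and> a \<notin> set (snd acc), a # snd acc)"
  have fold: "fst (foldl ?f (b, ys) xs) = (b \<and> distinct xs \<and> set xs \<inter> set ys = {})" for b ys xs
    by (induction xs arbitrary: b ys) auto
  have "polytime (\<lambda>x. foldl ?f (True, []) (l x))"
  proof (rule polytime_foldl_additive[OF l polytime_const])
    show "polytime (\<lambda>y :: 'a \<times> (bool \<times> 'b list) \<times> 'b. ?f (fst (snd y)) (snd (snd y)))"
      by (intro polytime_intros polytime_mem eq)
    show "poly_bounded (\<lambda>n. Suc (Suc (Suc (Suc (p n)))))" by (intro poly_bounded_intros p(1))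
    show "dsize (?f acc a) \<le> dsize acc + Suc (Suc (Suc (Suc (p (dsize x)))))" if "a \<in> set (l x)" for x acc a
      using dsize_bool[of "fst acc \<and> a \<notin> set (snd acc)"] dsize_member[OF that] p(2)[of x]
        tsize_pos[of "to_tree (fst acc)"] by (cases acc) simp
  qed
  from polytime_fst[OF this] show ?thesis unfolding fold by simp
qed

section \<open>From polynomial-time functions to Turing machines\<close>

text \<open>The input word, a stack of symbols, is first rewritten as the tree of a list of booleans.\<close>

lemma polytime_imp_PTIME:
  fixes f :: "bool list \<Rightarrow> bool"
  assumes "polytime f"
  shows "{x. f x} \<in> PTIME"
proof -
  obtain c p where cp: "poly_bounded p \<and> (\<forall>x \<in> UNIV. \<forall>v. tsize (to_tree (f x)) \<le> p (dsize x) \<and>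
     exec c (val_stack (ser (to_tree x) @ v)) (p (dsize x)) (val_stack (ser (to_tree (f x)) @ v)))"
    using assms[unfolded polytime_def tree_polytime_def] by (elim exE) (rule that)
  then have p: "poly_bounded p" and c: "exec c (val_stack (ser (to_tree x))) (p (dsize x)) (val_stack (ser (to_tree (f x))))" for x
    by (blast, metis UNIV_I append_Nil2)
  let ?sym = "\<lambda>b. if b then 2 else 1 :: nat"
  \<comment> \<open>A list cell starts with 2 1 for the bit 0 and with 2 2 1 1 for the bit 1; the
    symbols are pushed back to front.\<close>
  let ?body = "Ite 1 1 (Pop 1 ;; Push 0 1 ;; Push 0 2) (Pop 1 ;; Push 0 1 ;; Push 0 1 ;; Push 0 2 ;; Push 0 2)"
  let ?conv = "While 1 0 ?body"
  have conv: "exec ?conv (stacks (ser (to_tree ys)) (map ?sym xs) [] []) (Suc (20 * length xs))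
      (val_stack (ser (to_tree (rev xs @ ys))))" for xs ys
  proof (induction xs arbitrary: ys)
    case Nil
    have "exec ?conv (val_stack (ser (to_tree ys))) 1 (val_stack (ser (to_tree ys)))"
      by (rule exec.WhileStop) auto
    then show ?case by simp
  next
    case (Cons b xs)
    let ?s = "stacks (ser (to_tree ys)) (map ?sym (b # xs)) [] []"
    let ?s' = "stacks (ser (to_tree (b # ys))) (map ?sym xs) [] []"
    have 1: "exec ?body ?s 18 ?s'"
    proof (rule exec.Weaken, rule exec_Ite)
      assume "top (?s 1) = 1"
      then have b: "b = False" by (auto split: if_splits)
      show "exec (Pop 1 ;; Push 0 1 ;; Push 0 2) ?s 13 ?s'"
        by (rule exec.Weaken, rule exec.Seq, rule exec_Pop[OF _ refl], simp, rule exec.Seq,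
            rule exec_Push[OF _ refl], simp, rule exec_Push) (auto simp: b to_tree_bool_def)
    next
      assume "top (?s 1) \<noteq> 1"
      then have b: "b = True" by (auto split: if_splits)
      show "exec (Pop 1 ;; Push 0 1 ;; Push 0 1 ;; Push 0 2 ;; Push 0 2) ?s 13 ?s'"
        by (rule exec.Weaken, rule exec.Seq, rule exec_Pop[OF _ refl], simp, rule exec.Seq,
            rule exec_Push[OF _ refl], simp, rule exec.Seq, rule exec_Push[OF _ refl], simp,
            rule exec.Seq, rule exec_Push[OF _ refl], simp, rule exec_Push) (auto simp: b to_tree_bool_def)
    qed auto
    have 2: "exec ?conv ?s' (Suc (20 * length xs)) (val_stack (ser (to_tree (rev (b # xs) @ ys))))"
      using Cons.IH[of "b # ys"] by simp
    show ?case by (rule exec.Weaken[OF exec.WhileStep[OF _ _ 1 2]]) auto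
  qed
  \<comment> \<open>Draining stack 0 reverses the input, so that the list is built from its last
    element; the 1 pushed next is the empty list.\<close>
  let ?prog = "drain 0 1 ;; Push 0 1 ;; ?conv ;; c"
  let ?q = "\<lambda>n. Suc (Suc (6 * n) + Suc (2 + Suc (Suc (20 * n) + p (4 * n + 1))))"
  have len: "dsize x \<le> 4 * length x + 1" for x :: "bool list"
  proof (induction x)
    case (Cons b x)
    then show ?case using dsize_bool[of b] by simp
  qed simp
  have run: "exec ?prog (input_store x) (?q (length x)) (val_stack (ser (to_tree (f x))))" for x
  proof -
    have s: "input_store x = (val_stack [])(0 := map ?sym x, 1 := [])"
      by (auto simp: input_store_def stacks_def)
    have 1: "exec (drain 0 1) (input_store x) (Suc (6 * length x)) (stacks [] (map ?sym (rev x)) [] [])"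
      using exec_drain[of "map ?sym x" 0 1 "val_stack []" "[]"] unfolding s by (auto simp: rev_map)
    have 2: "exec (Push 0 1) (stacks [] (map ?sym (rev x)) [] []) 2 (stacks (ser (to_tree ([] :: bool list))) (map ?sym (rev x)) [] [])"
      by (rule exec_Push) auto
    have 3: "exec ?conv (stacks (ser (to_tree ([] :: bool list))) (map ?sym (rev x)) [] []) (Suc (20 * length x))
      (val_stack (ser (to_tree x)))" using conv[of "[]" "rev x"] by simp
    have 4: "exec c (val_stack (ser (to_tree x))) (p (4 * length x + 1)) (val_stack (ser (to_tree (f x))))"
      by (rule exec.Weaken[OF c poly_bounded_mono[OF p len]])
    show ?thesis by (rule exec.Seq[OF 1 exec.Seq[OF 2 exec.Seq[OF 3 4]]])
  qed
  have "poly_bounded ?q"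
    by (intro poly_bounded_intros poly_bounded_comp[OF p])
  then obtain a d where ad: "\<And>n. ?q n \<le> a * (n + 1) ^ d" unfolding poly_bounded_def by blast
  \<comment> \<open>For positive \<open>n\<close>, (n + 1)^d is at most 2^d * n^d, and for n = 0 the
    constant summand takes over. Adding 1 makes the bound strict, leaving room for the step to the
    verdict.\<close>
  let ?C = "a * 2 ^ d + 1"
  have bound: "?q n < ?C * n ^ d + ?C" for n
  proof -
    have "a * (n + 1) ^ d \<le> (a * 2 ^ d) * n ^ d + a * 2 ^ d"
    proof (cases "n = 0")
      case False
      then have "(n + 1) ^ d \<le> (2 * n) ^ d" by (intro power_mono) auto
      then have "a * (n + 1) ^ d \<le> a * (2 ^ d * n ^ d)"
        unfolding power_mult_distrib by (rule mult_le_mono2)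
      then show ?thesis unfolding mult.assoc by linarith
    next
      case True
      have "a \<le> a * 2 ^ d" using mult_le_mono2[of 1 "2 ^ d" a] by simp
      then show ?thesis unfolding True by (simp only: add_0 power_one mult_1_right trans_le_add2)
    qed
    also have "\<dots> < ?C * n ^ d + ?C" by (simp add: add_mult_distrib)
    finally show ?thesis using ad[of n] by linarith
  qed
  have "decides_in_time (machine ?prog) {x. f x} (\<lambda>n. ?C * n ^ d + ?C)"
    by (rule decides_in_time_machine[OF run])
      (use bound in \<open>auto simp: to_tree_bool_def\<close>)
  then show ?thesis unfolding PTIME_def using is_tm_machine by blast
qed


section \<open>Binary arithmetic\<close>

instantiation nat :: data
begin
definition to_tree_nat :: "nat \<Rightarrow> tree" where "to_tree_nat n = to_tree (nat_bits n)"
instance ..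
end

text \<open>A number is stored as its positive and its negative part, at most one of which is
  nonzero. Sums then reduce to sums and truncated differences of natural numbers, without a case
  distinction on signs.\<close>

instantiation int :: data
begin
definition to_tree_int :: "int \<Rightarrow> tree" where
  "to_tree_int k = Node (to_tree (nat k)) (to_tree (nat (- k)))"
instance ..
end

definition bits_val :: "bool list \<Rightarrow> nat" where
  "bits_val bs = foldr (\<lambda>b n. of_bool b + 2 * n) bs 0"

lemma bits_val_simps [simp]:
  "bits_val [] = 0" "bits_val (b # bs) = of_bool b + 2 * bits_val bs"
  by (auto simp: bits_val_def)

lemma nat_bits_0 [simp]: "nat_bits 0 = []"
  by (simp add: nat_bits.simps)

lemma nat_bits_step: "nat_bits (of_bool b + 2 * n) = (if n = 0 \<and> \<not> b then [] else b # nat_bits n)"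
  by (subst nat_bits.simps) auto

lemma bits_val_nat_bits [simp]: "bits_val (nat_bits n) = n"
proof (induction n rule: nat_bits.induct)
  case (1 n)
  then show ?case by (cases "n = 0") (auto simp: nat_bits.simps[of n])
qed

lemma nat_bits_eq_Nil: "nat_bits n = [] \<longleftrightarrow> n = 0"
  by (metis bits_val_nat_bits bits_val_simps(1) nat_bits_0)

lemma bits_val_less: "bits_val bs < 2 ^ length bs"
  by (induction bs) auto

lemma bits_val_append: "bits_val (xs @ ys) = bits_val xs + 2 ^ length xs * bits_val ys"
  by (induction xs) (auto simp: algebra_simps)

definition bit_length :: "nat \<Rightarrow> nat" where
  "bit_length n = length (nat_bits n)"

lemma bit_length_le: "n < 2 ^ k \<Longrightarrow> bit_length n \<le> k"
proof (induction n arbitrary: k rule: nat_bits.induct)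
  case (1 n)
  show ?case
  proof (cases "n = 0")
    case False
    then obtain j where k: "k = Suc j" using 1(2) by (cases k) auto
    then have "n div 2 < 2 ^ j" using 1(2) by auto
    then show ?thesis using 1(1)[OF False] False k
      by (simp add: bit_length_def nat_bits.simps[of n])
  qed (simp add: bit_length_def)
qed

lemma less_bit_length: "n < 2 ^ bit_length n"
  using bits_val_less[of "nat_bits n"] by (simp add: bit_length_def)

lemma dsize_bool_list: "dsize (bs :: bool list) \<le> Suc (4 * length bs)"
proof (induction bs)
  case (Cons b bs)
  then show ?case using dsize_bool[of b] by simp
qed simp

text \<open>Sizes are estimated through magnitudes: \<open>less_dsize\<close> turns the size of an
  input into a power of 2, the powers are combined, and this lemma turns the outcome back into a
  size.\<close>

lemma dsize_nat_le: "(n :: nat) < 2 ^ k \<Longrightarrow> dsize n \<le> Suc (4 * k)"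
  using bit_length_le[of n k] dsize_bool_list[of "nat_bits n"]
  by (simp add: bit_length_def to_tree_nat_def)

lemma less_dsize: "(n :: nat) < 2 ^ dsize n"
proof -
  have "bit_length n \<le> dsize n"
    using length_le_dsize[of "nat_bits n"] by (simp add: bit_length_def to_tree_nat_def)
  then show ?thesis using less_bit_length[of n] by (meson less_le_trans one_le_numeral power_increasing)
qed

lemma dsize_int_le: "\<bar>k :: int\<bar> < 2 ^ n \<Longrightarrow> dsize k \<le> 8 * n + 3"
proof -
  assume "\<bar>k :: int\<bar> < 2 ^ n"
  then have "nat k < 2 ^ n" "nat (- k) < 2 ^ n" by (simp_all add: nat_less_iff)
  then show ?thesis using dsize_nat_le[of "nat k" n] dsize_nat_le[of "nat (- k)" n]
    by (simp add: to_tree_int_def)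
qed

lemma abs_less_dsize: "\<bar>k\<bar> < 2 ^ dsize (k :: int)"
proof -
  have "dsize (nat k) \<le> dsize k" "dsize (nat (- k)) \<le> dsize k" by (auto simp: to_tree_int_def)
  then have "nat k < 2 ^ dsize k" "nat (- k) < 2 ^ dsize k"
    using less_dsize[of "nat k"] less_dsize[of "nat (- k)"]
    by (meson less_le_trans one_le_numeral power_increasing)+
  then show ?thesis by (auto simp: nat_less_iff abs_if)
qed

lemma polytime_nat_bits_iff: "polytime f \<longleftrightarrow> polytime (\<lambda>x. nat_bits (f x))"
  unfolding polytime_def to_tree_nat_def ..

lemma polytime_nat_bits: "polytime f \<Longrightarrow> polytime (\<lambda>x. nat_bits (f x))"
  using polytime_nat_bits_iff by blast

lemma polytime_nat_is_0: "polytime f \<Longrightarrow> polytime (\<lambda>x. f x = (0 :: nat))"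
  using polytime_null[OF polytime_nat_bits] by (simp add: nat_bits_eq_Nil)

lemma polytime_shift:
  assumes "polytime b" "polytime n"
  shows "polytime (\<lambda>x. of_bool (b x) + 2 * n x :: nat)"
  unfolding polytime_nat_bits_iff[of "\<lambda>x. of_bool (b x) + 2 * n x"] nat_bits_step
  by (intro polytime_intros polytime_nat_is_0 polytime_nat_bits assms)

lemma foldl_shift: "foldl (\<lambda>n b. of_bool b + 2 * n) 0 bs = bits_val (rev bs)"
  by (simp add: bits_val_def foldr_conv_foldl)

lemma polytime_bits_val:
  assumes l: "polytime l"
  shows "polytime (\<lambda>x. bits_val (l x))"
proof -
  have r: "polytime (\<lambda>x. rev (l x))" using l by (rule polytime_rev)
  obtain p where p: "poly_bounded p" "\<And>x. dsize (rev (l x)) \<le> p (dsize x)" by (rule polytime_size[OF r], rule that)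
  have "polytime (\<lambda>x. foldl (\<lambda>n b. of_bool b + 2 * n) 0 (rev (l x)) :: nat)"
  proof (rule polytime_foldl[OF r polytime_const])
    show "polytime (\<lambda>y. of_bool (snd (snd y)) + 2 * fst (snd y) :: nat)" by (intro polytime_shift polytime_intros)
    show "poly_bounded (\<lambda>n. Suc (4 * p n))" by (intro poly_bounded_intros p(1))
    fix x k
    have "bits_val (rev (take k (rev (l x)))) < 2 ^ p (dsize x)"
    proof (rule less_le_trans[OF bits_val_less], rule power_increasing)
      show "length (rev (take k (rev (l x)))) \<le> p (dsize x)"
        using length_le_dsize[of "rev (l x)"] p(2)[of x] by simp
    qed simp
    then show "dsize (foldl (\<lambda>n b. of_bool b + 2 * n) 0 (take k (rev (l x))) :: nat) \<le> Suc (4 * p (dsize x))"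
      unfolding foldl_shift by (rule dsize_nat_le)
  qed
  then show ?thesis unfolding foldl_shift by simp
qed

definition head_bit :: "bool list \<Rightarrow> bool" where
  "head_bit bs = (case bs of [] \<Rightarrow> False | b # _ \<Rightarrow> b)"

lemma polytime_head_bit: "polytime l \<Longrightarrow> polytime (\<lambda>x. head_bit (l x))"
  unfolding head_bit_def by (intro polytime_intros)

lemma bits_val_head: "bits_val bs = of_bool (head_bit bs) + 2 * bits_val (tl bs)"
  by (cases bs) (auto simp: head_bit_def)

section \<open>Binary addition, subtraction and multiplication\<close>

text \<open>Bit-serial addition (\<open>sub = False\<close>) and subtraction (\<open>sub = True\<close>). The state consists of the
  carry, the remaining bits of both arguments and the output, most significant bit first.\<close>

definition ripple_step ::
    "bool \<Rightarrow> bool \<times> (bool list \<times> bool list) \<times> bool list \<Rightarrow> bool \<times> (bool list \<times> bool list) \<times> bool list" where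
  "ripple_step sub st =
    (let c = fst st; a = head_bit (fst (fst (snd st))); b = head_bit (snd (fst (snd st)))
     in (if a = sub then b \<and> c else b \<or> c,
         (tl (fst (fst (snd st))), tl (snd (fst (snd st)))), (a = (b = c)) # snd (snd st)))"

text \<open>The concatenated words serve as a counter that is long enough to exhaust both
  arguments.\<close>

definition ripple :: "bool \<Rightarrow> nat \<Rightarrow> nat \<Rightarrow> bool \<times> (bool list \<times> bool list) \<times> bool list" where
  "ripple sub m n = foldl (\<lambda>st _. ripple_step sub st) (False, (nat_bits m, nat_bits n), []) (nat_bits m @ nat_bits n)"

text \<open>The number that a state stands for: the digits already written plus, at the current
  place value, the sum or difference of what is left, including the pending carry or borrow.\<close>

definition ripple_inv :: "bool \<Rightarrow> bool \<times> (bool list \<times> bool list) \<times> bool list \<Rightarrow> int" where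
  "ripple_inv sub st = (case st of (c, (xs, ys), out) \<Rightarrow> int (bits_val (rev out)) +
     2 ^ length out * (int (bits_val xs) + (if sub then -1 else 1) * (int (bits_val ys) + of_bool c)))"

text \<open>In both modes the new digit is the exclusive or of the digits a, b and the carry c, and
  a = (b = c) expresses just this. The carry is the majority of a, b, c, the borrow that of not a,
  b, c.\<close>

lemma ripple_inv_step: "ripple_inv sub (ripple_step sub st) = ripple_inv sub st"
proof -
  obtain c xs ys out where st: "st = (c, (xs, ys), out)" by (metis prod.collapse)
  show ?thesis
    unfolding st ripple_step_def ripple_inv_def
    using bits_val_head[of xs] bits_val_head[of ys]
    by (cases sub; cases "head_bit xs"; cases "head_bit ys"; cases c)
      (simp_all add: bits_val_append algebra_simps)
qed

lemma ripple_inv_foldl: "ripple_inv sub (foldl (\<lambda>st _. ripple_step sub st) st ws) = ripple_inv sub st"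
  by (induction ws arbitrary: st) (auto simp: ripple_inv_step)

lemma ripple_rest:
  "fst (snd (foldl (\<lambda>st _. ripple_step sub st) (c, (xs, ys), out) ws)) = (drop (length ws) xs, drop (length ws) ys)"
proof (induction ws arbitrary: c xs ys out)
  case (Cons w ws)
  show ?case using Cons.IH by (simp add: ripple_step_def Let_def drop_Suc)
qed simp

lemma ripple_result:
  obtains c out where "ripple sub m n = (c, ([], []), out)"
    "int m + (if sub then -1 else 1) * int n =
     int (bits_val (rev out)) + (if sub then -1 else 1) * 2 ^ length out * of_bool c"
proof -
  obtain c xs ys out where r: "ripple sub m n = (c, (xs, ys), out)" by (metis prod.collapse)
  have e: "xs = []" "ys = []"
    using ripple_rest[of sub False "nat_bits m" "nat_bits n" "[]" "nat_bits m @ nat_bits n"] r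
    by (auto simp: ripple_def)
  have "ripple_inv sub (ripple sub m n) = int m + (if sub then -1 else 1) * int n"
    unfolding ripple_def ripple_inv_foldl by (simp add: ripple_inv_def)
  then show ?thesis using that[of c out] r e by (simp add: ripple_inv_def split: if_splits)
qed

lemma add_ripple: "m + n = (let r = ripple False m n in bits_val (rev (fst r # snd (snd r))))"
proof -
  obtain c out where r: "ripple False m n = (c, ([], []), out)"
    "int m + int n = int (bits_val (rev out)) + 2 ^ length out * of_bool c"
    by (rule ripple_result[of False m n]) auto
  from r(2) have "int (m + n) = int (bits_val (rev out) + 2 ^ length out * of_bool c)" by simp
  then show ?thesis unfolding r(1) Let_def by (simp add: bits_val_append del: of_nat_add of_nat_mult)
qed

lemma diff_ripple: "m - n = (let r = ripple True m n in if fst r then 0 else bits_val (rev (snd (snd r))))"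
proof -
  obtain c out where r: "ripple True m n = (c, ([], []), out)"
    "int m - int n = int (bits_val (rev out)) - 2 ^ length out * of_bool c"
    by (rule ripple_result[of True m n]) auto
  have b: "int (bits_val (rev out)) < 2 ^ length out"
    using bits_val_less[of "rev out"] by (metis length_rev of_nat_less_numeral_power_cancel_iff)
  \<comment> \<open>A borrow left at the end means a negative difference, because the digits written
    stay below the place value at which it is due.\<close>
  have "m < n" if c
  proof -
    have "int m - int n = int (bits_val (rev out)) - 2 ^ length out" using r(2) that by simp
    then show ?thesis using b by linarith
  qed
  then show ?thesis using r by (cases c) (auto simp: Let_def)
qed

lemma polytime_ripple:
  assumes "polytime m" "polytime n"
  shows "polytime (\<lambda>x. ripple sub (m x) (n x))"
  unfolding ripple_def
proof (rule polytime_foldl_additive)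
  show "polytime (\<lambda>x. nat_bits (m x) @ nat_bits (n x))" "polytime (\<lambda>x. (False, (nat_bits (m x), nat_bits (n x)), []))"
    by (intro polytime_intros polytime_nat_bits assms)+
  show "polytime (\<lambda>y. ripple_step sub (fst (snd y)))"
    unfolding ripple_step_def by (intro polytime_intros polytime_head_bit)
  show "poly_bounded (\<lambda>_. 10)" by (rule poly_bounded_const)
  fix st :: "bool \<times> (bool list \<times> bool list) \<times> bool list"
  obtain c xs ys out where st: "st = (c, (xs, ys), out)" by (metis prod.collapse)
  have tl: "dsize (tl xs) \<le> dsize xs" for xs :: "bool list" by (cases xs) auto
  show "dsize (ripple_step sub st) \<le> dsize st + 10"
    unfolding st ripple_step_def Let_def fst_conv snd_conv
    using tl[of xs] tl[of ys] dsize_bool[of "head_bit xs = (head_bit ys = c)"]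
      dsize_bool[of "if head_bit xs = sub then head_bit ys \<and> c else head_bit ys \<or> c"]
    by (simp split del: if_split)
qed

lemma polytime_add_nat: "polytime m \<Longrightarrow> polytime n \<Longrightarrow> polytime (\<lambda>x. m x + n x :: nat)"
  unfolding add_ripple by (intro polytime_intros polytime_bits_val polytime_ripple)

lemma polytime_diff_nat: "polytime m \<Longrightarrow> polytime n \<Longrightarrow> polytime (\<lambda>x. m x - n x :: nat)"
  unfolding diff_ripple by (intro polytime_intros polytime_bits_val polytime_ripple)

lemma polytime_le_nat: "polytime m \<Longrightarrow> polytime n \<Longrightarrow> polytime (\<lambda>x. m x \<le> (n x :: nat))"
  using polytime_nat_is_0[OF polytime_diff_nat[of m n]] by simp

lemma polytime_mult_nat:
  assumes m: "polytime m" and n: "polytime n"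
  shows "polytime (\<lambda>x. m x * n x :: nat)"
proof -
  have l: "polytime (\<lambda>x. rev (nat_bits (m x)))" by (intro polytime_intros polytime_nat_bits m)
  obtain p where p: "poly_bounded p" "\<And>x. dsize (rev (nat_bits (m x))) \<le> p (dsize x)"
    by (rule polytime_size[OF l], rule that)
  obtain q where q: "poly_bounded q" "\<And>x. dsize (n x) \<le> q (dsize x)" by (rule polytime_size[OF n], rule that)
  \<comment> \<open>Horner's scheme from the most significant bit. Doubling is written with
    \<open>of_bool False\<close> to fit \<open>polytime_shift\<close>.\<close>
  have fold: "foldl (\<lambda>acc b. (if b then c else 0) + (of_bool False + 2 * acc)) 0 bs = bits_val (rev bs) * c"
    for c :: nat and bs
    by (induction bs rule: rev_induct) (auto simp: algebra_simps)
  have "polytime (\<lambda>x. foldl (\<lambda>acc b. (if b then n x else 0) + (of_bool False + 2 * acc)) 0 (rev (nat_bits (m x))))"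
  proof (rule polytime_foldl[OF l polytime_const])
    show "polytime (\<lambda>y. (if snd (snd y) then n (fst y) else 0) + (of_bool False + 2 * fst (snd y)))"
      by (intro polytime_add_nat polytime_shift polytime_intros polytime_comp[OF n])
    show "poly_bounded (\<lambda>k. Suc (4 * (p k + q k)))" by (intro poly_bounded_intros p(1) q(1))
    fix x k
    let ?bs = "take k (rev (nat_bits (m x)))"
    have "bits_val (rev ?bs) < 2 ^ p (dsize x)"
    proof (rule less_le_trans[OF bits_val_less], rule power_increasing)
      show "length (rev ?bs) \<le> p (dsize x)"
        using length_le_dsize[of "rev (nat_bits (m x))"] p(2)[of x] by simp
    qed simp
    moreover have "n x < 2 ^ q (dsize x)"
      by (rule less_le_trans[OF less_dsize], rule power_increasing) (use q(2) in auto)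
    ultimately have "bits_val (rev ?bs) * n x < 2 ^ (p (dsize x) + q (dsize x))"
      unfolding power_add by (rule mult_strict_mono) auto
    then show "dsize (foldl (\<lambda>acc b. (if b then n x else 0) + (of_bool False + 2 * acc)) 0 ?bs)
        \<le> Suc (4 * (p (dsize x) + q (dsize x)))"
      unfolding fold by (rule dsize_nat_le)
  qed
  then show ?thesis unfolding fold by simp
qed

lemma polytime_length:
  assumes l: "polytime l"
  shows "polytime (\<lambda>x. length (l x))"
proof -
  obtain p where p: "poly_bounded p" "\<And>x. dsize (l x) \<le> p (dsize x)" by (rule polytime_size[OF l], rule that)
  have fold: "foldl (\<lambda>n _. n + 1) k xs = k + length xs" for k xs
    by (induction xs arbitrary: k) auto
  have "polytime (\<lambda>x. foldl (\<lambda>n _. n + 1) (0 :: nat) (l x))"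
  proof (rule polytime_foldl[OF l polytime_const])
    show "polytime (\<lambda>y. fst (snd y) + 1 :: nat)" by (intro polytime_add_nat polytime_intros)
    show "poly_bounded (\<lambda>n. Suc (4 * p n))" by (intro poly_bounded_intros p(1))
    fix x k
    have "length (take k (l x)) \<le> p (dsize x)"
      using length_le_dsize[of "l x"] p(2)[of x] by simp
    also have "p (dsize x) < 2 ^ p (dsize x)" by simp
    finally show "dsize (foldl (\<lambda>n _. n + 1) (0 :: nat) (take k (l x))) \<le> Suc (4 * p (dsize x))"
      unfolding fold by (intro dsize_nat_le) simp
  qed
  then show ?thesis unfolding fold by simp
qed

section \<open>Integer arithmetic\<close>

lemma polytime_nat_pos_part: "polytime f \<Longrightarrow> polytime (\<lambda>x. nat (f x))"
  unfolding polytime_def to_tree_int_def by (rule tree_polytime_comp[OF _ tree_polytime_left])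

lemma polytime_nat_neg_part: "polytime f \<Longrightarrow> polytime (\<lambda>x. nat (- f x))"
  unfolding polytime_def to_tree_int_def by (rule tree_polytime_comp[OF _ tree_polytime_right])

lemma polytime_intI: "polytime (\<lambda>x. nat (f x)) \<Longrightarrow> polytime (\<lambda>x. nat (- f x)) \<Longrightarrow> polytime f"
  unfolding polytime_def to_tree_int_def by (rule tree_polytime_Node)

lemma polytime_uminus_int: "polytime f \<Longrightarrow> polytime (\<lambda>x. - f x :: int)"
  by (rule polytime_intI) (simp_all add: polytime_nat_pos_part polytime_nat_neg_part)

lemma polytime_int: "polytime f \<Longrightarrow> polytime (\<lambda>x. int (f x))"
  by (rule polytime_intI) (simp_all add: polytime_const)

lemma polytime_add_int:
  assumes "polytime f" "polytime g"
  shows "polytime (\<lambda>x. f x + g x :: int)"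
proof (rule polytime_intI)
  have "nat (a + b) = (nat a + nat b) - (nat (- a) + nat (- b))" for a b by linarith
  then show "polytime (\<lambda>x. nat (f x + g x))"
    by (simp only:) (intro polytime_diff_nat polytime_add_nat polytime_nat_pos_part polytime_nat_neg_part assms)
  have "nat (- (a + b)) = (nat (- a) + nat (- b)) - (nat a + nat b)" for a b by linarith
  then show "polytime (\<lambda>x. nat (- (f x + g x)))"
    by (simp only:) (intro polytime_diff_nat polytime_add_nat polytime_nat_pos_part polytime_nat_neg_part assms)
qed

lemma polytime_diff_int: "polytime f \<Longrightarrow> polytime g \<Longrightarrow> polytime (\<lambda>x. f x - g x :: int)"
  using polytime_add_int[OF _ polytime_uminus_int] by simp

text \<open>The decision procedure multiplies only by the number of states and by the denominator,
  both natural numbers. Such a factor can be applied to the positive and the negative part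
  separately.\<close>

lemma polytime_mult_int:
  assumes "polytime f" "polytime g"
  shows "polytime (\<lambda>x. int (f x) * g x)"
proof (rule polytime_intI)
  show "polytime (\<lambda>x. nat (int (f x) * g x))"
    unfolding nat_mult_distrib[OF of_nat_0_le_iff] nat_int
    by (intro polytime_mult_nat polytime_nat_pos_part assms)
  show "polytime (\<lambda>x. nat (- (int (f x) * g x)))"
    unfolding mult_minus_right[symmetric] nat_mult_distrib[OF of_nat_0_le_iff] nat_int
    by (intro polytime_mult_nat polytime_nat_neg_part assms)
qed

lemma polytime_le_int:
  assumes "polytime f" "polytime g"
  shows "polytime (\<lambda>x. f x \<le> (g x :: int))"
proof -
  have "a \<le> b \<longleftrightarrow> nat a + nat (- b) \<le> nat b + nat (- a)" for a b by linarith
  then show ?thesis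
    by (simp only:) (intro polytime_le_nat polytime_add_nat polytime_nat_pos_part polytime_nat_neg_part assms)
qed

lemma polytime_less_int:
  assumes "polytime f" "polytime g"
  shows "polytime (\<lambda>x. f x < (g x :: int))"
  unfolding not_le[symmetric] by (intro polytime_not polytime_le_int assms)

lemma polytime_eq_int:
  assumes "polytime f" "polytime g"
  shows "polytime (\<lambda>x. f x = (g x :: int))"
  unfolding eq_iff by (intro polytime_conj polytime_le_int assms)

lemma polytime_min_int:
  assumes "polytime f" "polytime g"
  shows "polytime (\<lambda>x. min (f x) (g x :: int))"
  unfolding min_def by (intro polytime_If polytime_le_int assms)

lemma polytime_int_bits:
  assumes "polytime f"
  shows "polytime (\<lambda>x. int_bits (f x))"
proof -
  have "int_bits k = (k < 0) # nat_bits (nat k + nat (- k))" for k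
    unfolding int_bits_def by (intro arg_cong2[of _ _ _ _ Cons] arg_cong[of _ _ nat_bits]) auto
  then show ?thesis
    by (simp only:)
      (intro polytime_intros polytime_less_int polytime_nat_bits polytime_add_nat polytime_nat_pos_part polytime_nat_neg_part assms)
qed

text \<open>Total on all words and hence not injective: the empty word and zero with a minus sign
  also have value 0. Words with such fields fail the later comparison with the re-encoded
  input.\<close>

definition int_val :: "bool list \<Rightarrow> int" where
  "int_val bs = (case bs of [] \<Rightarrow> 0 | s # b \<Rightarrow> if s then - int (bits_val b) else int (bits_val b))"

lemma int_val_int_bits [simp]: "int_val (int_bits k) = k"
  by (simp add: int_val_def int_bits_def)

lemma polytime_int_val: "polytime l \<Longrightarrow> polytime (\<lambda>x. int_val (l x))"
  unfolding int_val_def by (intro polytime_intros polytime_uminus_int polytime_int polytime_bits_val)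

lemmas polytime_arith = polytime_add_int polytime_diff_int polytime_mult_int polytime_le_int polytime_less_int polytime_eq_int polytime_min_int
  polytime_int polytime_int_val polytime_int_bits polytime_bits_val polytime_nat_bits polytime_length polytime_nat_is_0


section \<open>Shortest paths and average-energy\<close>

definition candidates :: "('v \<times> 'v \<times> int) list \<Rightarrow> ('v \<times> int) list \<Rightarrow> 'v \<Rightarrow> int list" where
  "candidates es D v =
     concat (map (\<lambda>(u, d). if u = v then [d] else []) D) @
     concat (map (\<lambda>(a, b, w). if b = v then concat (map (\<lambda>(u, d). if u = a then [d + w] else []) D) else []) es)"

text \<open>A vertex without an entry in the table has distance infinity. Since
  \<open>candidates\<close> includes the old value, \<open>k\<close> rounds minimise over all walks
  of at most \<open>k\<close> edges, not just over those of exactly \<open>k\<close>.\<close>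

definition relax :: "'v list \<Rightarrow> ('v \<times> 'v \<times> int) list \<Rightarrow> ('v \<times> int) list \<Rightarrow> ('v \<times> int) list" where
  "relax vs es D = concat (map (\<lambda>v. case candidates es D v of [] \<Rightarrow> [] | c # cs \<Rightarrow> [(v, foldl min c cs)]) vs)"

definition bellman_ford :: "'v list \<Rightarrow> ('v \<times> 'v \<times> int) list \<Rightarrow> ('v \<times> int) list \<Rightarrow> ('v \<times> int) list" where
  "bellman_ford vs es D = foldl (\<lambda>D _. relax vs es D) D vs"

text \<open>The table produced by Bellman-Ford is used either way: an edge that can still be
  improved yields a negative cycle, and if there is none, the table is a potential on the reached
  vertices.\<close>

definition unstable :: "('v \<times> 'v \<times> int) list \<Rightarrow> ('v \<times> int) list \<Rightarrow> bool" where
  "unstable es D \<longleftrightarrow> list_ex (\<lambda>(a, b, w). list_ex (\<lambda>(u, d). u = a \<and>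
     \<not> list_ex (\<lambda>(v, d'). v = b \<and> d' \<le> d + w) D) D) es"

text \<open>The new weights are scaled by a number \<open>k\<close> of at least the length of a simple cycle, so that
  subtracting 1 per edge turns non-positive cycles into negative ones and leaves the positive ones
  non-negative.\<close>

definition tight_edges ::
    "nat \<Rightarrow> int \<Rightarrow> nat \<Rightarrow> ('v \<times> 'v \<times> int) list \<Rightarrow> ('v \<times> int) list \<Rightarrow> ('v \<times> 'v \<times> int) list" where
  "tight_edges k p q es D = concat (map (\<lambda>(a, b, w). concat (map (\<lambda>(u, d).
     if u = a \<and> list_ex (\<lambda>(v, d'). v = b \<and> d' = d + w) D
     then [(a, b, int k * (int q * d - p) - 1)] else []) D)) es)"

text \<open>The second search starts with 0 at every reached vertex, as if an extra source had edges
  of weight 0 to all of them. So its table has an entry for every vertex that a play can visit,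
  without an argument that tight edges lead there.\<close>

definition winning :: "'v list \<Rightarrow> ('v \<times> 'v \<times> int) list \<Rightarrow> 'v \<Rightarrow> int \<Rightarrow> nat \<Rightarrow> bool" where
  "winning vs es s p q =
     (let D = bellman_ford vs es [(s, 0)] in
      unstable es D \<or>
      (let es' = tight_edges (length vs) p q es D in
       unstable es' (bellman_ford vs es' (map (\<lambda>vd. (fst vd, 0)) D))))"

section \<open>Walks and the correctness of the iteration\<close>

definition is_walk :: "('v \<times> 'v) set \<Rightarrow> (nat \<Rightarrow> 'v) \<Rightarrow> nat \<Rightarrow> bool" where
  "is_walk E p n \<longleftrightarrow> (\<forall>i < n. (p i, p (Suc i)) \<in> E)"

definition cost :: "('v \<times> 'v \<Rightarrow> int) \<Rightarrow> (nat \<Rightarrow> 'v) \<Rightarrow> nat \<Rightarrow> int" where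
  "cost w p n = (\<Sum>i<n. w (p i, p (Suc i)))"

lemma cost_simps [simp]: "cost w p 0 = 0" "cost w p (Suc n) = cost w p n + w (p n, p (Suc n))"
  by (auto simp: cost_def)

lemma cost_add: "cost w p (m + n) = cost w p m + cost w (\<lambda>i. p (m + i)) n"
  by (induction n) auto

lemma cost_cong: "(\<And>i. i \<le> n \<Longrightarrow> p i = p' i) \<Longrightarrow> cost w p n = cost w p' n"
  by (auto simp: cost_def intro!: sum.cong)

lemma set_candidates:
  "set (candidates es D v) = {d. (v, d) \<in> set D} \<union> {d + w | d w a. (a, v, w) \<in> set es \<and> (a, d) \<in> set D}"
  unfolding candidates_def by (force split: if_splits)

lemma foldl_min:
  "foldl min c cs \<in> set (c # cs)" "x \<in> set (c # cs) \<Longrightarrow> foldl min c cs \<le> (x :: int)"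
proof -
  have "foldl min c cs \<in> set (c # cs) \<and> (\<forall>x \<in> set (c # cs). foldl min c cs \<le> x)"
  proof (induction cs arbitrary: c)
    case (Cons a cs)
    from Cons[of "min c a"] show ?case by (auto simp: min_def split: if_splits)
  qed simp
  then show "foldl min c cs \<in> set (c # cs)" "x \<in> set (c # cs) \<Longrightarrow> foldl min c cs \<le> x" by blast+
qed

lemma relaxD:
  assumes "(v, d) \<in> set (relax vs es D)"
  shows "v \<in> set vs" "d \<in> set (candidates es D v)" "\<And>c. c \<in> set (candidates es D v) \<Longrightarrow> d \<le> c"
proof -
  have v: "v \<in> set vs" "(v, d) \<in> set (case candidates es D v of [] \<Rightarrow> [] | c # cs \<Rightarrow> [(v, foldl min c cs)])"
    using assms by (auto simp: relax_def split: list.splits)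
  then obtain c cs where "v \<in> set vs" and c: "candidates es D v = c # cs" "d = foldl min c cs"
    by (cases "candidates es D v") auto
  then show "v \<in> set vs" "d \<in> set (candidates es D v)" "\<And>c. c \<in> set (candidates es D v) \<Longrightarrow> d \<le> c"
    using foldl_min(1)[of c cs] foldl_min(2)[of _ c cs] unfolding c by auto
qed

lemma relaxI:
  assumes "v \<in> set vs" "c \<in> set (candidates es D v)"
  obtains d where "(v, d) \<in> set (relax vs es D)" "d \<le> c"
proof -
  obtain b cs where c: "candidates es D v = b # cs" using assms(2) by (cases "candidates es D v") auto
  have "(v, foldl min b cs) \<in> set (relax vs es D)"
    unfolding relax_def using assms(1) c by (auto intro!: bexI[of _ v])
  moreover have "foldl min b cs \<le> c" using foldl_min(2) assms(2) c by metis
  ultimately show ?thesis using that by blast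
qed

lemma bellman_ford_funpow: "bellman_ford vs es D = (relax vs es ^^ length vs) D"
proof -
  have "foldl (\<lambda>D _. relax vs es D) D xs = (relax vs es ^^ length xs) D" for xs :: "'a list"
    by (induction xs arbitrary: D) (auto simp: funpow_swap1)
  then show ?thesis unfolding bellman_ford_def .
qed

text \<open>Interpreted twice: for the game graph with source \<open>s\<close>, and for the tight
  edges with their new weights and all reached vertices as sources.\<close>

locale weighted_graph =
  fixes vs :: "'v list" and E :: "('v \<times> 'v) set" and w :: "'v \<times> 'v \<Rightarrow> int"
    and es :: "('v \<times> 'v \<times> int) list" and I :: "'v set" and D0 :: "('v \<times> int) list"
  assumes E: "E \<subseteq> set vs \<times> set vs"
    and es: "set es = (\<lambda>(a, b). (a, b, w (a, b))) ` E"
    and I: "I \<subseteq> set vs" and D0: "set D0 = I \<times> {0}"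
begin

lemma in_es: "(a, b, c) \<in> set es \<longleftrightarrow> (a, b) \<in> E \<and> c = w (a, b)"
  unfolding es by auto

lemma iterate_sound:
  "(v, d) \<in> set ((relax vs es ^^ k) D0) \<Longrightarrow>
   \<exists>p n. n \<le> k \<and> is_walk E p n \<and> p 0 \<in> I \<and> p n = v \<and> cost w p n = d"
proof (induction k arbitrary: v d)
  case 0
  then show ?case using D0 by (intro exI[of _ "\<lambda>_. v"] exI[of _ 0]) (auto simp: is_walk_def)
next
  case (Suc k)
  let ?D = "(relax vs es ^^ k) D0"
  have "d \<in> set (candidates es ?D v)" using relaxD(2) Suc.prems by simp
  then consider "(v, d) \<in> set ?D" | u d' where "(u, v) \<in> E" "(u, d') \<in> set ?D" "d = d' + w (u, v)"
    unfolding set_candidates in_es by blast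
  then show ?case
  proof cases
    case 1
    then show ?thesis using Suc.IH le_SucI by blast
  next
    case 2
    obtain p n where p: "n \<le> k" "is_walk E p n" "p 0 \<in> I" "p n = u" "cost w p n = d'"
      using Suc.IH[OF 2(2)] by blast
    define p' where "p' = p(Suc n := v)"
    have "is_walk E p' (Suc n)" using p 2(1) by (auto simp: p'_def is_walk_def less_Suc_eq)
    moreover have "cost w p' n = cost w p n" by (rule cost_cong) (auto simp: p'_def)
    moreover have "p' 0 = p 0" "p' n = p n" "p' (Suc n) = v" by (auto simp: p'_def)
    ultimately show ?thesis using p 2 by (intro exI[of _ p'] exI[of _ "Suc n"]) auto
  qed
qed

lemma iterate_complete:
  "is_walk E p n \<Longrightarrow> n \<le> k \<Longrightarrow> p 0 \<in> I \<Longrightarrow> \<exists>d. (p n, d) \<in> set ((relax vs es ^^ k) D0) \<and> d \<le> cost w p n"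
proof (induction k arbitrary: n)
  case 0
  then show ?case using D0 by auto
next
  case (Suc k)
  let ?D = "(relax vs es ^^ k) D0"
  have v: "p n \<in> set vs"
  proof (cases n)
    case (Suc m)
    then have "(p m, p n) \<in> E" using Suc.prems(1) by (auto simp: is_walk_def)
    then show ?thesis using E by auto
  qed (use Suc.prems(3) I in auto)
  have "\<exists>c \<in> set (candidates es ?D (p n)). c \<le> cost w p n"
  proof (cases "n \<le> k")
    case True
    then obtain d where "(p n, d) \<in> set ?D" "d \<le> cost w p n" using Suc.IH[of n] Suc.prems by blast
    then show ?thesis unfolding set_candidates by blast
  next
    case False
    then have n: "n = Suc k" using Suc.prems(2) by simp
    have "is_walk E p k" using Suc.prems(1) n by (auto simp: is_walk_def)
    then obtain d where d: "(p k, d) \<in> set ?D" "d \<le> cost w p k" using Suc.IH[of k] Suc.prems by blast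
    have "(p k, p n) \<in> E" using Suc.prems(1) n by (auto simp: is_walk_def)
    then have "d + w (p k, p n) \<in> set (candidates es ?D (p n))"
      unfolding set_candidates in_es using d(1) by blast
    then show ?thesis by (rule bexI[rotated]) (use d(2) n in simp)
  qed
  then obtain c where c: "c \<in> set (candidates es ?D (p n))" "c \<le> cost w p n" by blast
  obtain d where "(p n, d) \<in> set (relax vs es ?D)" "d \<le> c" using relaxI[OF v c(1)] .
  then show ?case using c(2) by auto
qed

abbreviation result :: "('v \<times> int) list" where
  "result \<equiv> bellman_ford vs es D0"

lemma result_sound:
  "(v, d) \<in> set result \<Longrightarrow> \<exists>p n. n \<le> length vs \<and> is_walk E p n \<and> p 0 \<in> I \<and> p n = v \<and> cost w p n = d"
  using iterate_sound unfolding bellman_ford_funpow by blast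

lemma result_complete:
  "is_walk E p n \<Longrightarrow> n \<le> length vs \<Longrightarrow> p 0 \<in> I \<Longrightarrow> \<exists>d. (p n, d) \<in> set result \<and> d \<le> cost w p n"
  using iterate_complete unfolding bellman_ford_funpow by blast

lemma result_start: "v \<in> I \<Longrightarrow> \<exists>d. (v, d) \<in> set result \<and> d \<le> 0"
  using result_complete[of "\<lambda>_. v" 0] by (auto simp: is_walk_def)

lemma result_unique:
  assumes "(v, d) \<in> set result" "(v, d') \<in> set result"
  shows "d = d'"
proof (cases "length vs")
  case 0
  then show ?thesis using assms I D0 by (auto simp: bellman_ford_funpow)
next
  case (Suc n)
  then have "result = relax vs es ((relax vs es ^^ n) D0)" by (simp add: bellman_ford_funpow)
  then show ?thesis using relaxD(2,3) assms by (metis order_antisym)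
qed

definition dist :: "'v \<Rightarrow> int" where
  "dist v = (THE d. (v, d) \<in> set result)"

lemma dist_eq: "(v, d) \<in> set result \<Longrightarrow> dist v = d"
  unfolding dist_def using result_unique by blast

lemma in_result: "(v, d) \<in> set result \<longleftrightarrow> v \<in> fst ` set result \<and> d = dist v"
  using dist_eq by force

lemma unstable_iff:
  "unstable es D \<longleftrightarrow> (\<exists>a b d. (a, b) \<in> E \<and> (a, d) \<in> set D \<and> \<not> (\<exists>d'. (b, d') \<in> set D \<and> d' \<le> d + w (a, b)))"
proof -
  have "unstable es D \<longleftrightarrow> (\<exists>a b c. (a, b, c) \<in> set es \<and> (\<exists>d. (a, d) \<in> set D \<and> \<not> (\<exists>d'. (b, d') \<in> set D \<and> d' \<le> d + c)))"
    unfolding unstable_def list_ex_iff by fastforce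
  then show ?thesis unfolding in_es by auto
qed

lemma stable_dist:
  assumes "\<not> unstable es result" "(a, b) \<in> E" "a \<in> fst ` set result"
  shows "b \<in> fst ` set result" "dist b \<le> dist a + w (a, b)"
proof -
  have "(a, dist a) \<in> set result" using assms(3) in_result by blast
  then obtain d where d: "(b, d) \<in> set result" "d \<le> dist a + w (a, b)"
    using assms unstable_iff by blast
  then show "b \<in> fst ` set result" "dist b \<le> dist a + w (a, b)" using dist_eq by force+
qed

text \<open>A walk of more than \<open>length vs\<close> edges visits some vertex twice. If there were no negative
  cycle, cutting the detour out would give a walk that the iteration has already accounted for.\<close>

lemma unstable_negative_cycle:
  assumes "unstable es result"
  obtains c m r j where "0 < m" "m \<le> length vs" "is_walk E c m" "c m = c 0" "cost w c m < 0"
    "is_walk E r j" "r 0 \<in> I" "r j = c 0"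
proof -
  obtain a b d where ab: "(a, b) \<in> E" "(a, d) \<in> set result"
    "\<And>d'. (b, d') \<in> set result \<Longrightarrow> d + w (a, b) < d'"
    using assms unstable_iff by (metis not_le)
  obtain p n where p: "n \<le> length vs" "is_walk E p n" "p 0 \<in> I" "p n = a" "cost w p n = d"
    using result_sound[OF ab(2)] by blast
  let ?p = "p(Suc n := b)"
  have walk: "is_walk E ?p (Suc n)" using p ab(1) by (auto simp: is_walk_def less_Suc_eq)
  have "cost w ?p n = cost w p n" by (rule cost_cong) auto
  then have cost: "cost w ?p (Suc n) = d + w (a, b)" using p by simp
  have no_short: "d + w (a, b) < cost w p' n'" if "is_walk E p' n'" "n' \<le> length vs" "p' 0 \<in> I" "p' n' = b" for p' n'
    using result_complete[OF that(1-3)] ab(3) that(4) by force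
  \<comment> \<open>Otherwise the extended walk has at most \<open>length vs\<close> edges, and
    \<open>no_short\<close> would make it cheaper than itself.\<close>
  have n: "n = length vs"
    using no_short[OF walk] cost p(1,3) by (cases "n = length vs") auto
  have in_vs: "?p i \<in> set vs" if "i \<le> n" for i
    using walk that E unfolding is_walk_def by (metis SigmaD1 le_imp_less_Suc subsetD)
  have "\<not> inj_on ?p {..n}"
  proof
    assume "inj_on ?p {..n}"
    then have "card (?p ` {..n}) = Suc n" by (simp only: card_image card_atMost)
    moreover have "card (?p ` {..n}) \<le> card (set vs)" by (rule card_mono) (use in_vs in auto)
    ultimately show False using card_length[of vs] n by simp
  qed
  then obtain i j where ij: "i < j" "j \<le> n" "?p i = ?p j"
    unfolding inj_on_def by (metis atMost_iff linorder_neqE_nat)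
  define m where "m = j - i"
  \<comment> \<open>\<open>?c\<close> is the part between the two visits, \<open>?q\<close> the walk
    with that part cut out.\<close>
  let ?c = "\<lambda>k. ?p (i + k)" and ?q = "\<lambda>k. if k \<le> i then ?p k else ?p (k + m)"
  have j: "j = i + m" using ij m_def by simp
  have m: "0 < m" "m \<le> length vs" using ij m_def n by auto
  have c: "is_walk E ?c m" "?c m = ?c 0"
  proof -
    have "(?c k, ?c (Suc k)) \<in> E" if "k < m" for k
      using walk[unfolded is_walk_def, rule_format, of "i + k"] that ij j by simp
    then show "is_walk E ?c m" unfolding is_walk_def by blast
    show "?c m = ?c 0" using ij j by simp
  qed
  have q: "is_walk E ?q (Suc n - m)"
    unfolding is_walk_def
  proof (intro allI impI)
    fix k assume k: "k < Suc n - m"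
    have edge: "(?p k, ?p (Suc k)) \<in> E" "(?p (k + m), ?p (Suc (k + m))) \<in> E"
      using walk[unfolded is_walk_def, rule_format, of k]
        walk[unfolded is_walk_def, rule_format, of "k + m"] k by auto
    consider "k < i" | "k = i" | "i < k" by linarith
    then show "(?q k, ?q (Suc k)) \<in> E"
    proof cases
      case 1
      then show ?thesis using edge(1) by simp
    next
      case 2
      then show ?thesis using edge(2) ij(3) j by simp
    next
      case 3
      then show ?thesis using edge(2) by simp
    qed
  qed
  have "cost w ?p (Suc n) = cost w ?p (j + (Suc n - j))" using ij by simp
  also have "\<dots> = cost w ?p i + cost w ?c m + cost w (\<lambda>k. ?p (j + k)) (Suc n - j)"
    unfolding cost_add j by simp
  finally have cost1: "cost w ?p (Suc n) = cost w ?p i + cost w ?c m + cost w (\<lambda>k. ?p (j + k)) (Suc n - j)" .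
  have "cost w ?q (Suc n - m) = cost w ?q (i + (Suc n - j))" using ij j by simp
  also have "\<dots> = cost w ?q i + cost w (\<lambda>k. ?q (i + k)) (Suc n - j)" by (rule cost_add)
  also have "cost w ?q i = cost w ?p i" by (rule cost_cong) simp
  also have "cost w (\<lambda>k. ?q (i + k)) (Suc n - j) = cost w (\<lambda>k. ?p (j + k)) (Suc n - j)"
  proof (rule cost_cong)
    fix k
    show "?q (i + k) = ?p (j + k)"
      by (cases k) (use ij j in \<open>simp_all add: ac_simps\<close>)
  qed
  finally have cost2: "cost w ?q (Suc n - m) = cost w ?p i + cost w (\<lambda>k. ?p (j + k)) (Suc n - j)" .
  have "?q (Suc n - m) = b"
  proof -
    have "i < Suc n - m" "Suc n - m + m = Suc n" using ij j by auto
    then show ?thesis by simp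
  qed
  moreover have "?q 0 \<in> I" using p(3) by simp
  moreover have "Suc n - m \<le> length vs" using m n by simp
  ultimately have "d + w (a, b) < cost w ?q (Suc n - m)" using no_short[OF q] by blast
  then have "cost w ?c m < 0" using cost cost1 cost2 by linarith
  moreover have "is_walk E ?p i"
  proof -
    have "(?p k, ?p (Suc k)) \<in> E" if "k < i" for k
      using walk[unfolded is_walk_def, rule_format, of k] that ij by simp
    then show ?thesis unfolding is_walk_def by blast
  qed
  moreover have "?p 0 \<in> I" "?p i = ?c 0" using p(3) by simp_all
  ultimately show ?thesis using that[OF m c] by blast
qed

end

section \<open>Plays that end in a repeated cycle\<close>

lemma bounded_partial_sums:
  fixes f :: "nat \<Rightarrow> int"
  assumes dec: "\<And>i. j \<le> i \<Longrightarrow> f (i + m) \<le> f i" and window: "(\<Sum>i<m. f (j + i)) \<le> 0" and "0 < m"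
  obtains B where "\<And>n. (\<Sum>i<n. f i) \<le> B"
proof -
  let ?F = "\<lambda>n. \<Sum>i<n. f i"
  \<comment> \<open>Moving the window one place to the right exchanges a term for the one
    \<open>m\<close> places later, which is no larger.\<close>
  have win: "(\<Sum>i<m. f (j + k + i)) \<le> 0" for k
  proof (induction k)
    case (Suc k)
    have "(\<Sum>i<Suc m. f (j + k + i)) = f (j + k) + (\<Sum>i<m. f (j + Suc k + i))"
      by (subst sum.lessThan_Suc_shift) simp
    moreover have "(\<Sum>i<Suc m. f (j + k + i)) = (\<Sum>i<m. f (j + k + i)) + f (j + k + m)" by simp
    ultimately show ?case using Suc dec[of "j + k"] by simp
  qed (use window in simp)
  have step: "?F (n + m) \<le> ?F n" if "j \<le> n" for n
  proof -
    have "?F (n + k) = ?F n + (\<Sum>i<k. f (n + i))" for k by (induction k) auto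
    then show ?thesis using win[of "n - j"] that by simp
  qed
  \<comment> \<open>From \<open>j\<close> on, going back by \<open>m\<close> does not lower a
    partial sum, so the sums up to \<open>j + m\<close> bound all others.\<close>
  let ?B = "Max (?F ` {..j + m})"
  have "?F n \<le> ?B" for n
  proof (induction n rule: less_induct)
    case (less n)
    show ?case
    proof (cases "n \<le> j + m")
      case False
      then have "?F (n - m + m) \<le> ?F (n - m)" by (intro step) simp
      then show ?thesis using less[of "n - m"] False \<open>0 < m\<close> by simp
    qed (auto intro!: Max_ge)
  qed
  then show ?thesis using that by blast
qed

definition lasso :: "(nat \<Rightarrow> 'v) \<Rightarrow> nat \<Rightarrow> (nat \<Rightarrow> 'v) \<Rightarrow> nat \<Rightarrow> nat \<Rightarrow> 'v" where
  "lasso r j c m i = (if i < j then r i else c ((i - j) mod m))"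

context
  fixes E :: "('v \<times> 'v) set" and r c :: "nat \<Rightarrow> 'v" and j m :: nat
  assumes r: "is_walk E r j" "r j = c 0" and c: "is_walk E c m" "c m = c 0" and m: "0 < m"
begin

lemma lasso_cycle_step: "c (Suc k mod m) = c (Suc (k mod m))"
  using c(2) m by (auto simp: mod_Suc)

lemma lasso_edge: "(lasso r j c m i, lasso r j c m (Suc i)) \<in> E"
proof (cases "i < j")
  case True
  then have "(r i, r (Suc i)) \<in> E" using r(1) by (auto simp: is_walk_def)
  moreover have "lasso r j c m (Suc i) = r (Suc i)"
    using True r(2) by (cases "Suc i = j") (auto simp: lasso_def)
  ultimately show ?thesis using True by (simp add: lasso_def)
next
  case False
  then have "(c ((i - j) mod m), c (Suc ((i - j) mod m))) \<in> E"
    using c(1) m by (auto simp: is_walk_def)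
  then show ?thesis using False lasso_cycle_step[of "i - j"] by (simp add: lasso_def Suc_diff_le)
qed

lemma cost_lasso: "cost w (lasso r j c m) (j + k) = cost w r j + cost w (\<lambda>i. c (i mod m)) k"
proof -
  have "cost w (lasso r j c m) j = cost w r j"
    by (rule cost_cong) (use r(2) in \<open>auto simp: lasso_def\<close>)
  then show ?thesis unfolding cost_add by (simp add: lasso_def)
qed

lemma cost_cycle: "k \<le> m \<Longrightarrow> cost w (\<lambda>i. c (i mod m)) k = cost w c k"
  by (rule cost_cong) (use c(2) in \<open>auto simp: le_less\<close>)

lemma cost_cycle_add: "cost w (\<lambda>i. c (i mod m)) (k + m) = cost w (\<lambda>i. c (i mod m)) k + cost w c m"
proof -
  have "cost w (\<lambda>i. c (i mod m)) (m + k) = cost w c m + cost w (\<lambda>i. c ((m + i) mod m)) k"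
    unfolding cost_add using cost_cycle[of m] by simp
  then show ?thesis by (simp add: add.commute)
qed

text \<open>A round of the cycle shifts the energy level by \<open>cost w c m\<close>. If this is
  negative, the sum over a round decreases from round to round until it is nonpositive; if it is 0,
  the sum over every round is the one in the hypothesis. Either way
  \<open>bounded_partial_sums\<close> applies from some round on.\<close>

lemma lasso_bounded:
  fixes p :: int and q :: nat
  assumes "0 < q"
    and neg: "cost w c m < 0 \<or>
      cost w c m = 0 \<and> (\<Sum>i<m. int q * (cost w r j + cost w c i) - p) \<le> 0"
  obtains B where "\<And>n. (\<Sum>i<n. int q * cost w (lasso r j c m) i - p) \<le> B"
proof -
  let ?f = "\<lambda>i. int q * cost w (lasso r j c m) i - p"
  let ?C = "int q * cost w c m"
  have step: "?f (i + m) = ?f i + ?C" if "j \<le> i" for i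
    using cost_lasso[of w "i - j"] cost_lasso[of w "i - j + m"] cost_cycle_add[of w "i - j"] that
    by (simp add: algebra_simps)
  have C: "?C \<le> 0" using neg by (auto simp: mult_nonneg_nonpos)
  have steps: "?f (j + t * m + i) = ?f (j + i) + int t * ?C" for t i
  proof (induction t)
    case (Suc t)
    then show ?case using step[of "j + t * m + i"] by (simp add: algebra_simps)
  qed simp
  define S where "S = (\<Sum>i<m. ?f (j + i))"
  have S: "S = (\<Sum>i<m. int q * (cost w r j + cost w c i) - p)"
    unfolding S_def by (intro sum.cong refl) (simp add: cost_lasso cost_cycle)
  obtain t where t: "(\<Sum>i<m. ?f (j + t * m + i)) \<le> 0"
  proof -
    have sum: "(\<Sum>i<m. ?f (j + t * m + i)) = S + int m * (int t * ?C)" for t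
      unfolding steps S_def by (simp add: sum.distrib)
    show ?thesis
    proof (cases "cost w c m < 0")
      case True
      then have "?C \<le> -1" using \<open>0 < q\<close> by (smt (verit) mult_pos_neg of_nat_0_less_iff)
      \<comment> \<open>Each round lowers the sum by at least 1, so as many rounds as the absolute
        value of \<open>S\<close> suffice.\<close>
      have "S + int m * (int (nat \<bar>S\<bar>) * ?C) \<le> 0"
      proof -
        have "int (nat \<bar>S\<bar>) * ?C \<le> \<bar>S\<bar> * -1"
          using \<open>?C \<le> -1\<close> mult_left_mono[of ?C "-1" "\<bar>S\<bar>"] by simp
        moreover have "int m * (int (nat \<bar>S\<bar>) * ?C) \<le> 1 * (int (nat \<bar>S\<bar>) * ?C)"
          by (rule mult_right_mono_neg) (use m C in \<open>auto simp: mult_nonneg_nonpos\<close>)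
        ultimately show ?thesis by linarith
      qed
      then show ?thesis using that sum by metis
    next
      case False
      then show ?thesis using that[of 0] neg S sum[of 0] by simp
    qed
  qed
  have "?f (i + m) \<le> ?f i" if "j + t * m \<le> i" for i using step[of i] C that by simp
  from bounded_partial_sums[OF this t m] show ?thesis using that by blast
qed

end

section \<open>Average-energy and partial sums\<close>

lemma energy_level_cost: "energy_level G \<pi> n = cost (weight G) \<pi> n"
  by (simp add: energy_level_def cost_def)

context
  fixes G :: "('v, 'm) game_scheme" and \<pi> :: "nat \<Rightarrow> 'v" and p :: int and q :: nat
  assumes q: "0 < q"
begin

text \<open>The distance of the energy level from the threshold p / q, multiplied by
  \<open>q\<close> to stay within the integers.\<close>

definition excess :: "nat \<Rightarrow> int" where
  "excess i = int q * energy_level G \<pi> i - p"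

lemma average_excess:
  assumes "0 < n"
  shows "1 / real n * (\<Sum>i = 1..n. real_of_int (energy_level G \<pi> i)) =
    p / q + real_of_int ((\<Sum>i<Suc n. excess i) - excess 0) / (real q * real n)"
proof -
  \<comment> \<open>The average runs over 1..n but the partial sum over 0..n; the term at 0 is the
    difference.\<close>
  have "(\<Sum>i<Suc n. excess i) - excess 0 = (\<Sum>i = 1..n. excess i)"
    by (induction n) auto
  also have "real_of_int \<dots> = real q * (\<Sum>i = 1..n. real_of_int (energy_level G \<pi> i)) - n * p"
    by (simp add: excess_def sum_subtractf sum_distrib_left)
  finally show ?thesis using assms q by (simp add: field_simps)
qed

lemma avg_energy_le:
  assumes "\<And>n. (\<Sum>i<n. excess i) \<le> B"
  shows "avg_energy G \<pi> \<le> ereal (p / q)"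
proof -
  let ?g = "\<lambda>n. p / q + (B - excess 0) / real q * (1 / real n)"
  have "(\<lambda>n. ereal (?g n)) \<longlonglongrightarrow> ereal (p / q + (B - excess 0) / real q * 0)"
    by (intro tendsto_intros lim_1_over_n)
  then have lim: "limsup (\<lambda>n. ereal (?g n)) = ereal (p / q)"
    by (intro lim_imp_Limsup) simp_all
  have "avg_energy G \<pi> \<le> limsup (\<lambda>n. ereal (?g n))"
    unfolding avg_energy_def
  proof (rule Limsup_mono, rule eventually_mono[OF eventually_gt_at_top[of 0]])
    fix n :: nat assume n: "0 < n"
    have "real_of_int ((\<Sum>i<Suc n. excess i) - excess 0) \<le> real_of_int (B - excess 0)"
      using assms[of "Suc n"] by (simp only: of_int_le_iff diff_right_mono)
    then have "real_of_int ((\<Sum>i<Suc n. excess i) - excess 0) / (real q * real n) \<le>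
        real_of_int (B - excess 0) / (real q * real n)"
      by (rule divide_right_mono) simp
    then show "ereal (1 / real n * (\<Sum>i = 1..n. real_of_int (energy_level G \<pi> i))) \<le> ereal (?g n)"
      unfolding average_excess[OF n] by simp
  qed
  then show ?thesis using lim by simp
qed

text \<open>Up to a constant the partial sums grow by 1 / K per step, and after division by
  \<open>q\<close> this leaves a surplus of 1 / (K * q) over p / q in the limit. The strict
  inequality comes from this surplus.\<close>

lemma avg_energy_gt:
  fixes K :: nat
  assumes "0 < K" "\<And>n. int n - B \<le> int K * (\<Sum>i<n. excess i)"
  shows "ereal (p / q) < avg_energy G \<pi>"
proof -
  \<comment> \<open>The constant part of (n + 1 - B) / K - \<open>excess 0\<close>, which vanishes
    when divided by \<open>n\<close>.\<close>
  define B' where "B' = (1 - B) / K - excess 0"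
  let ?g = "\<lambda>n. p / q + 1 / (real K * real q) + B' / real q * (1 / real n)"
  have "(\<lambda>n. ereal (?g n)) \<longlonglongrightarrow> ereal (p / q + 1 / (real K * real q) + B' / real q * 0)"
    by (intro tendsto_intros lim_1_over_n)
  then have lim: "limsup (\<lambda>n. ereal (?g n)) = ereal (p / q + 1 / (real K * real q))"
    by (intro lim_imp_Limsup) simp_all
  have "limsup (\<lambda>n. ereal (?g n)) \<le> avg_energy G \<pi>"
    unfolding avg_energy_def
  proof (rule Limsup_mono, rule eventually_mono[OF eventually_gt_at_top[of 0]])
    fix n :: nat assume n: "0 < n"
    have "real_of_int (int (Suc n) - B) \<le> real_of_int (int K * (\<Sum>i<Suc n. excess i))"
      using assms(2)[of "Suc n"] by (subst of_int_le_iff)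
    then have "(real n + 1 - B) / K \<le> real_of_int (\<Sum>i<Suc n. excess i)"
      using assms(1) by (simp add: field_simps del: sum.lessThan_Suc of_int_sum)
    then have "(real n / K + B') / (real q * real n) \<le>
        real_of_int ((\<Sum>i<Suc n. excess i) - excess 0) / (real q * real n)"
      by (intro divide_right_mono) (auto simp: B'_def add_divide_distrib diff_divide_distrib)
    moreover have "(real n / K + B') / (real q * real n) = 1 / (real K * real q) + B' / real q * (1 / real n)"
      using n q assms(1) by (simp add: field_simps)
    ultimately show "ereal (?g n) \<le> ereal (1 / real n * (\<Sum>i = 1..n. real_of_int (energy_level G \<pi> i)))"
      unfolding average_excess[OF n] by simp
  qed
  moreover have "ereal (p / q) < ereal (p / q + 1 / (real K * real q))" using assms(1) q by simp
  ultimately show ?thesis unfolding lim by (rule less_le_trans[rotated])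
qed

text \<open>The hypothesis on \<open>g\<close> telescopes, and since \<open>g\<close> is bounded
  below, so are the partial sums of K * \<open>excess\<close> - 1. The steps before
  \<open>k0\<close>, for which nothing is assumed, are finitely many and absorbed by a minimum. No
  decomposition of the play into cycles is involved.\<close>

lemma avg_energy_gt_potential:
  fixes K :: nat and g :: "nat \<Rightarrow> int"
  assumes K: "0 < K" and g: "\<And>i. k0 \<le> i \<Longrightarrow> g (Suc i) - g i \<le> int K * excess i - 1" and b: "\<And>i. b \<le> g i"
  shows "ereal (p / q) < avg_energy G \<pi>"
proof -
  let ?h = "\<lambda>i. int K * excess i - 1"
  let ?B = "Min ((\<lambda>n. \<Sum>i<n. ?h i) ` {..k0})"
  have tail: "(\<Sum>i<k0. ?h i) + g (k0 + n) - g k0 \<le> (\<Sum>i<k0 + n. ?h i)" for n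
  proof (induction n)
    case (Suc n)
    then show ?case using g[of "k0 + n"] by simp
  qed simp
  have "min ?B ((\<Sum>i<k0. ?h i) + b - g k0) \<le> (\<Sum>i<n. ?h i)" for n
  proof (cases "n \<le> k0")
    case True
    then have "?B \<le> (\<Sum>i<n. ?h i)" by (intro Min_le) auto
    then show ?thesis by simp
  next
    case False
    then show ?thesis using tail[of "n - k0"] b[of n] by simp
  qed
  moreover have "(\<Sum>i<n. ?h i) = int K * (\<Sum>i<n. excess i) - int n" for n
    by (simp add: sum_subtractf sum_distrib_left)
  ultimately have "int n - (- min ?B ((\<Sum>i<k0. ?h i) + b - g k0)) \<le> int K * (\<Sum>i<n. excess i)" for n
    by (smt (verit))
  from avg_energy_gt[OF K this] show ?thesis .
qed

end

text \<open>Here integrality enters: a bounded nondecreasing sequence has finite range and reaches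
  its maximum.\<close>

lemma mono_int_bounded_or_unbounded:
  fixes f :: "nat \<Rightarrow> int"
  assumes "mono f"
  obtains k where "\<And>i. k \<le> i \<Longrightarrow> f i = f k" | "\<And>B. \<exists>k. \<forall>i \<ge> k. B \<le> f i"
proof (cases "\<exists>B. \<forall>i. f i \<le> B")
  case True
  then obtain B where "\<And>i. f i \<le> B" by blast
  moreover have "f 0 \<le> f i" for i using assms by (simp add: monoD)
  ultimately have "range f \<subseteq> {f 0..B}" by auto
  then have fin: "finite (range f)" by (rule finite_subset) simp
  then have "Max (range f) \<in> range f" by (intro Max_in) auto
  then obtain k where "Max (range f) = f k" by blast
  then have "f i \<le> f k" for i using Max_ge[OF fin, of "f i"] by simp
  then show ?thesis using that(1)[of k] assms by (meson monoD order_antisym)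
next
  case False
  then have "\<exists>k. \<forall>i \<ge> k. B \<le> f i" for B
    using assms by (meson linorder_linear monoD order_trans)
  then show ?thesis using that(2) by blast
qed

section \<open>Reduction of strategies to single plays\<close>

lemma extend_path:
  assumes "\<forall>s \<in> states G. \<exists>s'. (s, s') \<in> edges G" "edges G \<subseteq> states G \<times> states G" "s \<in> states G"
  obtains \<pi> where "is_play_from G s \<pi>"
proof -
  obtain f where f: "\<And>v. v \<in> states G \<Longrightarrow> (v, f v) \<in> edges G" using assms(1) by metis
  have "(f ^^ i) s \<in> states G" for i
    by (induction i) (use assms(2,3) f in auto)
  then have "is_play_from G s (\<lambda>i. (f ^^ i) s)"
    using f by (simp add: is_play_from_def is_play_def)
  then show ?thesis using that by blast
qed

text \<open>\<open>is_prefix\<close> speaks of an infinite play, so the walk has to be prolonged,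
  which works because no state is a dead end. A strategy is guaranteed to give legal moves only on
  such prefixes.\<close>

lemma walk_is_prefix:
  assumes "is_game G" "is_walk (edges G) p n" "p 0 \<in> states G"
  shows "is_prefix G (play_prefix p n)"
proof -
  have "p n \<in> states G"
  proof (cases n)
    case (Suc m)
    then have "(p m, p n) \<in> edges G" using assms(2) by (auto simp: is_walk_def)
    then show ?thesis using assms(1) by (auto simp: is_game_def)
  qed (use assms(3) in simp)
  then obtain \<pi> where \<pi>: "is_play_from G (p n) \<pi>"
    using extend_path[of G "p n"] assms(1) unfolding is_game_def by blast
  let ?\<rho> = "\<lambda>i. if i < n then p i else \<pi> (i - n)"
  have "(?\<rho> i, ?\<rho> (Suc i)) \<in> edges G" for i
  proof (cases "i < n")
    case True
    then have "(p i, p (Suc i)) \<in> edges G" using assms(2) by (auto simp: is_walk_def)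
    moreover have "Suc i = n \<or> Suc i < n" using True by auto
    ultimately show ?thesis using True \<pi> by (auto simp: is_play_from_def)
  next
    case False
    then show ?thesis using \<pi> by (auto simp: is_play_from_def is_play_def Suc_diff_le)
  qed
  moreover have "play_prefix ?\<rho> n = play_prefix p n"
    using \<pi> by (auto simp: play_prefix_def is_play_from_def)
  ultimately have "is_play G ?\<rho> \<and> play_prefix p n = play_prefix ?\<rho> n" by (simp add: is_play_def)
  then show ?thesis unfolding is_prefix_def by (intro exI)
qed

text \<open>Without an opponent every move is chosen by the strategy, so exactly one play from
  \<open>s\<close> is consistent with it.\<close>

lemma player1_wins_iff:
  assumes G: "is_game G" "states2 G = {}" and s: "s \<in> states G"
  shows "player1_wins G s W \<longleftrightarrow> (\<exists>\<pi>. is_play_from G s \<pi> \<and> \<pi> \<in> W)"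
proof
  assume "player1_wins G s W"
  then obtain \<sigma> where \<sigma>: "is_strategy G (states1 G) \<sigma>" "is_winning1 G s W \<sigma>"
    unfolding player1_wins_def by blast
  \<comment> \<open>The history after \<open>n\<close> moves, obtained by iterating the strategy;
    the play itself consists of the last states.\<close>
  define h where "h n = ((\<lambda>\<rho>. \<rho> @ [\<sigma> \<rho>]) ^^ n) [s]" for n
  define \<pi> where "\<pi> n = last (h n)" for n
  have h: "h n = play_prefix \<pi> n" for n
    by (induction n) (auto simp: h_def \<pi>_def play_prefix_def)
  have \<pi>0: "\<pi> 0 = s" by (simp add: \<pi>_def h_def)
  have \<pi>Suc: "\<pi> (Suc n) = \<sigma> (play_prefix \<pi> n)" for n
    unfolding h[symmetric] by (simp add: \<pi>_def h_def)
  have "is_walk (edges G) \<pi> n" for n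
  proof (induction n)
    case (Suc n)
    have "is_prefix G (play_prefix \<pi> n)"
      by (rule walk_is_prefix[OF G(1) Suc]) (simp add: \<pi>0 s)
    moreover have "last (play_prefix \<pi> n) = \<pi> n" by (simp add: play_prefix_def)
    moreover have "\<pi> n \<in> states1 G"
    proof (cases n)
      case (Suc m)
      then have "(\<pi> m, \<pi> n) \<in> edges G" using Suc.IH by (auto simp: is_walk_def)
      then show ?thesis using G by (auto simp: is_game_def states_def)
    qed (use \<pi>0 s G in \<open>simp add: states_def\<close>)
    ultimately have "(\<pi> n, \<pi> (Suc n)) \<in> edges G"
      using \<sigma>(1) \<pi>Suc unfolding is_strategy_def by metis
    then show ?case using Suc by (auto simp: is_walk_def less_Suc_eq)
  qed (simp add: is_walk_def)
  then have "is_play_from G s \<pi>" using \<pi>0 by (auto simp: is_play_from_def is_play_def is_walk_def)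
  moreover from this have "\<pi> \<in> W"
    using \<sigma>(2) \<pi>Suc unfolding is_winning1_def is_consistent_def by blast
  ultimately show "\<exists>\<pi>. is_play_from G s \<pi> \<and> \<pi> \<in> W" by blast
next
  assume "\<exists>\<pi>. is_play_from G s \<pi> \<and> \<pi> \<in> W"
  then obtain \<pi> where \<pi>: "is_play_from G s \<pi>" "\<pi> \<in> W" by blast
  \<comment> \<open>On the prefixes of the play the strategy reproduces it. Elsewhere it picks any
    successor, because \<open>is_strategy\<close> demands a legal move after every prefix.\<close>
  define \<sigma> where "\<sigma> \<rho> = (if \<rho> = play_prefix \<pi> (length \<rho> - 1) then \<pi> (length \<rho>)
    else SOME v. (last \<rho>, v) \<in> edges G)" for \<rho>
  have "is_strategy G (states1 G) \<sigma>"
    unfolding is_strategy_def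
  proof (intro allI impI)
    fix \<rho> assume \<rho>: "is_prefix G \<rho> \<and> last \<rho> \<in> states1 G"
    show "(last \<rho>, \<sigma> \<rho>) \<in> edges G"
    proof (cases "\<rho> = play_prefix \<pi> (length \<rho> - 1)")
      case True
      have "\<rho> \<noteq> []" using \<rho> by (auto simp: is_prefix_def play_prefix_def)
      then have "Suc (length \<rho> - 1) = length \<rho>" by simp
      moreover have "last \<rho> = \<pi> (length \<rho> - 1)"
        by (subst True) (simp add: play_prefix_def)
      ultimately have "(last \<rho>, \<pi> (length \<rho>)) \<in> edges G"
        using \<pi>(1) unfolding is_play_from_def is_play_def by metis
      then show ?thesis using True by (simp add: \<sigma>_def)
    next
      case False
      have "\<exists>v. (last \<rho>, v) \<in> edges G" using \<rho> G(1) by (auto simp: is_game_def states_def)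
      then have "(last \<rho>, SOME v. (last \<rho>, v) \<in> edges G) \<in> edges G" by (rule someI_ex)
      then show ?thesis unfolding \<sigma>_def using False by simp
    qed
  qed
  moreover have "is_winning1 G s W \<sigma>"
    unfolding is_winning1_def
  proof (intro allI impI)
    fix \<pi>' assume \<pi>': "is_play_from G s \<pi>' \<and> is_consistent (states1 G) \<sigma> \<pi>'"
    have in1: "\<pi>' n \<in> states1 G" for n
      using \<pi>' G unfolding is_play_from_def is_play_def is_game_def states_def by blast
    have "\<forall>i \<le> n. \<pi>' i = \<pi> i" for n
    proof (induction n)
      case 0
      then show ?case using \<pi>' \<pi>(1) by (simp add: is_play_from_def)
    next
      case (Suc n)
      then have "play_prefix \<pi>' n = play_prefix \<pi> n" by (auto simp: play_prefix_def)
      moreover have "\<pi>' (Suc n) = \<sigma> (play_prefix \<pi>' n)" using \<pi>' in1 by (auto simp: is_consistent_def)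
      moreover have "\<sigma> (play_prefix \<pi> n) = \<pi> (Suc n)" by (simp add: \<sigma>_def play_prefix_def)
      ultimately show ?case using Suc by (auto simp: le_Suc_eq)
    qed
    then have "\<pi>' = \<pi>" by auto
    then show "\<pi>' \<in> W" using \<pi> by simp
  qed
  ultimately show "player1_wins G s W" unfolding player1_wins_def by blast
qed

section \<open>Correctness of the decision procedure\<close>

lemma in_AvgEnergy:
  "0 < q \<Longrightarrow> \<pi> \<in> AvgEnergy G (of_int p / of_nat q) \<longleftrightarrow> is_play G \<pi> \<and> avg_energy G \<pi> \<le> ereal (p / q)"
  by (simp add: AvgEnergy_def of_rat_divide)

lemma set_concat_map: "x \<in> set (concat (map f xs)) \<longleftrightarrow> (\<exists>y \<in> set xs. x \<in> set (f y))"
  by auto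

lemma in_tight_edges:
  "(a, b, c) \<in> set (tight_edges k p q es D) \<longleftrightarrow>
   (\<exists>w d. (a, b, w) \<in> set es \<and> (a, d) \<in> set D \<and> (b, d + w) \<in> set D \<and> c = int k * (int q * d - p) - 1)"
proof -
  have ex: "list_ex (\<lambda>(v, d'). v = b \<and> d' = d) D \<longleftrightarrow> (b, d) \<in> set D" for b d
    by (auto simp: list_ex_iff)
  have if_mem: "x \<in> set (if P then [y] else []) \<longleftrightarrow> P \<and> x = y" for P and x y :: "'a \<times> 'a \<times> int"
    by auto
  show ?thesis
    unfolding tight_edges_def set_concat_map Bex_def split_paired_Ex prod.case if_mem ex prod.inject
    by blast
qed

theorem winning_iff:
  fixes G :: "'v game"
  assumes G: "is_game G" "states2 G = {}" and s: "s \<in> states G" and q: "0 < q"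
    and vs: "set vs = states1 G"
    and es: "set es = (\<lambda>(u, v). (u, v, weight G (u, v))) ` edges G"
  shows "player1_wins G s (AvgEnergy G (of_int p / of_nat q)) \<longleftrightarrow> winning vs es s p q"
proof -
  define D where "D = bellman_ford vs es [(s, 0)]"
  define K where "K = length vs"
  let ?E = "edges G" and ?w = "weight G"
  have s_vs: "s \<in> set vs" using s G vs by (simp add: states_def)
  then have K: "0 < K" unfolding K_def by (cases vs) auto
  interpret g: weighted_graph vs ?E ?w es "{s}" "[(s, 0)]"
    using G vs es s_vs by unfold_locales (auto simp: is_game_def states_def)
  define R where "R = fst ` set D"
  define es' where "es' = tight_edges K p q es D"
  define E' where "E' = {(a, b) \<in> ?E. a \<in> R \<and> b \<in> R \<and> g.dist b = g.dist a + ?w (a, b)}"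
  define w' where "w' = (\<lambda>(a, b :: 'v). int K * (int q * g.dist a - p) - 1)"
  have in_D: "(v, d) \<in> set D \<longleftrightarrow> v \<in> R \<and> d = g.dist v" for v d
    unfolding D_def R_def by (rule g.in_result)
  have R_vs: "R \<subseteq> set vs"
  proof
    fix v assume "v \<in> R"
    then obtain r n where "is_walk ?E r n" "r 0 = s" "r n = v"
      using g.result_sound[of v "g.dist v"] in_D[of v "g.dist v"] D_def by auto
    then show "v \<in> set vs" using g.E s_vs by (cases n) (auto simp: is_walk_def)
  qed
  interpret t: weighted_graph vs E' w' es' R "map (\<lambda>vd. (fst vd, 0)) D"
  proof
    show "E' \<subseteq> set vs \<times> set vs" using g.E by (auto simp: E'_def)
    show "set es' = (\<lambda>(a, b). (a, b, w' (a, b))) ` E'"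
    proof (rule set_eqI)
      fix e :: "'v \<times> 'v \<times> int"
      obtain a b c where e: "e = (a, b, c)" by (metis prod.collapse)
      show "e \<in> set es' \<longleftrightarrow> e \<in> (\<lambda>(a, b). (a, b, w' (a, b))) ` E'"
        unfolding e es'_def in_tight_edges g.in_es in_D by (auto simp: E'_def w'_def)
    qed
    show "set (map (\<lambda>vd. (fst vd, 0)) D) = R \<times> {0}" by (force simp: R_def)
  qed (rule R_vs)
  have win: "winning vs es s p q \<longleftrightarrow> unstable es D \<or> unstable es' t.result"
    by (simp add: winning_def D_def es'_def K_def Let_def)
  \<comment> \<open>One alternative for each search: a negative cycle, or a cycle of tight edges on
    which the mean distance is at most p / q.\<close>
  have lasso_wins: "player1_wins G s (AvgEnergy G (of_int p / of_nat q))"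
    if h: "is_walk ?E r j" "r 0 = s" "r j = c 0" "is_walk ?E c m" "c m = c 0" "0 < m"
      "cost ?w c m < 0 \<or>
        cost ?w c m = 0 \<and> (\<Sum>i<m. int q * (cost ?w r j + cost ?w c i) - p) \<le> 0" for r c j m
  proof -
    let ?\<pi> = "lasso r j c m"
    obtain B where "\<And>n. (\<Sum>i<n. int q * cost ?w ?\<pi> i - p) \<le> B"
      using lasso_bounded[OF h(1,3-6) q h(7)] by blast
    then have "avg_energy G ?\<pi> \<le> ereal (p / q)"
      by (intro avg_energy_le[OF q, of G _ p B]) (simp add: excess_def[OF q] energy_level_cost)
    moreover have "is_play G ?\<pi>"
      unfolding is_play_def using lasso_edge[OF h(1,3-6)] by blast
    moreover have "?\<pi> 0 = s" using h(2,3) by (auto simp: lasso_def)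
    ultimately show ?thesis
      unfolding player1_wins_iff[OF G s] is_play_from_def in_AvgEnergy[OF q] by blast
  qed
  show ?thesis
  proof (cases "unstable es D")
    case True
    obtain c m r j where "0 < m" "m \<le> length vs" "is_walk ?E c m" "c m = c 0" "cost ?w c m < 0"
        "is_walk ?E r j" "r 0 \<in> {s}" "r j = c 0"
      by (rule g.unstable_negative_cycle[OF True[unfolded D_def]])
    then show ?thesis using lasso_wins[of r j c m] True win by simp
  next
    case False
    have stable: "\<not> unstable es g.result" using False D_def by simp
    have dist_step: "b \<in> R" "g.dist b \<le> g.dist a + ?w (a, b)" if "(a, b) \<in> ?E" "a \<in> R" for a b
      using g.stable_dist[OF stable that(1)] that(2) unfolding R_def D_def by blast+
    have s_R: "s \<in> R" "g.dist s \<le> 0"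
      using g.result_start[of s] in_D D_def by auto
    have walk_dist: "p n \<in> R \<and> g.dist (p n) \<le> g.dist s + cost ?w p n"
      if "is_walk ?E p n" "p 0 = s" for p n
      using that(1)
    proof (induction n)
      case (Suc n)
      have "is_walk ?E p n" "(p n, p (Suc n)) \<in> ?E" using Suc.prems by (auto simp: is_walk_def)
      then show ?case using Suc.IH dist_step[of "p n" "p (Suc n)"] by force
    qed (use that s_R in simp)
    have shortest: "\<exists>r j. is_walk ?E r j \<and> r 0 = s \<and> r j = v \<and> cost ?w r j = g.dist v" if "v \<in> R" for v
      using g.result_sound[of v "g.dist v"] in_D[of v "g.dist v"] that D_def by auto
    \<comment> \<open>The walk that realises \<open>g.dist s\<close> is closed, and
      \<open>walk_dist\<close> applied to it shows that its cost is nonnegative.\<close>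
    have dist_s: "g.dist s = 0"
      using shortest[OF s_R(1)] walk_dist s_R(2) by force
    show ?thesis
    proof (cases "unstable es' t.result")
      case unst: True
      obtain c m where c: "0 < m" "m \<le> K" "is_walk E' c m" "c m = c 0" "cost w' c m < 0"
        by (rule t.unstable_negative_cycle[OF unst]) (auto simp: K_def)
      have edge: "(c i, c (Suc i)) \<in> E'" if "i < m" for i using c(3) that by (simp add: is_walk_def)
      have "c 0 \<in> R" using edge[of 0] c(1) by (simp add: E'_def)
      then obtain r j where r: "is_walk ?E r j" "r 0 = s" "r j = c 0" "cost ?w r j = g.dist (c 0)"
        using shortest by blast
      have dist_c: "g.dist (c 0) + cost ?w c i = g.dist (c i)" if "i \<le> m" for i
        using that
      proof (induction i)
        case (Suc i)
        then show ?case using edge[of i] by (simp add: E'_def)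
      qed simp
      let ?S = "\<Sum>i<m. int q * g.dist (c i) - p"
      have scaled_sum: "(\<Sum>i<n. int K * h i - 1) = int K * (\<Sum>i<n. h i) - int n" for n h
        by (induction n) (auto simp: algebra_simps)
      have "cost w' c m = int K * ?S - int m"
        unfolding cost_def w'_def prod.case by (rule scaled_sum)
      \<comment> \<open>From K * S < m and m \<le> K; as \<open>?S\<close> is an integer, it is at
        most 0.\<close>
      then have "int K * ?S < int K" using c(2,5) by simp
      then have "?S \<le> 0" using K by simp
      moreover have "(\<Sum>i<m. int q * (cost ?w r j + cost ?w c i) - p) = ?S"
        by (intro sum.cong refl) (simp add: r(4) dist_c)
      moreover have "cost ?w c m = 0" using dist_c[of m] c(4) by simp
      moreover have "is_walk ?E c m" using c(3) by (auto simp: is_walk_def E'_def)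
      ultimately have "player1_wins G s (AvgEnergy G (of_int p / of_nat q))"
        using lasso_wins[OF r(1-3) _ c(4,1)] by simp
      then show ?thesis using win unst by simp
    next
      case st: False
      have "\<not> avg_energy G \<pi> \<le> ereal (p / q)" if \<pi>: "is_play_from G s \<pi>" for \<pi>
      proof -
        have \<pi>0: "\<pi> 0 = s" and edge: "(\<pi> i, \<pi> (Suc i)) \<in> ?E" for i
          using \<pi> by (auto simp: is_play_from_def is_play_def)
        have \<pi>R: "\<pi> i \<in> R" for i
          using walk_dist[of \<pi> i] edge \<pi>0 by (auto simp: is_walk_def)
        define f where "f i = cost ?w \<pi> i - g.dist (\<pi> i)" for i
        have "mono f"
          unfolding mono_iff_le_Suc
        proof
          fix i show "f i \<le> f (Suc i)" using dist_step(2)[OF edge \<pi>R, of i] by (simp add: f_def)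
        qed
        have "f 0 = 0" using \<pi>0 dist_s by (simp add: f_def)
        then have f_nonneg: "0 \<le> f i" for i using \<open>mono f\<close> by (metis monoD le0)
        have excess: "excess G \<pi> p q i = int q * (g.dist (\<pi> i) + f i) - p" for i
          by (simp add: excess_def[OF q] energy_level_cost f_def)
        have finite_R: "finite R" using R_vs finite_subset by blast
        show ?thesis
        proof (rule mono_int_bounded_or_unbounded[OF \<open>mono f\<close>])
          fix k assume k: "\<And>i. k \<le> i \<Longrightarrow> f i = f k"
          let ?g = "\<lambda>i. t.dist (\<pi> i)"
          have R_dom: "R \<subseteq> fst ` set t.result" using t.result_start by force
          have "?g (Suc i) - ?g i \<le> int K * excess G \<pi> p q i - 1" if "k \<le> i" for i
          proof -
            have "f (Suc i) = f i" using k[of i] k[of "Suc i"] that by simp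
            then have "(\<pi> i, \<pi> (Suc i)) \<in> E'" using edge \<pi>R by (auto simp: E'_def f_def)
            then have "?g (Suc i) \<le> ?g i + w' (\<pi> i, \<pi> (Suc i))"
              by (rule t.stable_dist(2)[OF st]) (use \<pi>R R_dom in blast)
            \<comment> \<open>A positive final value of \<open>f\<close> only increases the excess,
              so the weights formed from \<open>g.dist\<close> are a lower bound.\<close>
            moreover have "int K * (int q * g.dist (\<pi> i) - p) \<le> int K * excess G \<pi> p q i"
              unfolding excess by (intro mult_left_mono) (use f_nonneg in \<open>auto simp: mult_left_mono\<close>)
            ultimately show ?thesis by (simp add: w'_def)
          qed
          moreover have "Min (t.dist ` R) \<le> ?g i" for i using finite_R \<pi>R by simp
          ultimately show ?thesis
            using avg_energy_gt_potential[OF q K, of k ?g G \<pi> p "Min (t.dist ` R)"] by simp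
        next
          assume unb: "\<And>B. \<exists>k. \<forall>i \<ge> k. B \<le> f i"
          let ?b = "Min (g.dist ` R)"
          \<comment> \<open>From here on the energy level is at least |p| + 1 and hence the excess
            at least 1, so the constant potential 0 does.\<close>
          obtain k where k: "\<And>i. k \<le> i \<Longrightarrow> \<bar>p\<bar> + 1 - ?b \<le> f i" using unb by blast
          have "(0 :: int) - 0 \<le> int K * excess G \<pi> p q i - 1" if "k \<le> i" for i
          proof -
            have "?b \<le> g.dist (\<pi> i)" using finite_R \<pi>R by simp
            then have le: "\<bar>p\<bar> + 1 \<le> g.dist (\<pi> i) + f i" using k[OF that] by linarith
            have "1 \<le> int q * x - p" if "\<bar>p\<bar> + 1 \<le> x" for x
            proof -
              have "1 * x \<le> int q * x" by (rule mult_right_mono) (use q that in auto)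
              then show ?thesis using that abs_ge_self[of p] by linarith
            qed
            then have "1 \<le> excess G \<pi> p q i" using le unfolding excess by blast
            then have "1 * 1 \<le> int K * excess G \<pi> p q i" by (intro mult_mono) (use K in auto)
            then show ?thesis by simp
          qed
          then show ?thesis
            using avg_energy_gt_potential[OF q K, of k "\<lambda>_. 0" G \<pi> p 0] by simp
        qed
      qed
      then have "\<not> player1_wins G s (AvgEnergy G (of_int p / of_nat q))"
        unfolding player1_wins_iff[OF G s] in_AvgEnergy[OF q] by blast
      then show ?thesis using win False st by simp
    qed
  qed
qed


section \<open>The decision procedure\<close>

type_synonym vertex = "bool list"

section \<open>Polynomial running time of the graph searches\<close>

lemma polytime_eq_vertex: "polytime f \<Longrightarrow> polytime g \<Longrightarrow> polytime (\<lambda>x. f x = (g x :: vertex))"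
  by (intro polytime_eq_list polytime_eq_bool polytime_intros)

lemma polytime_eq_edge: "polytime f \<Longrightarrow> polytime g \<Longrightarrow> polytime (\<lambda>x. f x = (g x :: vertex \<times> vertex))"
  by (intro polytime_eq_prod polytime_eq_vertex polytime_intros)

lemma polytime_candidates:
  assumes "polytime es" "polytime D" "polytime v"
  shows "polytime (\<lambda>x. candidates (es x) (D x) (v x :: vertex))"
  unfolding candidates_def
  by (intro polytime_eq_vertex polytime_arith polytime_intros polytime_comp[OF assms(1)] polytime_comp[OF assms(2)] polytime_comp[OF assms(3)])

lemma polytime_foldl_min:
  assumes c: "polytime c" and cs: "polytime cs"
  shows "polytime (\<lambda>x. foldl min (c x) (cs x) :: int)"
proof -
  obtain p where p: "poly_bounded p" "\<And>x. dsize (c x) \<le> p (dsize x)" by (rule polytime_size[OF c], rule that)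
  obtain q where q: "poly_bounded q" "\<And>x. dsize (cs x) \<le> q (dsize x)" by (rule polytime_size[OF cs], rule that)
  show ?thesis
  proof (rule polytime_foldl[OF cs c])
    show "polytime (\<lambda>y. min (fst (snd y)) (snd (snd y)) :: int)" by (intro polytime_arith polytime_intros)
    show "poly_bounded (\<lambda>n. p n + q n)" by (intro poly_bounded_intros p(1) q(1))
    fix x k
    \<comment> \<open>A minimum is one of the given numbers, so it is no larger as data than the
      input.\<close>
    have "foldl min (c x) (take k (cs x)) \<in> set (c x # cs x)"
      using foldl_min(1)[of "c x" "take k (cs x)"] set_take_subset[of k "cs x"] by auto
    then show "dsize (foldl min (c x) (take k (cs x))) \<le> p (dsize x) + q (dsize x)"
      using p(2)[of x] q(2)[of x] dsize_member[of _ "cs x"] by fastforce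
  qed
qed

lemma polytime_relax:
  assumes "polytime vs" "polytime es" "polytime D"
  shows "polytime (\<lambda>x. relax (vs x :: vertex list) (es x) (D x))"
  unfolding relax_def
  by (intro polytime_candidates polytime_foldl_min polytime_intros polytime_comp[OF assms(1)] polytime_comp[OF assms(2)] polytime_comp[OF assms(3)])

text \<open>A new value is an old one or an old one plus a weight; this costs one bit per
  round.\<close>

lemma relax_bound:
  assumes "\<And>v d. (v, d) \<in> set D \<Longrightarrow> \<bar>d\<bar> < 2 ^ n" "\<And>a b w. (a, b, w) \<in> set es \<Longrightarrow> \<bar>w\<bar> < 2 ^ n"
    and "(v, d) \<in> set (relax vs es D)"
  shows "\<bar>d\<bar> < 2 ^ Suc n"
proof -
  have "d \<in> set (candidates es D v)" using relaxD(2)[OF assms(3)] .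
  then consider "(v, d) \<in> set D" | a c w where "(a, v, w) \<in> set es" "(a, c) \<in> set D" "d = c + w"
    unfolding set_candidates by blast
  then show ?thesis
  proof cases
    case 1
    then show ?thesis using assms(1)[of v d] by simp
  next
    case 2
    then show ?thesis using assms(1)[of a c] assms(2)[of a v w] by simp
  qed
qed

lemma dsize_concat_map:
  "(\<And>v. v \<in> set vs \<Longrightarrow> dsize (f v) \<le> Suc c) \<Longrightarrow> dsize (concat (map f vs)) \<le> Suc (length vs * c)"
proof (induction vs)
  case (Cons v vs)
  have "dsize (concat (map f vs)) \<le> Suc (length vs * c)" using Cons by simp
  then show ?case using Cons.prems[of v] dsize_append[of "f v" "concat (map f vs)"] by simp
qed simp

lemma dsize_relax:
  assumes "\<And>v d. (v, d) \<in> set (relax vs es D) \<Longrightarrow> \<bar>d\<bar> < 2 ^ n"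
  shows "dsize (relax vs es D) \<le> Suc (length vs * (dsize vs + 8 * n + 6))"
  unfolding relax_def
proof (rule dsize_concat_map)
  fix v assume v: "v \<in> set vs"
  show "dsize (case candidates es D v of [] \<Rightarrow> [] | c # cs \<Rightarrow> [(v, foldl min c cs)]) \<le> Suc (dsize vs + 8 * n + 6)"
  proof (cases "candidates es D v")
    case (Cons c cs)
    then have "(v, foldl min c cs) \<in> set (relax vs es D)"
      unfolding relax_def using v by (auto intro!: bexI[of _ v])
    then have "dsize (foldl min c cs) \<le> 8 * n + 3" using assms dsize_int_le by blast
    then show ?thesis using Cons dsize_member[OF v] by simp
  qed simp
qed

text \<open>Numbers start with at most as many bits as the input is large and gain one bit per
  round. A table after at least one round has at most one entry per element of \<open>vs\<close>, so
  only the numbers can make it grow. The summand \<open>dsize D\<close> covers the start, before any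
  round.\<close>

lemma dsize_iterate:
  assumes "k \<le> length vs"
  shows "dsize ((relax vs es ^^ k) D) \<le>
    dsize D + Suc (length vs * (dsize vs + 8 * (dsize es + dsize D + length vs) + 6))"
proof -
  have pow: "(2 :: int) ^ m \<le> 2 ^ n" if "m \<le> n" for m n using that by (simp add: power_increasing)
  let ?n = "dsize es + dsize D"
  have es: "\<bar>c\<bar> < 2 ^ (?n + j)" if "(a, b, c) \<in> set es" for a b c j
  proof -
    have "dsize c \<le> ?n + j" using dsize_member[OF that] by simp
    then show ?thesis using abs_less_dsize[of c] pow less_le_trans by blast
  qed
  have D: "\<bar>d\<bar> < 2 ^ (?n + j)" if "(v, d) \<in> set ((relax vs es ^^ j) D)" for v d j
    using that
  proof (induction j arbitrary: v d)
    case 0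
    then have "dsize d \<le> ?n + 0" using dsize_member[of "(v, d)" D] by simp
    then show ?case using abs_less_dsize[of d] pow less_le_trans by blast
  next
    case (Suc j)
    have "\<bar>d\<bar> < 2 ^ Suc (?n + j)"
      by (rule relax_bound[OF Suc.IH es]) (use Suc.prems in auto)
    then show ?case by simp
  qed
  show ?thesis
  proof (cases k)
    case (Suc j)
    have "dsize (relax vs es ((relax vs es ^^ j) D)) \<le> Suc (length vs * (dsize vs + 8 * (?n + length vs) + 6))"
    proof (rule dsize_relax)
      fix v d assume "(v, d) \<in> set (relax vs es ((relax vs es ^^ j) D))"
      then have "\<bar>d\<bar> < 2 ^ (?n + Suc j)" using D[of v d "Suc j"] by simp
      then show "\<bar>d\<bar> < 2 ^ (?n + length vs)" using pow[of "?n + Suc j" "?n + length vs"] Suc assms by linarith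
    qed
    then show ?thesis using Suc by simp
  qed simp
qed

lemma polytime_bellman_ford:
  assumes vs: "polytime vs" and es: "polytime es" and D: "polytime D"
  shows "polytime (\<lambda>x. bellman_ford (vs x :: vertex list) (es x) (D x))"
proof -
  obtain p where p: "poly_bounded p" "\<And>x. dsize (vs x) \<le> p (dsize x)" by (rule polytime_size[OF vs], rule that)
  obtain q where q: "poly_bounded q" "\<And>x. dsize (es x) \<le> q (dsize x)" by (rule polytime_size[OF es], rule that)
  obtain r where r: "poly_bounded r" "\<And>x. dsize (D x) \<le> r (dsize x)" by (rule polytime_size[OF D], rule that)
  show ?thesis
    unfolding bellman_ford_def
  proof (rule polytime_foldl[OF vs D])
    show "polytime (\<lambda>y. relax (vs (fst y)) (es (fst y)) (fst (snd y)))"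
      by (intro polytime_relax polytime_intros polytime_comp[OF vs] polytime_comp[OF es])
    show "poly_bounded (\<lambda>n. r n + Suc (p n * (p n + 8 * (q n + r n + p n) + 6)))"
      by (intro poly_bounded_intros p(1) q(1) r(1))
    fix x k
    have len: "length (vs x) \<le> p (dsize x)" using length_le_dsize[of "vs x"] p(2)[of x] by simp
    have "foldl (\<lambda>D _. relax (vs x) (es x) D) D ws = (relax (vs x) (es x) ^^ length ws) D" for D and ws :: "vertex list"
      by (induction ws arbitrary: D) (auto simp: funpow_swap1)
    then have "dsize (foldl (\<lambda>D _. relax (vs x) (es x) D) (D x) (take k (vs x))) \<le> dsize (D x) +
        Suc (length (vs x) * (dsize (vs x) + 8 * (dsize (es x) + dsize (D x) + length (vs x)) + 6))"
      using dsize_iterate[of "length (take k (vs x))" "vs x"] by simp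
    also have "\<dots> \<le> r (dsize x) +
        Suc (p (dsize x) * (p (dsize x) + 8 * (q (dsize x) + r (dsize x) + p (dsize x)) + 6))"
      by (intro add_mono mult_mono Suc_le_mono[THEN iffD2] r(2) q(2) p(2) len order_refl) auto
    finally show "dsize (foldl (\<lambda>D _. relax (vs x) (es x) D) (D x) (take k (vs x))) \<le> r (dsize x) +
        Suc (p (dsize x) * (p (dsize x) + 8 * (q (dsize x) + r (dsize x) + p (dsize x)) + 6))" .
  qed
qed

lemma polytime_unstable:
  assumes "polytime es" "polytime D"
  shows "polytime (\<lambda>x. unstable (es x :: (vertex \<times> vertex \<times> int) list) (D x))"
  unfolding unstable_def
  by (intro polytime_eq_vertex polytime_arith polytime_intros polytime_comp[OF assms(1)] polytime_comp[OF assms(2)])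

lemma polytime_tight_edges:
  assumes "polytime k" "polytime p" "polytime q" "polytime es" "polytime D"
  shows "polytime (\<lambda>x. tight_edges (k x) (p x) (q x) (es x :: (vertex \<times> vertex \<times> int) list) (D x))"
  unfolding tight_edges_def
  by (intro polytime_eq_vertex polytime_arith polytime_intros polytime_comp[OF assms(1)] polytime_comp[OF assms(2)]
      polytime_comp[OF assms(3)] polytime_comp[OF assms(4)] polytime_comp[OF assms(5)])

lemma polytime_winning:
  assumes "polytime vs" "polytime es" "polytime s" "polytime p" "polytime q"
  shows "polytime (\<lambda>x. winning (vs x :: vertex list) (es x) (s x) (p x) (q x))"
  unfolding winning_def
  by (intro polytime_unstable polytime_tight_edges polytime_bellman_ford polytime_arith polytime_intros
      polytime_comp[OF assms(1)] polytime_comp[OF assms(2)] polytime_comp[OF assms(3)] polytime_comp[OF assms(4)] polytime_comp[OF assms(5)])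


section \<open>Parsing of encoded instances\<close>

definition head_list :: "'a list list \<Rightarrow> 'a list" where
  "head_list xs = (case xs of [] \<Rightarrow> [] | x # _ \<Rightarrow> x)"

lemma head_list_Cons [simp]: "head_list (x # xs) = x"
  by (simp add: head_list_def)

lemma polytime_head_list: "polytime l \<Longrightarrow> polytime (\<lambda>x. head_list (l x))"
  unfolding head_list_def by (intro polytime_intros)

definition pair_step :: "'a list \<times> ('a \<times> 'a) list \<Rightarrow> 'a \<Rightarrow> 'a list \<times> ('a \<times> 'a) list" where
  "pair_step st b = (case fst st of [] \<Rightarrow> ([b], snd st) | a # _ \<Rightarrow> ([], (a, b) # snd st))"

text \<open>Tokens occupy two bits. The blocks come out in reverse order, which suits reading from
  the right. An odd last bit is dropped here and detected by the later comparison with the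
  re-encoded input.\<close>

definition rev_pairs :: "'a list \<Rightarrow> ('a \<times> 'a) list" where
  "rev_pairs bs = snd (foldl pair_step ([], []) bs)"

lemma rev_pairs_concat: "rev_pairs (concat (map (\<lambda>(a, b). [a, b]) ps)) = rev ps"
proof -
  have "foldl pair_step ([], out) (concat (map (\<lambda>(a, b). [a, b]) ps)) = ([], rev ps @ out)" for out
    by (induction ps arbitrary: out) (auto simp: pair_step_def)
  then show ?thesis by (simp add: rev_pairs_def)
qed

lemma polytime_rev_pairs:
  fixes l :: "'a :: data \<Rightarrow> 'b :: data list"
  assumes l: "polytime l"
  shows "polytime (\<lambda>x. rev_pairs (l x))"
proof -
  obtain p where p: "poly_bounded p" "\<And>x. dsize (l x) \<le> p (dsize x)" by (rule polytime_size[OF l], rule that)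
  have "polytime (\<lambda>x. foldl pair_step ([], []) (l x))"
  proof (rule polytime_foldl_additive[OF l polytime_const])
    show "polytime (\<lambda>y. pair_step (fst (snd y)) (snd (snd y)))"
      unfolding pair_step_def by (intro polytime_intros)
    show "poly_bounded (\<lambda>n. Suc (Suc (Suc (p n))))" by (intro poly_bounded_intros p(1))
    show "dsize (pair_step acc a) \<le> dsize acc + Suc (Suc (Suc (p (dsize x))))" if "a \<in> set (l x)" for x acc a
      using dsize_member[OF that] p(2)[of x] by (cases acc) (auto simp: pair_step_def split: list.splits)
  qed
  then show ?thesis unfolding rev_pairs_def by (rule polytime_snd)
qed

text \<open>Tokens as pairs of bits. They are read from right to left, so that each token extends the front
  of the sections (separated by semicolons) of fields (terminated by commas) found so far.\<close>

definition token_pair :: "token \<Rightarrow> bool \<times> bool" where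
  "token_pair t = (case t of Bit b \<Rightarrow> (False, b) | Comma \<Rightarrow> (True, False) | Semicolon \<Rightarrow> (True, True))"

definition section_step :: "bool list list list \<Rightarrow> bool \<times> bool \<Rightarrow> bool list list list" where
  "section_step st t = (case st of [] \<Rightarrow> [] | sec # secs \<Rightarrow>
     if fst t then (if snd t then [] # sec # secs else ([] # sec) # secs)
     else (case sec of [] \<Rightarrow> [] # secs | bs # flds \<Rightarrow> ((snd t # bs) # flds) # secs))"

definition sections :: "bool list \<Rightarrow> bool list list list" where
  "sections x = foldl section_step [[]] (rev_pairs x)"

text \<open>The reading done by \<open>sections\<close>, as a \<open>foldr\<close> over the tokens
  in their original order. A concatenation is thus read from its last part on, each part continuing
  with the state left by the next one.\<close>

definition read_tokens :: "token list \<Rightarrow> bool list list list \<Rightarrow> bool list list list" where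
  "read_tokens ts st = foldr (\<lambda>t st. section_step st (token_pair t)) ts st"

lemma sections_tokens: "sections (concat (map token_bits ts)) = read_tokens ts [[]]"
proof -
  have "token_bits t = (\<lambda>(a, b). [a, b]) (token_pair t)" for t
    by (cases t) (auto simp: token_pair_def)
  then have "map token_bits ts = map (\<lambda>(a, b). [a, b]) (map token_pair ts)"
    unfolding map_map by (intro map_cong) auto
  then have "rev_pairs (concat (map token_bits ts)) = rev (map token_pair ts)"
    using rev_pairs_concat by metis
  then show ?thesis
    by (simp add: sections_def read_tokens_def foldl_conv_foldr foldr_map comp_def)
qed

lemma read_tokens_append: "read_tokens (ts @ us) st = read_tokens ts (read_tokens us st)"
  by (simp add: read_tokens_def)

lemma read_tokens_Semicolon: "read_tokens [Semicolon] (sec # secs) = [] # sec # secs"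
  by (simp add: read_tokens_def token_pair_def section_step_def)

lemma read_tokens_field: "read_tokens (field bs) (sec # secs) = (bs # sec) # secs"
proof -
  have "read_tokens (map Bit bs) ((cs # sec) # secs) = ((bs @ cs) # sec) # secs" for cs
    by (induction bs) (auto simp: read_tokens_def token_pair_def section_step_def)
  then show ?thesis
    by (simp add: field_def read_tokens_append) (simp add: read_tokens_def token_pair_def section_step_def)
qed

lemma read_tokens_fields: "read_tokens (concat (map field bss)) (sec # secs) = (bss @ sec) # secs"
proof (induction bss)
  case (Cons bs bss)
  then show ?case by (simp add: read_tokens_append read_tokens_field)
qed (simp add: read_tokens_def)

lemma polytime_sections: "polytime sections"
proof -
  have l: "polytime (\<lambda>x :: bool list. rev_pairs x)" by (intro polytime_rev_pairs polytime_id)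
  have "polytime (\<lambda>x. foldl section_step [[]] (rev_pairs x))"
  proof (rule polytime_foldl_additive[OF l polytime_const])
    show "polytime (\<lambda>y. section_step (fst (snd y)) (snd (snd y)))"
      unfolding section_step_def by (intro polytime_intros)
    show "poly_bounded (\<lambda>n. 4)" by (rule poly_bounded_const)
    show "dsize (section_step acc a) \<le> dsize acc + 4" for acc a
      using dsize_bool[of "snd a"] by (auto simp: section_step_def split: list.splits)
  qed
  then show ?thesis unfolding sections_def .
qed

definition triple_step ::
    "bool list list \<times> (vertex \<times> vertex \<times> int) list \<Rightarrow> bool list \<Rightarrow> bool list list \<times> (vertex \<times> vertex \<times> int) list" where
  "triple_step st bs = (case fst st of [] \<Rightarrow> ([bs], snd st) | u # us \<Rightarrow>
     (case us of [] \<Rightarrow> ([u, bs], snd st) | v # _ \<Rightarrow> ([], (u, v, int_val bs) # snd st)))"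

definition triples :: "bool list list \<Rightarrow> (vertex \<times> vertex \<times> int) list" where
  "triples bss = rev (snd (foldl triple_step ([], []) bss))"

lemma triples_concat: "triples (concat (map (\<lambda>(u, v, w). [u, v, int_bits w]) es)) = es"
proof -
  have "foldl triple_step ([], out) (concat (map (\<lambda>(u, v, w). [u, v, int_bits w]) es)) = ([], rev es @ out)" for out
    by (induction es arbitrary: out) (auto simp: triple_step_def)
  then show ?thesis by (simp add: triples_def)
qed

lemma polytime_triples:
  assumes l: "polytime l"
  shows "polytime (\<lambda>x. triples (l x))"
proof -
  obtain p where p: "poly_bounded p" "\<And>x. dsize (l x) \<le> p (dsize x)" by (rule polytime_size[OF l], rule that)
  obtain q where q: "poly_bounded q" "\<And>x. dsize (int_val x) \<le> q (dsize x)"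
    by (rule polytime_size[OF polytime_int_val[OF polytime_id]], rule that)
  have "polytime (\<lambda>x. foldl triple_step ([], []) (l x))"
  proof (rule polytime_foldl_additive[OF l polytime_const])
    show "polytime (\<lambda>y. triple_step (fst (snd y)) (snd (snd y)))"
      unfolding triple_step_def by (intro polytime_int_val polytime_intros)
    show "poly_bounded (\<lambda>n. 4 + p n + q (p n))"
      by (intro poly_bounded_intros p(1) poly_bounded_comp[OF q(1) p(1)])
    fix x acc a assume a: "a \<in> set (l x)"
    have ap: "dsize a \<le> p (dsize x)" using dsize_member[OF a] p(2)[of x] by simp
    then have "dsize (int_val a) \<le> q (p (dsize x))"
      using q(2)[of a] poly_bounded_mono[OF q(1) ap] by simp
    then show "dsize (triple_step acc a) \<le> dsize acc + (4 + p (dsize x) + q (p (dsize x)))"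
      using ap by (cases acc) (auto simp: triple_step_def split: list.splits)
  qed
  then show ?thesis unfolding triples_def by (intro polytime_rev polytime_snd)
qed

section \<open>Re-encoding and acceptance\<close>

definition field_bits :: "bool list \<Rightarrow> bool list" where
  "field_bits bs = concat (map (\<lambda>b. [False, b]) bs) @ [True, False]"

lemma polytime_field_bits: "polytime f \<Longrightarrow> polytime (\<lambda>x. field_bits (f x))"
  unfolding field_bits_def by (intro polytime_intros)

text \<open>The encoding as a function of what \<open>decode\<close> returns: the list of player 2
  is empty, whence two semicolons in a row, and the weights come with the edges.\<close>

definition encoding ::
    "vertex list \<Rightarrow> (vertex \<times> vertex \<times> int) list \<Rightarrow> vertex \<Rightarrow> int \<Rightarrow> nat \<Rightarrow> bool list" where
  "encoding vs es s p q = concat (map field_bits vs) @ [True, True] @ [True, True] @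
     concat (map (\<lambda>(u, v, w). field_bits u @ field_bits v @ field_bits (int_bits w)) es) @ [True, True] @
     field_bits s @ field_bits (int_bits p) @ field_bits (nat_bits q)"

lemma token_bits_field: "concat (map token_bits (field bs)) = field_bits bs"
  by (simp add: field_def field_bits_def comp_def)

lemma token_bits_concat: "concat (map token_bits (concat (map f xs))) = concat (map (\<lambda>x. concat (map token_bits (f x))) xs)"
  by (induction xs) auto

lemma encoding_eq:
  "concat (map token_bits (instance_tokens vs [] es w s p q)) =
   encoding vs (map (\<lambda>(u, v). (u, v, w (u, v))) es) s p q"
  by (simp add: instance_tokens_def encoding_def token_bits_field token_bits_concat split_def comp_def)

lemma sections_instance:
  "sections (concat (map token_bits (instance_tokens vs1 vs2 es w s p q))) =
   [vs1, vs2, concat (map (\<lambda>(u, v, w). [u, v, int_bits w]) (map (\<lambda>(u, v). (u, v, w (u, v))) es)),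
    [s, int_bits p, nat_bits q]]"
proof -
  have "concat (map (\<lambda>(u, v). field u @ field v @ field (int_bits (w (u, v)))) es) =
      concat (map field (concat (map (\<lambda>(u, v, w). [u, v, int_bits w]) (map (\<lambda>(u, v). (u, v, w (u, v))) es))))"
    by (induction es) auto
  then show ?thesis
    unfolding sections_tokens instance_tokens_def read_tokens_append
    by (simp add: read_tokens_field read_tokens_fields read_tokens_Semicolon)
qed

text \<open>The section of player 2 is skipped; that it is empty is established by the comparison
  with \<open>encoding\<close>, as is the right number of sections and fields.\<close>

definition decode :: "bool list \<Rightarrow> vertex list \<times> (vertex \<times> vertex \<times> int) list \<times> vertex \<times> int \<times> nat" where
  "decode x = (let secs = sections x; l = head_list (tl (tl (tl secs))) in
     (head_list secs, triples (head_list (tl (tl secs))), head_list l, int_val (head_list (tl l)),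
      bits_val (head_list (tl (tl l)))))"

lemma decode_instance:
  "decode (concat (map token_bits (instance_tokens vs1 vs2 es w s p q))) =
   (vs1, map (\<lambda>(u, v). (u, v, w (u, v))) es, s, p, q)"
  unfolding decode_def sections_instance Let_def by (simp only: list.sel head_list_Cons triples_concat
      int_val_int_bits bits_val_nat_bits)

lemma polytime_decode: "polytime decode"
  unfolding decode_def
  by (intro polytime_triples polytime_head_list polytime_arith polytime_intros polytime_comp[OF polytime_sections])

text \<open>Edges must differ as pairs of states, not merely as triples: the same edge with two
  weights would not define a weight function.\<close>

definition is_instance ::
    "vertex list \<Rightarrow> (vertex \<times> vertex \<times> int) list \<Rightarrow> vertex \<Rightarrow> int \<Rightarrow> nat \<Rightarrow> bool" where
  "is_instance vs es s p q \<longleftrightarrow> distinct vs \<and> distinct (map (\<lambda>e. (fst e, fst (snd e))) es) \<and>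
     list_all (\<lambda>e. fst e \<in> set vs \<and> fst (snd e) \<in> set vs) es \<and>
     list_all (\<lambda>u. list_ex (\<lambda>e. fst e = u) es) vs \<and> s \<in> set vs \<and> q \<noteq> 0"

text \<open>Decoding is total and does not check well-formedness. Encoding the result again and comparing it
  with the input does.\<close>

definition accepts :: "bool list \<Rightarrow> bool" where
  "accepts x = (case decode x of (vs, es, s, p, q) \<Rightarrow>
     x = encoding vs es s p q \<and> is_instance vs es s p q \<and> winning vs es s p q)"

lemma polytime_is_instance:
  assumes "polytime vs" "polytime es" "polytime s" "polytime p" "polytime q"
  shows "polytime (\<lambda>x. is_instance (vs x) (es x) (s x) (p x) (q x))"
  unfolding is_instance_def
  by (intro polytime_mem polytime_distinct polytime_eq_vertex polytime_eq_edge polytime_arith polytime_intros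
      polytime_comp[OF assms(1)] polytime_comp[OF assms(2)] polytime_comp[OF assms(3)] polytime_comp[OF assms(5)])

lemma polytime_encoding:
  assumes "polytime vs" "polytime es" "polytime s" "polytime p" "polytime q"
  shows "polytime (\<lambda>x. encoding (vs x) (es x) (s x) (p x) (q x))"
  unfolding encoding_def
  by (intro polytime_field_bits polytime_arith polytime_intros
      polytime_comp[OF assms(1)] polytime_comp[OF assms(2)] polytime_comp[OF assms(3)] polytime_comp[OF assms(4)] polytime_comp[OF assms(5)])

lemma polytime_accepts: "polytime accepts"
  unfolding accepts_def
  by (intro polytime_winning polytime_is_instance polytime_eq_vertex polytime_encoding polytime_intros polytime_comp[OF polytime_decode])

lemma accepts_iff:
  "accepts x \<longleftrightarrow> (\<exists>(G :: bool list game) s_init t.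
     is_game G \<and> states2 G = {} \<and> s_init \<in> states G \<and> encodes x G s_init t \<and>
     player1_wins G s_init (AvgEnergy G t))"
proof
  assume acc: "accepts x"
  obtain vs es s p q where dec: "decode x = (vs, es, s, p, q)" by (metis prod.collapse)
  have x: "x = encoding vs es s p q" and inst: "is_instance vs es s p q" and win: "winning vs es s p q"
    using acc dec by (auto simp: accepts_def)
  \<comment> \<open>The decoded list fixes the weights of the edges; the value 0 elsewhere is an
    arbitrary choice that makes the function total.\<close>
  define w where "w e = (case map_of (map (\<lambda>(u, v, c). ((u, v), c)) es) e of None \<Rightarrow> 0 | Some c \<Rightarrow> c)" for e
  define es' where "es' = map (\<lambda>e. (fst e, fst (snd e))) es"
  define G :: "bool list game" where
    "G = \<lparr>states1 = set vs, states2 = {}, edges = set es', weight = w\<rparr>"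
  have dist: "distinct vs" "distinct es'" using inst by (auto simp: is_instance_def es'_def)
  have w: "w (u, v) = c" if "(u, v, c) \<in> set es" for u v c
  proof -
    have "map fst (map (\<lambda>(u, v, c). ((u, v), c)) es) = es'" by (auto simp: es'_def)
    then have "map_of (map (\<lambda>(u, v, c). ((u, v), c)) es) (u, v) = Some c"
      using dist(2) that by (intro map_of_is_SomeI) force+
    then show ?thesis by (simp add: w_def)
  qed
  have es: "map (\<lambda>(u, v). (u, v, w (u, v))) es' = es"
    unfolding es'_def using w by (auto intro!: map_idI)
  have mem: "fst e \<in> set vs" "fst (snd e) \<in> set vs" if "e \<in> set es" for e
    using inst that by (simp_all add: is_instance_def list_all_iff)
  have out: "\<exists>e \<in> set es. fst e = u" if "u \<in> set vs" for u
    using inst that by (simp add: is_instance_def list_all_iff list_ex_iff)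
  have "\<exists>v. (u, v) \<in> edges G" if u: "u \<in> set vs" for u
  proof -
    obtain e where "e \<in> set es" "fst e = u" using out[OF u] by blast
    then have "(u, fst (snd e)) \<in> edges G" by (auto simp: G_def es'_def)
    then show ?thesis ..
  qed
  moreover have "edges G \<subseteq> set vs \<times> set vs" using mem by (auto simp: G_def es'_def)
  ultimately have game: "is_game G" unfolding is_game_def states_def by (simp add: G_def)
  have s: "s \<in> states G" using inst by (simp add: is_instance_def G_def states_def)
  have q: "0 < q" using inst by (simp add: is_instance_def)
  have "encodes x G s (of_int p / of_nat q)"
    unfolding encodes_def
    by (intro exI[of _ vs] exI[of _ "[]"] exI[of _ es'] exI[of _ p] exI[of _ q])
      (auto simp: G_def dist q x encoding_eq es)
  moreover have "player1_wins G s (AvgEnergy G (of_int p / of_nat q))"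
  proof (subst winning_iff[OF game _ s q, of vs es])
    have "set es = set (map (\<lambda>(u, v). (u, v, w (u, v))) es')" using es by simp
    then show "set es = (\<lambda>(u, v). (u, v, weight G (u, v))) ` edges G" by (simp add: G_def)
  qed (auto simp: G_def win)
  ultimately show "\<exists>(G :: bool list game) s_init t.
     is_game G \<and> states2 G = {} \<and> s_init \<in> states G \<and> encodes x G s_init t \<and>
     player1_wins G s_init (AvgEnergy G t)"
    using game s by (intro exI[of _ G] exI[of _ s] exI[of _ "of_int p / of_nat q"]) (simp add: G_def)
next
  assume "\<exists>(G :: bool list game) s_init t.
     is_game G \<and> states2 G = {} \<and> s_init \<in> states G \<and> encodes x G s_init t \<and>
     player1_wins G s_init (AvgEnergy G t)"
  then obtain G :: "bool list game" and s t where G: "is_game G" "states2 G = {}" "s \<in> states G"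
    and enc: "encodes x G s t" and wins: "player1_wins G s (AvgEnergy G t)" by blast
  from enc G(2) obtain vs es p q where vs: "distinct vs" "set vs = states1 G"
    and es: "distinct es" "set es = edges G" and q: "0 < q" and t: "t = of_int p / of_nat q"
    and x: "x = concat (map token_bits (instance_tokens vs [] es (weight G) s p q))"
    unfolding encodes_def by auto
  let ?es = "map (\<lambda>(u, v). (u, v, weight G (u, v))) es"
  have "x = encoding vs ?es s p q" unfolding x by (rule encoding_eq)
  moreover have "is_instance vs ?es s p q"
  proof -
    have "map (\<lambda>e. (fst e, fst (snd e))) ?es = es" by (auto intro!: map_idI)
    moreover have edges: "edges G \<subseteq> set vs \<times> set vs" "\<And>u. u \<in> set vs \<Longrightarrow> \<exists>v. (u, v) \<in> edges G"
      using G(1,2) vs(2) by (auto simp: is_game_def states_def)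
    have "fst e \<in> set vs \<and> fst (snd e) \<in> set vs" if "e \<in> set ?es" for e
      using that edges(1) es(2) by auto
    moreover have "\<exists>e \<in> set ?es. fst e = u" if u: "u \<in> set vs" for u
    proof -
      obtain v where "(u, v) \<in> set es" using edges(2)[OF u] es(2) by blast
      then show ?thesis by (intro bexI[of _ "(u, v, weight G (u, v))"]) auto
    qed
    moreover have "s \<in> set vs" using G vs(2) by (simp add: states_def)
    ultimately show ?thesis
      unfolding is_instance_def list_all_iff list_ex_iff using vs(1) es(1) q by simp
  qed
  moreover have "winning vs ?es s p q"
    using wins unfolding t by (subst (asm) winning_iff[OF G q vs(2), of ?es]) (auto simp: es(2))
  ultimately show "accepts x"
    using decode_instance[of vs "[]" es "weight G" s p q] by (simp add: accepts_def x)
qed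

theorem theorem2:
  "{x. \<exists>(G :: bool list game) s_init t.
         is_game G \<and> states2 G = {} \<and> s_init \<in> states G \<and> encodes x G s_init t \<and>
         player1_wins G s_init (AvgEnergy G t)} \<in> PTIME"
  using polytime_imp_PTIME[OF polytime_accepts] unfolding accepts_iff .

end
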